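(* Given a CNF formula $F$ over $n$ variables and $m$ clauses and of size $s$, and a linear branch decomposition $(T,\delta)$ of $F$ of $\mathtt{ps}$-width $k$, one can solve \textsc{\#SAT}, \textsc{MaxSAT} and weighted \textsc{MaxSAT} on $F$ in time $\mathcal{O}(k^2 s(m+n))$.
   Context: A literal is a propositional variable $x$ or its negation $\neg x$; a clause is a finite set of literals; a CNF formula $F$ is a finite multiset of clauses, and $\mathtt{cla}(F)$ denotes its clauses (equal clauses are treated as distinct elements). For a clause $C$, $\mathtt{var}(C)$ is the set of variables of its literals, and $\mathtt{var}(F)=\bigcup_{C\in\mathtt{cla}(F)}\mathtt{var}(C)$. The size of $F$ is $s=|\mathtt{cla}(F)|+\sum_{C\in\mathtt{cla}(F)}|C|$. An assignment of a set $X$ of variables is a map $\tau:X\to\{0,1\}$, extended to literals by $\tau(\neg x)=1-\tau(x)$; it satisfies a clause if some literal of the clause gets value $1$ (the empty clause is never satisfied). \textsc{\#SAT}: compute the number of assignments of $\mathtt{var}(F)$ satisfying all clauses of $F$. Weighted \textsc{MaxSAT}: given also $w:\mathtt{cla}(F)\to\mathbb{N}$ (with total weight at most $2^{\mathcal{O}(|\mathtt{cla}(F)|)}$), find an assignment $\tau$ of $\mathtt{var}(F)$ maximizing the sum of $w(C)$ over clauses $C$ satisfied by $\tau$. \textsc{MaxSAT} is weighted \textsc{MaxSAT} with all weights $1$. For a clause $C$ and a set $X$ of variables, $C|_X=\{\ell\in C:\mathtt{var}(\ell)\in X\}$. For $\mathcal{C}\subseteq\mathtt{cla}(F)$ and $X\subseteq\mathtt{var}(F)$,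 $F_{\mathcal{C},X}$ is the formula with clauses $\{C|_X : C\in\mathcal{C}\}$. For a formula $F$ and an assignment $\tau$ of $\mathtt{var}(F)$, $\mathtt{sat}(F,\tau)$ is the set of clauses of $F$ satisfied by $\tau$, and $\mathtt{PS}(F)=\{\mathtt{sat}(F,\tau):\tau \text{ an assignment of } \mathtt{var}(F)\}$. A branch decomposition of $F$ is a pair $(T,\delta)$ where $T$ is a rooted binary tree and $\delta$ is a bijection from the leaves of $T$ to $\mathtt{cla}(F)\cup\mathtt{var}(F)$; it is linear if the non-leaf nodes of $T$ induce a path. For a node $v$ of $T$, $\delta(v)$ is the set of $\delta(l)$ over leaves $l$ of the subtree rooted at $v$. Writing $\delta(v)=\mathcal{C}\cup X$ with $\mathcal{C}\subseteq\mathtt{cla}(F)$, $X\subseteq\mathtt{var}(F)$, let $F_v=F_{\mathtt{cla}(F)\setminus\mathcal{C},\,X}$ and $F_{\overline{v}}=F_{\mathcal{C},\,\mathtt{var}(F)\setminus X}$; the $\mathtt{ps}$-value of $\delta(v)$ is $\max\{|\mathtt{PS}(F_v)|,|\mathtt{PS}(F_{\overline{v}})|\}$, and the $\mathtt{ps}$-width of $(T,\delta)$ is the maximum $\mathtt{ps}$-value over all nodes $v$ of $T$. *)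

theory Defs
  imports "HOL-Library.Multiset" "HOL-Library.FuncSet"
begin

section \<open>CNF formulas\<close>

datatype 'v lit = Pos (lvar: 'v) | Neg (lvar: 'v)

type_synonym 'v clause = "'v lit set"
type_synonym 'v cnf = "'v clause multiset"

text \<open>Equal clauses of a formula are distinct elements of \<open>cla F\<close>: an occurrence of a clause
  consists of the clause and a number below its multiplicity.\<close>

type_synonym 'v occ = "'v clause \<times> nat"

definition is_cnf :: "'v cnf \<Rightarrow> bool" where
  "is_cnf F \<longleftrightarrow> (\<forall>C\<in>#F. finite C)"

definition cla :: "'v cnf \<Rightarrow> 'v occ set" where
  "cla F = {(C, i). i < count F C}"

definition vars :: "'v cnf \<Rightarrow> 'v set" where
  "vars F = (\<Union>(C, i)\<in>cla F. lvar ` C)"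

definition cnf_size :: "'v cnf \<Rightarrow> nat" where
  "cnf_size F = card (cla F) + (\<Sum>(C, i)\<in>cla F. card C)"

definition assignments :: "'v set \<Rightarrow> ('v \<Rightarrow> bool) set" where
  "assignments X = X \<rightarrow>\<^sub>E UNIV"

fun lit_val :: "('v \<Rightarrow> bool) \<Rightarrow> 'v lit \<Rightarrow> bool" where
  "lit_val \<tau> (Pos x) = \<tau> x"
| "lit_val \<tau> (Neg x) = (\<not> \<tau> x)"

definition satisfies :: "('v \<Rightarrow> bool) \<Rightarrow> 'v clause \<Rightarrow> bool" where
  "satisfies \<tau> C \<longleftrightarrow> (\<exists>l\<in>C. lit_val \<tau> l)"

definition sat :: "'v cnf \<Rightarrow> ('v \<Rightarrow> bool) \<Rightarrow> 'v occ set" where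
  "sat F \<tau> = {(C, i) \<in> cla F. satisfies \<tau> C}"

definition PS :: "'v cnf \<Rightarrow> 'v occ set set" where
  "PS F = sat F ` assignments (vars F)"

text \<open>Distinct occurrences stay distinct when their clauses are restricted to \<open>X\<close>.\<close>

definition restrict_cnf :: "'v cnf \<Rightarrow> 'v occ set \<Rightarrow> 'v set \<Rightarrow> 'v cnf" where
  "restrict_cnf F \<C> X = image_mset (\<lambda>(C, i). {l \<in> C. lvar l \<in> X}) (mset_set \<C>)"

definition num_models :: "'v cnf \<Rightarrow> nat" where
  "num_models F = card {\<tau> \<in> assignments (vars F). sat F \<tau> = cla F}"

definition max_weight_assignment :: "'v cnf \<Rightarrow> ('v occ \<Rightarrow> nat) \<Rightarrow> ('v \<Rightarrow> bool) \<Rightarrow> bool" where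
  "max_weight_assignment F w \<tau> \<longleftrightarrow> \<tau> \<in> assignments (vars F) \<and>
     (\<forall>\<tau>'\<in>assignments (vars F). (\<Sum>c\<in>sat F \<tau>'. w c) \<le> (\<Sum>c\<in>sat F \<tau>. w c))"

section \<open>Branch decompositions\<close>

text \<open>A rooted binary tree in which every non-leaf node has exactly two children.  The bijection
  \<open>\<delta>\<close> is represented by the leaf labels; it is onto and injective iff the list of labels
  enumerates the target without repetition.\<close>

datatype 'a btree = Leaf 'a | Node "'a btree" "'a btree"

fun leaves :: "'a btree \<Rightarrow> 'a list" where
  "leaves (Leaf a) = [a]"
| "leaves (Node l r) = leaves l @ leaves r"

definition branch_decomposition :: "'v cnf \<Rightarrow> ('v occ + 'v) btree \<Rightarrow> bool" where
  "branch_decomposition F D \<longleftrightarrow> distinct (leaves D) \<and> set (leaves D) = cla F <+> vars F"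

text \<open>A node is identified with the sequence of turns (left is \<open>False\<close>, right is \<open>True\<close>) leading
  to it from the root.\<close>

fun nodes :: "'a btree \<Rightarrow> bool list set" where
  "nodes (Leaf a) = {[]}"
| "nodes (Node l r) = {[]} \<union> (#) False ` nodes l \<union> (#) True ` nodes r"

fun inner_nodes :: "'a btree \<Rightarrow> bool list set" where
  "inner_nodes (Leaf a) = {}"
| "inner_nodes (Node l r) = {[]} \<union> (#) False ` inner_nodes l \<union> (#) True ` inner_nodes r"

fun subtree :: "'a btree \<Rightarrow> bool list \<Rightarrow> 'a btree" where
  "subtree t [] = t"
| "subtree (Leaf a) (b # p) = Leaf a"
| "subtree (Node l r) (b # p) = subtree (if b then r else l) p"

definition tree_adj :: "bool list \<Rightarrow> bool list \<Rightarrow> bool" where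
  "tree_adj p q \<longleftrightarrow> (\<exists>b. q = p @ [b] \<or> p = q @ [b])"

definition induces_path :: "('n \<Rightarrow> 'n \<Rightarrow> bool) \<Rightarrow> 'n set \<Rightarrow> bool" where
  "induces_path adj V \<longleftrightarrow> (\<exists>ps. distinct ps \<and> set ps = V \<and>
     (\<forall>i<length ps. \<forall>j<length ps. adj (ps ! i) (ps ! j) \<longleftrightarrow> j = Suc i \<or> i = Suc j))"

text \<open>The path is a path of the underlying undirected tree, so the root may be one of its inner
  nodes.\<close>

definition linear_decomposition :: "'a btree \<Rightarrow> bool" where
  "linear_decomposition D \<longleftrightarrow> induces_path tree_adj (inner_nodes D)"

definition ps_value :: "'v cnf \<Rightarrow> ('v occ + 'v) set \<Rightarrow> nat" where
  "ps_value F S = (let \<C> = Inl -` S; X = Inr -` S in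
     max (card (PS (restrict_cnf F (cla F - \<C>) X)))
         (card (PS (restrict_cnf F \<C> (vars F - X)))))"

definition ps_width :: "'v cnf \<Rightarrow> ('v occ + 'v) btree \<Rightarrow> nat" where
  "ps_width F D = Max ((\<lambda>p. ps_value F (set (leaves (subtree D p)))) ` nodes D)"

section \<open>Random access machine\<close>

text \<open>Running time is measured on a word RAM, programmed in a structured language.  A program has
  finitely many registers and a memory addressed by natural numbers.  One assignment, store or
  test costs one time unit; as a program contains only finitely many expressions, each of fixed
  size, charging every operation separately would only change constant factors.  The parameter
  \<open>B\<close> bounds the words: a computation in which an operand, an intermediate result or an address
  exceeds \<open>B\<close> is stuck, so longer numbers have to be handled word by word.\<close>

datatype expr =
    Num nat
  | Reg nat
  | Load expr
  | Add expr expr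
  | Sub expr expr
  | Mul expr expr
  | Div expr expr

datatype com =
    Skip
  | Assign nat expr
  | Store expr expr  \<comment> \<open>address, value\<close>
  | Seq com com
  | If expr com com
  | While expr com

type_synonym state = "(nat \<Rightarrow> nat) \<times> (nat \<Rightarrow> nat)"  \<comment> \<open>registers, memory\<close>

fun val :: "expr \<Rightarrow> state \<Rightarrow> nat" where
  "val (Num n) s = n"
| "val (Reg x) s = fst s x"
| "val (Load e) s = snd s (val e s)"
| "val (Add e f) s = val e s + val f s"
| "val (Sub e f) s = val e s - val f s"
| "val (Mul e f) s = val e s * val f s"
| "val (Div e f) s = val e s div val f s"

fun fits :: "nat \<Rightarrow> expr \<Rightarrow> state \<Rightarrow> bool" where
  "fits B (Num n) s \<longleftrightarrow> n \<le> B"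
| "fits B (Reg x) s \<longleftrightarrow> fst s x \<le> B"
| "fits B (Load e) s \<longleftrightarrow> fits B e s \<and> val (Load e) s \<le> B"
| "fits B (Add e f) s \<longleftrightarrow> fits B e s \<and> fits B f s \<and> val (Add e f) s \<le> B"
| "fits B (Sub e f) s \<longleftrightarrow> fits B e s \<and> fits B f s"
| "fits B (Mul e f) s \<longleftrightarrow> fits B e s \<and> fits B f s \<and> val (Mul e f) s \<le> B"
| "fits B (Div e f) s \<longleftrightarrow> fits B e s \<and> fits B f s"

text \<open>\<open>exec B p s t s'\<close>: started in state \<open>s\<close>, program \<open>p\<close> halts in state \<open>s'\<close> after exactly \<open>t\<close>
  steps.  The rules are deterministic.\<close>

inductive exec :: "nat \<Rightarrow> com \<Rightarrow> state \<Rightarrow> nat \<Rightarrow> state \<Rightarrow> bool" for B where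
  Skip: "exec B Skip s 1 s"
| Assign: "fits B e s \<Longrightarrow> exec B (Assign x e) s 1 ((fst s)(x := val e s), snd s)"
| Store: "fits B a s \<Longrightarrow> fits B e s \<Longrightarrow>
    exec B (Store a e) s 1 (fst s, (snd s)(val a s := val e s))"
| Seq: "exec B p s t s' \<Longrightarrow> exec B q s' t' s'' \<Longrightarrow> exec B (Seq p q) s (t + t') s''"
| IfTrue: "fits B e s \<Longrightarrow> val e s \<noteq> 0 \<Longrightarrow> exec B p s t s' \<Longrightarrow> exec B (If e p q) s (Suc t) s'"
| IfFalse: "fits B e s \<Longrightarrow> val e s = 0 \<Longrightarrow> exec B q s t s' \<Longrightarrow> exec B (If e p q) s (Suc t) s'"
| WhileFalse: "fits B e s \<Longrightarrow> val e s = 0 \<Longrightarrow> exec B (While e p) s 1 s"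
| WhileTrue: "fits B e s \<Longrightarrow> val e s \<noteq> 0 \<Longrightarrow> exec B p s t s' \<Longrightarrow>
    exec B (While e p) s' t' s'' \<Longrightarrow> exec B (While e p) s (Suc (t + t')) s''"

definition input_memory :: "nat list \<Rightarrow> nat \<Rightarrow> nat" where
  "input_memory ws a =
     (if a = 0 then length ws else if a \<le> length ws then ws ! (a - 1) else 0)"

definition output_of :: "(nat \<Rightarrow> nat) \<Rightarrow> nat list" where
  "output_of \<mu> = map (\<lambda>i. \<mu> (Suc i)) [0..<\<mu> 0]"

text \<open>Program \<open>P\<close>, run on input \<open>ws\<close>, halts within \<open>c * T\<close> steps with an output satisfying \<open>Q\<close>.
  The word bound is polynomial in \<open>T\<close>, that is, words have \<open>O(log T)\<close> bits, as is needed to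
  address a memory of size \<open>T\<close>.\<close>

definition computes_within :: "com \<Rightarrow> nat \<Rightarrow> nat \<Rightarrow> nat list \<Rightarrow> (nat list \<Rightarrow> bool) \<Rightarrow> bool" where
  "computes_within P c T ws Q \<longleftrightarrow>
     (\<exists>t \<sigma> \<mu>. t \<le> c * T \<and> exec (c * T ^ c) P (\<lambda>_. 0, input_memory ws) t (\<sigma>, \<mu>) \<and>
        Q (output_of \<mu>))"

section \<open>Input and output formats\<close>

text \<open>An input lists the variables (\<open>xs\<close>), the clauses (\<open>cs\<close>) and the literals of every clause
  (\<open>ls\<close>) in an arbitrary order, without repetitions.\<close>

definition presentation ::
  "'v cnf \<Rightarrow> 'v list \<Rightarrow> 'v occ list \<Rightarrow> ('v occ \<Rightarrow> 'v lit list) \<Rightarrow> bool" where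
  "presentation F xs cs ls \<longleftrightarrow>
     distinct xs \<and> set xs = vars F \<and> distinct cs \<and> set cs = cla F \<and>
     (\<forall>c\<in>cla F. distinct (ls c) \<and> set (ls c) = fst c)"

definition pos_in :: "'a list \<Rightarrow> 'a \<Rightarrow> nat" where
  "pos_in xs x = length (takeWhile (\<lambda>y. y \<noteq> x) xs)"

fun encode_lit :: "'v list \<Rightarrow> 'v lit \<Rightarrow> nat" where
  "encode_lit xs (Pos x) = 2 * pos_in xs x"
| "encode_lit xs (Neg x) = 2 * pos_in xs x + 1"

definition encode_cnf ::
  "'v list \<Rightarrow> 'v occ list \<Rightarrow> ('v occ \<Rightarrow> 'v lit list) \<Rightarrow> nat list" where
  "encode_cnf xs cs ls = [length cs, length xs] @
     concat (map (\<lambda>c. length (ls c) # map (encode_lit xs) (ls c)) cs)"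

fun encode_label :: "'v list \<Rightarrow> 'v occ list \<Rightarrow> 'v occ + 'v \<Rightarrow> nat" where
  "encode_label xs cs (Inl c) = pos_in cs c"
| "encode_label xs cs (Inr x) = length cs + pos_in xs x"

fun encode_tree :: "('a \<Rightarrow> nat) \<Rightarrow> 'a btree \<Rightarrow> nat list" where
  "encode_tree g (Leaf a) = [0, g a]"
| "encode_tree g (Node l r) = 1 # encode_tree g l @ encode_tree g r"

definition encode_instance ::
  "'v list \<Rightarrow> 'v occ list \<Rightarrow> ('v occ \<Rightarrow> 'v lit list) \<Rightarrow> ('v occ + 'v) btree \<Rightarrow> nat list" where
  "encode_instance xs cs ls D = encode_cnf xs cs ls @ encode_tree (encode_label xs cs) D"

text \<open>Weights and numbers of models may exceed the word bound, so they are given bit by bit,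
  least significant bit first.\<close>

fun binary :: "nat \<Rightarrow> nat list" where
  "binary n = (if n = 0 then [] else n mod 2 # binary (n div 2))"

declare binary.simps [simp del]

definition encode_weights :: "'c list \<Rightarrow> ('c \<Rightarrow> nat) \<Rightarrow> nat list" where
  "encode_weights cs w = concat (map (\<lambda>c. length (binary (w c)) # binary (w c)) cs)"

definition represents_number :: "nat list \<Rightarrow> nat \<Rightarrow> bool" where
  "represents_number ws N \<longleftrightarrow> set ws \<subseteq> {0, 1} \<and> horner_sum id 2 ws = N"

definition represents_assignment :: "'v list \<Rightarrow> nat list \<Rightarrow> ('v \<Rightarrow> bool) \<Rightarrow> bool" where
  "represents_assignment xs ws \<tau> \<longleftrightarrow> ws = map (\<lambda>x. if \<tau> x then 1 else 0) xs"

text \<open>The legal inputs: a formula with a linear branch decomposition of \<open>ps\<close>-width \<open>k\<close>, presented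
  by \<open>xs\<close>, \<open>cs\<close>, \<open>ls\<close>, and its parameters.  Variables are named by natural numbers, but programs only
  see their positions in \<open>xs\<close>.\<close>

definition linear_instance ::
  "nat cnf \<Rightarrow> (nat occ + nat) btree \<Rightarrow> nat list \<Rightarrow> nat occ list \<Rightarrow> (nat occ \<Rightarrow> nat lit list) \<Rightarrow>
   nat \<Rightarrow> nat \<Rightarrow> nat \<Rightarrow> nat \<Rightarrow> bool" where
  "linear_instance F D xs cs ls n m s k \<longleftrightarrow>
     is_cnf F \<and> card (vars F) = n \<and> card (cla F) = m \<and> cnf_size F = s \<and>
     branch_decomposition F D \<and> linear_decomposition D \<and> ps_width F D = k \<and>
     presentation F xs cs ls"

end

theory Submission
  imports Defs
begin

text \<open>The inner nodes of a linear decomposition form a path, so its leaves can be ordered such that every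
  prefix of the order or its complement is the leaf set of a node.  Put the clauses and variables in
  this order.  A partial assignment of the first \<open>i\<close> elements matters only through the set of later
  clauses it satisfies, and an assignment of the remaining elements only through the set of earlier
  clauses it satisfies; by the bound on the width there are at most \<open>k\<close> sets of either kind.  Both
  families are computed level by level, as bit vectors without repetitions, together with the maps
  between consecutive levels.  A table indexed by pairs of such sets, where the second set is a
  promise of what the remaining elements will satisfy, then yields the number of models, or the
  maximal weight and, by backtracking, an assignment.  Table entries are numbers of \<open>O(m + n)\<close> or
  \<open>O(m)\<close> bits, which are handled bit by bit in time \<open>O(s)\<close>.

  For the running time, programs are written in a language with \<open>for\<close> loops over an associative memory
  indexed by lists of numbers.  These lists are mapped to addresses by a pairing function that is
  polynomial, so that compiled programs respect the word bound.\<close>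


section \<open>A language with bounded loops\<close>

text \<open>Why a level costs \<open>k^2\<close> and not \<open>k^3\<close> table steps: a step at
  element \<open>i\<close> is fixed by a branch \<open>b\<close>, a forward set \<open>p\<close>
  before \<open>i\<close> and a promise \<open>q\<close> for what comes after \<open>i\<close>.
  These determine both the forward set after \<open>i\<close> (by \<open>FA\<close>) and the promise
  before \<open>i\<close> (by \<open>FB\<close>), so each triple updates one entry from one other
  entry and no compatible partner has to be searched for. The two families overlap only in the
  clause at position \<open>i\<close> itself, and that is where the clause is checked or its weight
  is credited. The program never needs to know \<open>k\<close>. Removing duplicates keeps each
  level as small as the width guarantees, and \<open>k\<close> enters only the analysis. Comparing a
  candidate with all earlier rows costs \<open>O(k m)\<close>, hence \<open>O(k^2 m)\<close> per
  level, which the claimed time allows. The remaining obstacle is the word bound. Indices, labels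
  and addresses of the input are linear in \<open>T = k^2 s (m + n)\<close>, and a fixed expression
  over such words is polynomial in \<open>T\<close>; only counts and weights outgrow it and are
  split into bits.\<close>

datatype hexp = HNum nat | HReg nat | HInp hexp | HGet "hexp list"
  | HAdd hexp hexp | HSub hexp hexp | HMul hexp hexp | HDiv hexp hexp

datatype prog = PSkip | PAsg nat hexp | PSto "hexp list" hexp | PSeq prog prog
  | PIf hexp prog prog | PFor nat hexp prog

fun hval :: "(nat \<Rightarrow> nat) \<Rightarrow> hexp \<Rightarrow> (nat \<Rightarrow> nat) \<Rightarrow> (nat list \<Rightarrow> nat) \<Rightarrow> nat" where
  "hval inp (HNum n) r \<mu> = n"
| "hval inp (HReg x) r \<mu> = r x"
| "hval inp (HInp e) r \<mu> = inp (hval inp e r \<mu>)"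
| "hval inp (HGet es) r \<mu> = \<mu> (map (\<lambda>e. hval inp e r \<mu>) es)"
| "hval inp (HAdd e f) r \<mu> = hval inp e r \<mu> + hval inp f r \<mu>"
| "hval inp (HSub e f) r \<mu> = hval inp e r \<mu> - hval inp f r \<mu>"
| "hval inp (HMul e f) r \<mu> = hval inp e r \<mu> * hval inp f r \<mu>"
| "hval inp (HDiv e f) r \<mu> = hval inp e r \<mu> div hval inp f r \<mu>"

type_synonym post = "(nat \<Rightarrow> nat) \<Rightarrow> (nat list \<Rightarrow> nat) \<Rightarrow> nat \<Rightarrow> bool"

text \<open>The transformer \<open>W\<close> of the body is an argument, so that \<open>wp\<close>
  can stay primitive recursive in the program.\<close>

primrec loop :: "(post \<Rightarrow> (nat \<Rightarrow> nat) \<Rightarrow> (nat list \<Rightarrow> nat) \<Rightarrow> bool) \<Rightarrow> nat \<Rightarrow> nat \<Rightarrow>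
    post \<Rightarrow> (nat \<Rightarrow> nat) \<Rightarrow> (nat list \<Rightarrow> nat) \<Rightarrow> bool" where
  "loop W i 0 Q r \<mu> = Q r \<mu> 0"
| "loop W i (Suc n) Q r \<mu> =
     W (\<lambda>r' \<mu>' t. loop W i n (\<lambda>r'' \<mu>'' t'. Q r'' \<mu>'' (Suc (t + t'))) (r'(i := Suc (r i))) \<mu>') r \<mu>"

text \<open>Besides registers and memory, a postcondition is given the number of loop iterations, to which the
  running time is proportional.  Stored values have to be at most \<open>V\<close>; intermediate values are then
  polynomial in \<open>V\<close>.\<close>

primrec wp :: "(nat \<Rightarrow> nat) \<Rightarrow> nat \<Rightarrow> prog \<Rightarrow> post \<Rightarrow> (nat \<Rightarrow> nat) \<Rightarrow> (nat list \<Rightarrow> nat) \<Rightarrow> bool" where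
  "wp inp V PSkip Q r \<mu> = Q r \<mu> 0"
| "wp inp V (PAsg x e) Q r \<mu> = (hval inp e r \<mu> \<le> V \<and> Q (r(x := hval inp e r \<mu>)) \<mu> 0)"
| "wp inp V (PSto es e) Q r \<mu> = (hval inp e r \<mu> \<le> V \<and>
     Q r (\<mu>(map (\<lambda>e. hval inp e r \<mu>) es := hval inp e r \<mu>)) 0)"
| "wp inp V (PSeq p q) Q r \<mu> = wp inp V p (\<lambda>r' \<mu>' t. wp inp V q (\<lambda>r'' \<mu>'' t'. Q r'' \<mu>'' (t + t')) r' \<mu>') r \<mu>"
| "wp inp V (PIf e p q) Q r \<mu> = (if hval inp e r \<mu> \<noteq> 0 then wp inp V p Q r \<mu> else wp inp V q Q r \<mu>)"
| "wp inp V (PFor i e p) Q r \<mu> = (hval inp e r \<mu> \<le> V \<and>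
     loop (wp inp V p) i (hval inp e r \<mu>) Q (r(i := 0)) \<mu>)"

primrec modr :: "prog \<Rightarrow> nat set" where
  "modr PSkip = {}"
| "modr (PAsg x e) = {x}"
| "modr (PSto es e) = {}"
| "modr (PSeq p q) = modr p \<union> modr q"
| "modr (PIf e p q) = modr p \<union> modr q"
| "modr (PFor i e p) = insert i (modr p)"

text \<open>Arrays are told apart by a literal first index. A key of any other shape may hit every
  array, so all of them count as modified.\<close>

fun key_name :: "hexp list \<Rightarrow> nat set" where
  "key_name (HNum a # es) = {a}"
| "key_name es = UNIV"

primrec modm :: "prog \<Rightarrow> nat set" where
  "modm PSkip = {}"
| "modm (PAsg x e) = {}"
| "modm (PSto es e) = key_name es"
| "modm (PSeq p q) = modm p \<union> modm q"
| "modm (PIf e p q) = modm p \<union> modm q"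
| "modm (PFor i e p) = modm p"

text \<open>\<open>loop\<close> advances the counter from its value before the body, whereas
  compiled code increments the register that the body leaves behind. Both agree when the body does
  not assign the counter, which also rules out nested loops over the same register.\<close>

primrec wf_prog :: "prog \<Rightarrow> bool" where
  "wf_prog PSkip = True"
| "wf_prog (PAsg x e) = True"
| "wf_prog (PSto es e) = True"
| "wf_prog (PSeq p q) = (wf_prog p \<and> wf_prog q)"
| "wf_prog (PIf e p q) = (wf_prog p \<and> wf_prog q)"
| "wf_prog (PFor i e p) = (i \<notin> modr p \<and> wf_prog p)"

section \<open>Rules for weakest preconditions: monotonicity, frames and loop invariants\<close>

lemma loop_mono:
  assumes W: "\<And>Q Q' r \<mu>. W Q r \<mu> \<Longrightarrow> (\<And>r' \<mu>' t. Q r' \<mu>' t \<Longrightarrow> Q' r' \<mu>' t) \<Longrightarrow> W Q' r \<mu>"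
    and "loop W i n Q r \<mu>" and "\<And>r' \<mu>' t. Q r' \<mu>' t \<Longrightarrow> Q' r' \<mu>' t"
  shows "loop W i n Q' r \<mu>"
  using assms(2,3)
proof (induction n arbitrary: Q Q' r \<mu>)
  case (Suc n)
  show ?case
    unfolding loop.simps
    by (rule W[OF Suc.prems(1)[unfolded loop.simps]]) (rule Suc.IH, assumption, rule Suc.prems(2))
qed simp

lemma wp_mono:
  "wp inp V p Q r \<mu> \<Longrightarrow> (\<And>r' \<mu>' t. Q r' \<mu>' t \<Longrightarrow> Q' r' \<mu>' t) \<Longrightarrow> wp inp V p Q' r \<mu>"
proof (induction p arbitrary: Q Q' r \<mu>)
  case (PSeq p q)
  show ?case
    unfolding wp.simps
    by (rule PSeq.IH(1)[OF PSeq.prems(1)[unfolded wp.simps]]) (rule PSeq.IH(2), assumption, rule PSeq.prems(2))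
next
  case (PIf e p q)
  then show ?case by (auto split: if_splits)
next
  case (PFor i e p)
  have "loop (wp inp V p) i (hval inp e r \<mu>) Q (r(i := 0)) \<mu>" using PFor.prems by simp
  then have "loop (wp inp V p) i (hval inp e r \<mu>) Q' (r(i := 0)) \<mu>"
    by (rule loop_mono[rotated 1]) (use PFor in blast)+
  then show ?case using PFor.prems by simp
qed auto

definition frame :: "prog \<Rightarrow> (nat \<Rightarrow> nat) \<Rightarrow> (nat list \<Rightarrow> nat) \<Rightarrow> (nat \<Rightarrow> nat) \<Rightarrow> (nat list \<Rightarrow> nat) \<Rightarrow> bool" where
  "frame p r \<mu> r' \<mu>' \<longleftrightarrow> (\<forall>x. x \<notin> modr p \<longrightarrow> r' x = r x) \<and>
     (\<forall>a ks. a \<notin> modm p \<longrightarrow> \<mu>' (a # ks) = \<mu> (a # ks))"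

lemma key_nameD: "a \<notin> key_name es \<Longrightarrow> map (\<lambda>e. hval inp e r \<mu>) es \<noteq> a # ks"
  by (induction es rule: key_name.induct) auto

text \<open>\<open>j\<close> counts the iterations already done; keeping it general lets the
  induction on the remaining ones shift the invariant. An iteration is charged \<open>Suc T\<close>:
  one for itself and \<open>T\<close> for the loops inside it.\<close>

lemma loop_inv:
  assumes mono: "\<And>Q Q' r \<mu>. W Q r \<mu> \<Longrightarrow> (\<And>r' \<mu>' t. Q r' \<mu>' t \<Longrightarrow> Q' r' \<mu>' t) \<Longrightarrow> W Q' r \<mu>"
    and I0: "I j r \<mu>"
    and step: "\<And>j' r' \<mu>'. j \<le> j' \<Longrightarrow> j' < j + n \<Longrightarrow> I j' r' \<mu>' \<Longrightarrow>
      W (\<lambda>r'' \<mu>'' t. t \<le> T \<and> I (Suc j') (r''(i := Suc (r' i))) \<mu>'') r' \<mu>'"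
    and fin: "\<And>r' \<mu>' t. I (j + n) r' \<mu>' \<Longrightarrow> t \<le> n * Suc T \<Longrightarrow> Q r' \<mu>' t"
  shows "loop W i n Q r \<mu>"
  using I0 step fin
proof (induction n arbitrary: j r \<mu> Q)
  case (Suc n)
  show ?case
    unfolding loop.simps
  proof (rule mono[OF Suc.prems(2)[of j r \<mu>]])
    fix r' \<mu>' t assume a: "t \<le> T \<and> I (Suc j) (r'(i := Suc (r i))) \<mu>'"
    show "loop W i n (\<lambda>r'' \<mu>'' t'. Q r'' \<mu>'' (Suc (t + t'))) (r'(i := Suc (r i))) \<mu>'"
    proof (rule Suc.IH[of "Suc j"])
      fix j' r' \<mu>' assume "Suc j \<le> j'" "j' < Suc j + n" "I j' r' \<mu>'"
      then show "W (\<lambda>r'' \<mu>'' t. t \<le> T \<and> I (Suc j') (r''(i := Suc (r' i))) \<mu>'') r' \<mu>'"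
        by (intro Suc.prems(2)) auto
    next
      fix r' \<mu>' t' assume "I (Suc j + n) r' \<mu>'" "t' \<le> n * Suc T"
      then show "Q r' \<mu>' (Suc (t + t'))" using a by (intro Suc.prems(3)) auto
    qed (use a in blast)
  qed (use Suc.prems in auto)
qed simp

text \<open>A specification may thus speak only about what changes; everything else is recovered
  from the syntactic sets \<open>modr\<close> and \<open>modm\<close>.\<close>

lemma wp_frame:
  "wp inp V p Q r \<mu> \<Longrightarrow> wp inp V p (\<lambda>r' \<mu>' t. frame p r \<mu> r' \<mu>' \<and> Q r' \<mu>' t) r \<mu>"
proof (induction p arbitrary: Q r \<mu>)
  case (PSto es e)
  then have "wp inp V (PSto es e) Q r \<mu>" by simp
  moreover have "frame (PSto es e) r \<mu> r (\<mu>(map (\<lambda>e. hval inp e r \<mu>) es := v))" for v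
  proof -
    have "(\<mu>(map (\<lambda>e. hval inp e r \<mu>) es := v)) (a # ks) = \<mu> (a # ks)" if "a \<notin> key_name es" for a ks
      by (rule fun_upd_other[OF key_nameD[OF that, symmetric]])
    then show ?thesis unfolding frame_def by simp
  qed
  ultimately show ?case by simp
next
  case (PSeq p q)
  have 1: "wp inp V p (\<lambda>r' \<mu>' t. wp inp V q (\<lambda>r'' \<mu>'' t'. Q r'' \<mu>'' (t + t')) r' \<mu>') r \<mu>"
    using PSeq.prems by simp
  show ?case
    unfolding wp.simps
  proof (rule wp_mono[OF PSeq.IH(1)[OF 1]])
    fix r' \<mu>' t
    assume a: "frame p r \<mu> r' \<mu>' \<and> wp inp V q (\<lambda>r'' \<mu>'' t'. Q r'' \<mu>'' (t + t')) r' \<mu>'"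
    then have "wp inp V q (\<lambda>r'' \<mu>'' t'. frame q r' \<mu>' r'' \<mu>'' \<and> Q r'' \<mu>'' (t + t')) r' \<mu>'"
      by (intro PSeq.IH(2)) simp
    then show "wp inp V q (\<lambda>r'' \<mu>'' t'. frame (PSeq p q) r \<mu> r'' \<mu>'' \<and> Q r'' \<mu>'' (t + t')) r' \<mu>'"
      by (rule wp_mono) (use a in \<open>auto simp: frame_def\<close>)
  qed
next
  case (PIf e p q)
  have "wp inp V p (\<lambda>r' \<mu>' t. frame (PIf e p q) r \<mu> r' \<mu>' \<and> Q r' \<mu>' t) r \<mu>" if "wp inp V p Q r \<mu>"
    by (rule wp_mono[OF PIf.IH(1)[OF that]]) (auto simp: frame_def)
  moreover have "wp inp V q (\<lambda>r' \<mu>' t. frame (PIf e p q) r \<mu> r' \<mu>' \<and> Q r' \<mu>' t) r \<mu>" if "wp inp V q Q r \<mu>"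
    by (rule wp_mono[OF PIf.IH(2)[OF that]]) (auto simp: frame_def)
  ultimately show ?case using PIf.prems by (auto split: if_splits)
next
  case (PFor i e p)
  \<comment> \<open>\<open>r0\<close> and \<open>\<mu>0\<close> belong to the state before the whole
    loop. The frame must be measured from there rather than from the current iteration for the
    induction to go through.\<close>
  have *: "loop (wp inp V p) i n (\<lambda>r' \<mu>' t. frame (PFor i e p) r0 \<mu>0 r' \<mu>' \<and> Q r' \<mu>' t) r \<mu>"
    if "loop (wp inp V p) i n Q r \<mu>" "frame (PFor i e p) r0 \<mu>0 r \<mu>" for n r \<mu> r0 \<mu>0 Q
    using that
  proof (induction n arbitrary: r \<mu> Q)
    case (Suc n)
    note [simp del] = fun_upd_apply
    show ?case
      unfolding loop.simps
    proof (rule wp_mono[OF PFor.IH[OF Suc.prems(1)[unfolded loop.simps]]], rule Suc.IH)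
      fix r' \<mu>' t
      assume "frame p r \<mu> r' \<mu>' \<and> loop (wp inp V p) i n (\<lambda>r'' \<mu>'' t'. Q r'' \<mu>'' (Suc (t + t'))) (r'(i := Suc (r i))) \<mu>'"
      then show "frame (PFor i e p) r0 \<mu>0 (r'(i := Suc (r i))) \<mu>'"
        using Suc.prems(2) by (auto simp: frame_def fun_upd_apply)
    qed simp
  qed simp
  show ?case using PFor.prems *[of "hval inp e r \<mu>" Q "r(i := 0)" \<mu> r \<mu>] by (simp add: frame_def)
qed (auto simp: frame_def)

text \<open>The invariant of a loop may assume that whatever the body does not modify is unchanged.\<close>

lemma wp_For:
  assumes "hval inp e r \<mu> \<le> V"
    and "\<And>r' . (\<forall>x. x \<noteq> i \<longrightarrow> r' x = r x) \<Longrightarrow> r' i = 0 \<Longrightarrow> I 0 r' \<mu>"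
    and "\<And>j r' \<mu>'. j < hval inp e r \<mu> \<Longrightarrow> I j r' \<mu>' \<Longrightarrow> r' i = j \<Longrightarrow> frame (PFor i e p) r \<mu> r' \<mu>' \<Longrightarrow>
      wp inp V p (\<lambda>r'' \<mu>'' t. t \<le> T \<and> I (Suc j) (r''(i := Suc j)) \<mu>'') r' \<mu>'"
    and "\<And>r' \<mu>' t. I (hval inp e r \<mu>) r' \<mu>' \<Longrightarrow> r' i = hval inp e r \<mu> \<Longrightarrow> frame (PFor i e p) r \<mu> r' \<mu>' \<Longrightarrow>
      t \<le> hval inp e r \<mu> * Suc T \<Longrightarrow> Q r' \<mu>' t"
  shows "wp inp V (PFor i e p) Q r \<mu>"
proof -
  have "loop (wp inp V p) i (hval inp e r \<mu>) Q (r(i := 0)) \<mu>"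
  proof (rule loop_inv[where j = 0 and T = T and
        I = "\<lambda>j r' \<mu>'. I j r' \<mu>' \<and> r' i = j \<and> frame (PFor i e p) r \<mu> r' \<mu>'"])
    fix Q Q' r \<mu> assume "wp inp V p Q r \<mu>" "\<And>r' \<mu>' t. Q r' \<mu>' t \<Longrightarrow> Q' r' \<mu>' t"
    then show "wp inp V p Q' r \<mu>" by (rule wp_mono)
  next
    fix j' r' \<mu>'
    assume a: "j' < 0 + hval inp e r \<mu>" "I j' r' \<mu>' \<and> r' i = j' \<and> frame (PFor i e p) r \<mu> r' \<mu>'"
    have "wp inp V p (\<lambda>r'' \<mu>'' t. frame p r' \<mu>' r'' \<mu>'' \<and> t \<le> T \<and> I (Suc j') (r''(i := Suc j')) \<mu>'') r' \<mu>'"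
      by (rule wp_frame, rule assms(3)) (use a in auto)
    then show "wp inp V p (\<lambda>r'' \<mu>'' t. t \<le> T \<and> I (Suc j') (r''(i := Suc (r' i))) \<mu>'' \<and>
        (r''(i := Suc (r' i))) i = Suc j' \<and> frame (PFor i e p) r \<mu> (r''(i := Suc (r' i))) \<mu>'') r' \<mu>'"
      by (rule wp_mono) (use a in \<open>auto simp: frame_def\<close>)
  qed (use assms in \<open>auto simp: frame_def\<close>)
  then show ?thesis using assms(1) by simp
qed

section \<open>Compilation\<close>

text \<open>The pairing \<open>(x + y)^2 + x\<close> is a polynomial, so an address is the value of
  one expression. The rest of the key occurs in it twice, which is harmless because keys have
  constant length.\<close>

fun addr :: "expr list \<Rightarrow> expr" where
  "addr [] = Num 0"
| "addr (e # es) = Add (Num 1) (Add (Mul (Add e (addr es)) (Add e (addr es))) e)"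

fun code :: "nat list \<Rightarrow> nat" where
  "code [] = 0"
| "code (x # xs) = Suc ((x + code xs) * (x + code xs) + x)"

text \<open>\<open>s^2 + a\<close> with \<open>a <= s\<close> lies strictly below
  \<open>(s + 1)^2\<close>, so it determines \<open>s = a + b\<close>, and then
  \<open>a\<close>.\<close>

lemma square_pair_inj:
  assumes "(a + b) * (a + b) + a = (c + d) * (c + d) + (c::nat)"
  shows "a = c \<and> b = d"
proof -
  have lt: False if "x < y" "x * x + u = y * y + v" "u \<le> x" for x y u v :: nat
  proof -
    have "Suc x * Suc x \<le> y * y" using that by (intro mult_le_mono) auto
    then show False using that by simp
  qed
  have "a + b = c + d"
    using lt[of "a+b" "c+d" a c] lt[of "c+d" "a+b" c a] assms by (metis le_add1 linorder_neqE_nat)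
  then show ?thesis using assms by simp
qed

lemma code_inj: "code xs = code ys \<longleftrightarrow> xs = ys"
proof (induction xs arbitrary: ys)
  case (Cons x xs)
  show ?case
  proof (cases ys)
    case (Cons y ys')
    have "code (x # xs) = code (y # ys') \<Longrightarrow> x = y \<and> code xs = code ys'"
      using square_pair_inj[of x "code xs" y "code ys'"] by simp
    then show ?thesis using Cons Cons.IH by auto
  qed simp
qed (case_tac ys, auto)

text \<open>The arrays live behind the input, so a read of the input must yield 0 there although the
  memory does not. The nested truncated subtractions give the factor 1 for addresses below
  \<open>Reg 0\<close> and 0 from it on.\<close>

fun compile_exp :: "hexp \<Rightarrow> expr" where
  "compile_exp (HNum n) = Num n"
| "compile_exp (HReg x) = Reg (2 * x + 1)"
| "compile_exp (HInp e) = Mul (Load (compile_exp e)) (Sub (Num 1) (Sub (Num 1) (Sub (Reg 0) (compile_exp e))))"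
| "compile_exp (HGet es) = Load (Add (Reg 0) (addr (map compile_exp es)))"
| "compile_exp (HAdd e f) = Add (compile_exp e) (compile_exp f)"
| "compile_exp (HSub e f) = Sub (compile_exp e) (compile_exp f)"
| "compile_exp (HMul e f) = Mul (compile_exp e) (compile_exp f)"
| "compile_exp (HDiv e f) = Div (compile_exp e) (compile_exp f)"

text \<open>Register \<open>0\<close> holds the first address behind the input; \<open>2 * i + 2\<close> holds the bound of the loop
  over \<open>i\<close>.\<close>

primrec compile :: "prog \<Rightarrow> com" where
  "compile PSkip = Skip"
| "compile (PAsg x e) = Assign (2 * x + 1) (compile_exp e)"
| "compile (PSto es e) = Store (Add (Reg 0) (addr (map compile_exp es))) (compile_exp e)"
| "compile (PSeq p q) = Seq (compile p) (compile q)"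
| "compile (PIf e p q) = If (compile_exp e) (compile p) (compile q)"
| "compile (PFor i e p) = Seq (Assign (2 * i + 2) (compile_exp e)) (Seq (Assign (2 * i + 1) (Num 0))
     (While (Sub (Reg (2 * i + 2)) (Reg (2 * i + 1)))
        (Seq (compile p) (Assign (2 * i + 1) (Add (Reg (2 * i + 1)) (Num 1))))))"

definition conc :: "(nat \<Rightarrow> nat) \<Rightarrow> nat \<Rightarrow> (nat \<Rightarrow> nat) \<Rightarrow> (nat list \<Rightarrow> nat) \<Rightarrow> state \<Rightarrow> bool" where
  "conc inp off r \<mu> s \<longleftrightarrow> fst s 0 = off \<and> (\<forall>x. fst s (2 * x + 1) = r x) \<and>
     (\<forall>j<off. snd s j = inp j) \<and> (\<forall>ks. snd s (off + code ks) = \<mu> ks)"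

definition bnd :: "nat \<Rightarrow> state \<Rightarrow> bool" where
  "bnd V s \<longleftrightarrow> (\<forall>x. fst s x \<le> V) \<and> (\<forall>a. snd s a \<le> V)"

text \<open>An exponent: if all stored words are at most \<open>V\<close> and \<open>2 <= V\<close>,
  then an expression has value at most \<open>V ^ esz e\<close>. Numerals count with their value
  because \<open>n < 2 ^ n\<close>; a load counts only its address, since what it returns is at most
  \<open>V\<close> again.\<close>

fun esz :: "expr \<Rightarrow> nat" where
  "esz (Num n) = Suc n"
| "esz (Reg x) = 1"
| "esz (Load e) = esz e"
| "esz (Add e f) = esz e + esz f"
| "esz (Sub e f) = esz e + esz f"
| "esz (Mul e f) = esz e + esz f"
| "esz (Div e f) = esz e + esz f"

primrec cesz :: "com \<Rightarrow> nat" where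
  "cesz Skip = 1"
| "cesz (Assign x e) = esz e"
| "cesz (Store a e) = esz a + esz e"
| "cesz (Seq p q) = cesz p + cesz q"
| "cesz (If e p q) = esz e + cesz p + cesz q"
| "cesz (While e p) = esz e + cesz p"

lemma esz_pos: "1 \<le> esz e"
  by (induction e) auto

lemma val_bound:
  assumes "bnd V s" "2 \<le> V"
  shows "val e s \<le> V ^ esz e"
proof (induction e)
  case (Num n)
  have "n < 2 ^ n" by simp
  also have "2 ^ n \<le> V ^ n" using assms by (intro power_mono) auto
  also have "\<dots> \<le> V ^ Suc n" using assms by (intro power_increasing) auto
  finally show ?case by simp
next
  case (Reg x)
  then show ?case using assms by (simp add: bnd_def)
next
  case (Load e)
  have "val (Load e) s \<le> V ^ 1" using assms by (simp add: bnd_def)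
  also have "\<dots> \<le> V ^ esz e" using assms esz_pos[of e] by (intro power_increasing) auto
  finally show ?case by simp
next
  case (Add e f)
  have 2: "2 \<le> V ^ esz e'" for e'
  proof -
    have "V ^ 1 \<le> V ^ esz e'" using assms esz_pos[of e'] by (intro power_increasing) auto
    then show ?thesis using assms by simp
  qed
  have "x + y \<le> x * y" if xy: "2 \<le> x" "2 \<le> y" for x y :: nat
  proof -
    obtain x' where "x = 2 + x'" using le_Suc_ex[OF xy(1)] by blast
    moreover obtain y' where "y = 2 + y'" using le_Suc_ex[OF xy(2)] by blast
    ultimately show ?thesis by (simp add: algebra_simps)
  qed
  from this[OF 2 2, of e f] show ?case using Add by (simp add: power_add)
next
  case (Sub e f)
  have "val (Sub e f) s \<le> V ^ esz e" using Sub by simp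
  also have "\<dots> \<le> V ^ (esz e + esz f)" using assms by (intro power_increasing) auto
  finally show ?case by simp
next
  case (Mul e f)
  then show ?case by (simp add: power_add mult_le_mono)
next
  case (Div e f)
  have "val (Div e f) s \<le> val e s" by simp
  also have "\<dots> \<le> V ^ esz e" using Div by simp
  also have "\<dots> \<le> V ^ (esz e + esz f)" using assms by (intro power_increasing) auto
  finally show ?case by simp
qed

lemma fits_esz:
  assumes "bnd V s" "2 \<le> V" "esz e \<le> K"
  shows "fits (V ^ K) e s"
proof -
  have *: "val e s \<le> V ^ K" if "esz e \<le> K" for e
    using val_bound[OF assms(1,2), of e] power_increasing[OF that, of V] assms(2) by linarith
  show ?thesis
    using assms(3)
  proof (induction e)
    case (Num x)
    then show ?case using *[of "Num x"] by simp
  next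
    case (Reg x)
    then show ?case using *[of "Reg x"] by simp
  next
    case (Load e)
    then show ?case using *[of "Load e"] by simp
  next
    case (Add e f)
    then show ?case using *[of "Add e f"] by simp
  next
    case (Mul e f)
    then show ?case using *[of "Mul e f"] by simp
  qed simp_all
qed

lemma val_addr: "val (addr es) s = code (map (\<lambda>e. val e s) es)"
  by (induction es) auto

lemma val_compile_exp:
  assumes "conc inp off r \<mu> s" "\<And>j. off \<le> j \<Longrightarrow> inp j = 0"
  shows "val (compile_exp e) s = hval inp e r \<mu>"
proof (induction e)
  case (HInp e)
  then show ?case
    using assms by (cases "hval inp e r \<mu> < off") (auto simp: conc_def)
next
  case (HGet es)
  then have "map (\<lambda>e. val (compile_exp e) s) es = map (\<lambda>e. hval inp e r \<mu>) es" by simp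
  then have "map (\<lambda>e. val e s) (map compile_exp es) = map (\<lambda>e. hval inp e r \<mu>) es" by simp
  then show ?case using assms(1) by (simp only: compile_exp.simps val.simps val_addr conc_def hval.simps)
qed (use assms in \<open>auto simp: conc_def\<close>)

text \<open>The factor from loop iterations to machine steps. A loop adds two initial assignments
  and the last test, and in every iteration a test and an increment; 5 covers all of these.\<close>

primrec tsz :: "prog \<Rightarrow> nat" where
  "tsz PSkip = 1"
| "tsz (PAsg x e) = 1"
| "tsz (PSto es e) = 1"
| "tsz (PSeq p q) = tsz p + tsz q"
| "tsz (PIf e p q) = 1 + tsz p + tsz q"
| "tsz (PFor i e p) = 5 + tsz p"

lemma ex5I: "P a b c d e \<Longrightarrow> \<exists>a b c d e. P a b c d e"
  by blast

text \<open>The last conjunct carries the induction: registers \<open>2 * x + 2\<close> hold loop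
  bounds, and a body must preserve the bound of the loop around it, which it does because that
  counter is outside its \<open>modr\<close>.\<close>

theorem compile_correct:
  assumes V: "2 \<le> V" and inp0: "\<And>j. off \<le> j \<Longrightarrow> inp j = 0"
  shows "wf_prog p \<Longrightarrow> wp inp V p Q r \<mu> \<Longrightarrow> conc inp off r \<mu> s \<Longrightarrow> bnd V s \<Longrightarrow> cesz (compile p) \<le> K \<Longrightarrow>
    \<exists>u s' r' \<mu>' t. exec (V ^ K) (compile p) s u s' \<and> conc inp off r' \<mu>' s' \<and> bnd V s' \<and> Q r' \<mu>' t \<and>
      u \<le> tsz p * Suc t \<and> (\<forall>x. x \<notin> modr p \<longrightarrow> r' x = r x \<and> fst s' (2 * x + 2) = fst s (2 * x + 2))"
proof (induction p arbitrary: Q r \<mu> s)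
  case PSkip
  then show ?case by (intro ex5I[of _ "1::nat" s r \<mu> "0::nat"]) (auto intro: exec.Skip[unfolded One_nat_def])
next
  case (PAsg x e)
  have v: "val (compile_exp e) s = hval inp e r \<mu>" by (rule val_compile_exp[OF PAsg.prems(3) inp0])
  have "exec (V ^ K) (compile (PAsg x e)) s 1 ((fst s)(2 * x + 1 := hval inp e r \<mu>), snd s)"
    using exec.Assign[of "V ^ K" "compile_exp e" s "2*x+1"] fits_esz[OF PAsg.prems(4) V, of "compile_exp e" K] PAsg.prems(5) v by simp
  moreover have "conc inp off (r(x := hval inp e r \<mu>)) \<mu> ((fst s)(2 * x + 1 := hval inp e r \<mu>), snd s)"
    using PAsg.prems(3) by (auto simp: conc_def)
  moreover have "bnd V ((fst s)(2 * x + 1 := hval inp e r \<mu>), snd s)"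
    using PAsg.prems by (auto simp: bnd_def)
  moreover have "2 * y + 2 \<noteq> 2 * x + (1::nat)" for y by presburger
  moreover have "Q (r(x := hval inp e r \<mu>)) \<mu> 0" using PAsg.prems by simp
  ultimately have "exec (V ^ K) (compile (PAsg x e)) s 1 ((fst s)(2 * x + 1 := hval inp e r \<mu>), snd s) \<and>
     conc inp off (r(x := hval inp e r \<mu>)) \<mu> ((fst s)(2 * x + 1 := hval inp e r \<mu>), snd s) \<and>
     bnd V ((fst s)(2 * x + 1 := hval inp e r \<mu>), snd s) \<and> Q (r(x := hval inp e r \<mu>)) \<mu> 0 \<and>
     1 \<le> tsz (PAsg x e) * Suc 0 \<and> (\<forall>y. y \<notin> modr (PAsg x e) \<longrightarrow> (r(x := hval inp e r \<mu>)) y = r y \<and>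
       fst ((fst s)(2 * x + 1 := hval inp e r \<mu>), snd s) (2 * y + 2) = fst s (2 * y + 2))"
    by auto
  then show ?case by blast
next
  case (PSto es e)
  have v: "val (compile_exp e) s = hval inp e r \<mu>" for e by (rule val_compile_exp[OF PSto.prems(3) inp0])
  let ?ks = "map (\<lambda>e. hval inp e r \<mu>) es"
  let ?s = "(fst s, (snd s)(off + code ?ks := hval inp e r \<mu>))"
  have o: "fst s 0 = off" using PSto.prems by (simp add: conc_def)
  have a: "val (Add (Reg 0) (addr (map compile_exp es))) s = off + code ?ks"
    using o v by (simp add: val_addr comp_def)
  have f: "fits (V ^ K) (Add (Reg 0) (addr (map compile_exp es))) s" "fits (V ^ K) (compile_exp e) s"
    using PSto.prems(5) by (auto intro!: fits_esz[OF PSto.prems(4) V] simp del: fits.simps)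
  have "exec (V ^ K) (compile (PSto es e)) s 1 ?s"
    using exec.Store[OF f] unfolding a v by simp
  moreover have "conc inp off r (\<mu>(?ks := hval inp e r \<mu>)) ?s"
    using PSto.prems(3) by (auto simp: conc_def code_inj)
  moreover have "bnd V ?s"
    using PSto.prems by (auto simp: bnd_def)
  moreover have "Q r (\<mu>(?ks := hval inp e r \<mu>)) 0" using PSto.prems by simp
  ultimately have "exec (V ^ K) (compile (PSto es e)) s 1 ?s \<and>
     conc inp off r (\<mu>(?ks := hval inp e r \<mu>)) ?s \<and> bnd V ?s \<and> Q r (\<mu>(?ks := hval inp e r \<mu>)) 0 \<and>
     1 \<le> tsz (PSto es e) * Suc 0 \<and> (\<forall>y. y \<notin> modr (PSto es e) \<longrightarrow> r y = r y \<and> fst ?s (2 * y + 2) = fst s (2 * y + 2))"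
    by simp
  then show ?case by blast
next
  case (PSeq p q)
  obtain u s' r' \<mu>' t where 1: "exec (V ^ K) (compile p) s u s'" "conc inp off r' \<mu>' s'" "bnd V s'"
      "wp inp V q (\<lambda>r'' \<mu>'' t'. Q r'' \<mu>'' (t + t')) r' \<mu>'" "u \<le> tsz p * Suc t"
      "\<forall>x. x \<notin> modr p \<longrightarrow> r' x = r x \<and> fst s' (2 * x + 2) = fst s (2 * x + 2)"
    using PSeq.IH(1)[OF _ PSeq.prems(2)[unfolded wp.simps] PSeq.prems(3,4)] PSeq.prems(1,5) by auto
  obtain u' s'' r'' \<mu>'' t' where 2: "exec (V ^ K) (compile q) s' u' s''" "conc inp off r'' \<mu>'' s''" "bnd V s''"
      "Q r'' \<mu>'' (t + t')" "u' \<le> tsz q * Suc t'"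
      "\<forall>x. x \<notin> modr q \<longrightarrow> r'' x = r' x \<and> fst s'' (2 * x + 2) = fst s' (2 * x + 2)"
    using PSeq.IH(2)[OF _ 1(4,2,3)] PSeq.prems(1,5) by auto
  have "u + u' \<le> tsz (PSeq p q) * Suc (t + t')" using 1(5) 2(5) by (simp add: algebra_simps)
  then show ?case using exec.Seq[OF 1(1) 2(1)] 2 1(6)
    by (intro ex5I[of _ "u + u'" s'' r'' \<mu>'' "t + t'"]) (auto)
next
  case (PIf e p q)
  have v: "val (compile_exp e) s = hval inp e r \<mu>" by (rule val_compile_exp[OF PIf.prems(3) inp0])
  have f: "fits (V ^ K) (compile_exp e) s" using PIf.prems(5) by (auto intro!: fits_esz[OF PIf.prems(4) V])
  show ?case
  proof (cases "hval inp e r \<mu> = 0")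
    case False
    then obtain u s' r' \<mu>' t where 1: "exec (V ^ K) (compile p) s u s'" "conc inp off r' \<mu>' s'" "bnd V s'"
      "Q r' \<mu>' t" "u \<le> tsz p * Suc t"
      "\<forall>x. x \<notin> modr p \<longrightarrow> r' x = r x \<and> fst s' (2 * x + 2) = fst s (2 * x + 2)"
      using PIf.IH(1)[OF _ _ PIf.prems(3,4), of Q] PIf.prems(1,2,5) by auto
    have "Suc u \<le> tsz (PIf e p q) * Suc t" using 1(5) by (simp add: algebra_simps)
    then show ?thesis using exec.IfTrue[OF f _ 1(1), of "compile q"] v False 1
      by (intro ex5I[of _ "Suc u" s' r' \<mu>' t]) (auto)
  next
    case True
    then obtain u s' r' \<mu>' t where 1: "exec (V ^ K) (compile q) s u s'" "conc inp off r' \<mu>' s'" "bnd V s'"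
      "Q r' \<mu>' t" "u \<le> tsz q * Suc t"
      "\<forall>x. x \<notin> modr q \<longrightarrow> r' x = r x \<and> fst s' (2 * x + 2) = fst s (2 * x + 2)"
      using PIf.IH(2)[OF _ _ PIf.prems(3,4), of Q] PIf.prems(1,2,5) by auto
    have "Suc u \<le> tsz (PIf e p q) * Suc t" using 1(5) by (simp add: algebra_simps)
    then show ?thesis using exec.IfFalse[OF f _ 1(1), of "compile p"] v True 1
      by (intro ex5I[of _ "Suc u" s' r' \<mu>' t]) (auto)
  qed
next
  case (PFor i e p)
  let ?body = "Seq (compile p) (Assign (2 * i + 1) (Add (Reg (2 * i + 1)) (Num 1)))"
  let ?test = "Sub (Reg (2 * i + 2)) (Reg (2 * i + 1))"
  let ?n = "hval inp e r \<mu>"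
  have i: "i \<notin> modr p" "wf_prog p" using PFor.prems(1) by auto
  have K: "cesz (compile p) \<le> K" "esz (compile_exp e) \<le> K" "esz ?test \<le> K" "esz (Add (Reg (2 * i + 1)) (Num 1)) \<le> K" "esz (Num 0) \<le> K"
    using PFor.prems(5) esz_pos[of "compile_exp e"] by auto
  \<comment> \<open>Induction on the number \<open>d\<close> of iterations left: the bound register
    always holds \<open>r i + d\<close>, so the test is nonzero exactly while \<open>d\<close> is
    positive.\<close>
  have main: "\<exists>u s' r' \<mu>' t. exec (V ^ K) (While ?test ?body) s u s' \<and> conc inp off r' \<mu>' s' \<and> bnd V s' \<and> Q r' \<mu>' t \<and>
      u \<le> 1 + (2 + tsz p) * t \<and> (\<forall>x. x \<notin> modr (PFor i e p) \<longrightarrow> r' x = r x \<and> fst s' (2 * x + 2) = fst s (2 * x + 2))"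
    if "loop (wp inp V p) i d Q r \<mu>" "conc inp off r \<mu> s" "bnd V s" "fst s (2 * i + 2) = r i + d" "r i + d \<le> V"
    for d Q r \<mu> s
    using that
  proof (induction d arbitrary: Q r \<mu> s)
    case 0
    have "exec (V ^ K) (While ?test ?body) s 1 s"
      using 0 by (intro exec.WhileFalse fits_esz[OF _ V] K) (auto simp: conc_def)
    then show ?case using 0
      by (intro ex5I[of _ "1::nat" s r \<mu> "0::nat"]) (auto)
  next
    case (Suc d)
    obtain u s' r' \<mu>' t where 1: "exec (V ^ K) (compile p) s u s'" "conc inp off r' \<mu>' s'" "bnd V s'"
      "loop (wp inp V p) i d (\<lambda>r'' \<mu>'' t'. Q r'' \<mu>'' (Suc (t + t'))) (r'(i := Suc (r i))) \<mu>'" "u \<le> tsz p * Suc t"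
      "\<forall>x. x \<notin> modr p \<longrightarrow> r' x = r x \<and> fst s' (2 * x + 2) = fst s (2 * x + 2)"
      using PFor.IH[OF i(2) Suc.prems(1)[unfolded loop.simps] Suc.prems(2,3) K(1)] by blast
    have ri: "r' i = r i" "fst s' (2 * i + 2) = fst s (2 * i + 2)" using 1(6) i by auto
    let ?s = "((fst s')(2 * i + 1 := Suc (r i)), snd s')"
    have vi: "val (Add (Reg (2 * i + 1)) (Num 1)) s' = Suc (r i)"
      using 1(2) ri by (auto simp: conc_def)
    have e1: "exec (V ^ K) (Assign (2 * i + 1) (Add (Reg (2 * i + 1)) (Num 1))) s' 1 ?s"
      using exec.Assign[OF fits_esz[OF 1(3) V K(4)], of "2*i+1"] unfolding vi .
    have c: "conc inp off (r'(i := Suc (r i))) \<mu>' ?s" using 1(2) by (auto simp: conc_def)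
    have b: "bnd V ?s" using 1(3) Suc.prems(5) by (auto simp: bnd_def)
    have l: "fst ?s (2 * i + 2) = (r'(i := Suc (r i))) i + d" using ri Suc.prems(4) by simp
    obtain u' s'' r'' \<mu>'' t' where 2: "exec (V ^ K) (While ?test ?body) ?s u' s''" "conc inp off r'' \<mu>'' s''" "bnd V s''"
      "Q r'' \<mu>'' (Suc (t + t'))" "u' \<le> 1 + (2 + tsz p) * t'"
      "\<forall>x. x \<notin> modr (PFor i e p) \<longrightarrow> r'' x = (r'(i := Suc (r i))) x \<and> fst s'' (2 * x + 2) = fst ?s (2 * x + 2)"
      using Suc.IH[OF 1(4) c b l] Suc.prems(5) by auto
    have "exec (V ^ K) (While ?test ?body) s (Suc ((u + 1) + u')) s''"
      using Suc.prems(2,4) by (intro exec.WhileTrue[OF fits_esz[OF Suc.prems(3) V K(3)] _ exec.Seq[OF 1(1) e1] 2(1)]) (auto simp: conc_def)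
    moreover have "Suc ((u + 1) + u') \<le> 1 + (2 + tsz p) * Suc (t + t')" using 1(5) 2(5) by (simp add: algebra_simps)
    moreover have "r'' x = r x \<and> fst s'' (2 * x + 2) = fst s (2 * x + 2)" if "x \<notin> modr (PFor i e p)" for x
    proof -
      have "2 * x + 2 \<noteq> 2 * i + 1" by presburger
      then show ?thesis using that 2(6) 1(6) by auto
    qed
    ultimately show ?case using 2
      by (intro ex5I[of _ "Suc ((u + 1) + u')" s'' r'' \<mu>'' "Suc (t + t')"]) (auto)
  qed
  have v: "val (compile_exp e) s = ?n" by (rule val_compile_exp[OF PFor.prems(3) inp0])
  have n: "?n \<le> V" using PFor.prems by simp
  let ?s1 = "((fst s)(2 * i + 2 := ?n), snd s)"
  let ?s2 = "((fst s)(2 * i + 2 := ?n, 2 * i + 1 := 0), snd s)"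
  have e1: "exec (V ^ K) (Assign (2 * i + 2) (compile_exp e)) s 1 ?s1"
    using exec.Assign[OF fits_esz[OF PFor.prems(4) V K(2)], of "2 * i + 2"] v by simp
  have b1: "bnd V ?s1" using PFor.prems(4) n by (auto simp: bnd_def)
  have e2: "exec (V ^ K) (Assign (2 * i + 1) (Num 0)) ?s1 1 ?s2"
    using exec.Assign[OF fits_esz[OF b1 V K(5)], of "2 * i + 1"] by simp
  have b2: "bnd V ?s2" using PFor.prems(4) n by (auto simp: bnd_def)
  have ne: "2 * i + 2 \<noteq> 2 * x + 1" for x by presburger
  have c2: "conc inp off (r(i := 0)) \<mu> ?s2" using PFor.prems(3) ne by (simp add: conc_def)
  obtain u' s'' r'' \<mu>'' t' where 2: "exec (V ^ K) (While ?test ?body) ?s2 u' s''" "conc inp off r'' \<mu>'' s''" "bnd V s''"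
      "Q r'' \<mu>'' t'" "u' \<le> 1 + (2 + tsz p) * t'"
      "\<forall>x. x \<notin> modr (PFor i e p) \<longrightarrow> r'' x = (r(i := 0)) x \<and> fst s'' (2 * x + 2) = fst ?s2 (2 * x + 2)"
    using main[of ?n Q "r(i := 0)" \<mu> ?s2] PFor.prems(2) c2 b2 n by auto
  have "exec (V ^ K) (compile (PFor i e p)) s (1 + (1 + u')) s''"
    unfolding compile.simps by (rule exec.Seq[OF e1 exec.Seq[OF e2 2(1)]])
  moreover have "1 + (1 + u') \<le> tsz (PFor i e p) * Suc t'" using 2(5) by (simp add: algebra_simps)
  moreover have "r'' x = r x \<and> fst s'' (2 * x + 2) = fst s (2 * x + 2)" if "x \<notin> modr (PFor i e p)" for x
  proof -
    have "2 * x + 2 \<noteq> 2 * i + 1" by presburger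
    then show ?thesis using that 2(6) by auto
  qed
  ultimately show ?case using 2(2-4) by blast
qed

section \<open>Running compiled programs\<close>

lemma fits_mono: "fits B e s \<Longrightarrow> B \<le> B' \<Longrightarrow> fits B' e s"
  by (induction e) auto

lemma exec_mono: "exec B p s t s' \<Longrightarrow> B \<le> B' \<Longrightarrow> exec B' p s t s'"
  by (induction rule: exec.induct) (auto intro: exec.intros fits_mono simp del: One_nat_def)

text \<open>Array \<open>0\<close> and register \<open>1\<close> hold the output and its length; register \<open>0\<close> is scratch space.\<close>

definition out_body :: com where
  "out_body = Seq (Store (Add (Reg 1) (Num 1)) (compile_exp (HGet [HNum 0, HReg 0])))
     (Assign 1 (Add (Reg 1) (Num 1)))"

definition out_loop :: com where
  "out_loop = While (Sub (Reg 3) (Reg 1)) out_body"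

definition program :: "prog \<Rightarrow> com" where
  "program p = Seq (Assign 0 (Add (Load (Num 0)) (Num 1))) (Seq (compile p)
     (Seq (Assign 1 (Num 0)) (Seq out_loop (Store (Num 0) (Reg 3)))))"

definition prog_esz :: "prog \<Rightarrow> nat" where
  "prog_esz p = cesz (compile p) + cesz out_loop + 5"

text \<open>The output overwrites the input. Being no longer than the input, it stays below
  \<open>off\<close> and cannot damage array 0 while that array is copied; this is why every program
  specification also bounds the output length.\<close>

lemma out_loop_correct:
  assumes V: "2 \<le> V" and K: "cesz out_loop \<le> K"
  shows "j + d = N \<Longrightarrow> N < off \<Longrightarrow> off \<le> V \<Longrightarrow> bnd V s \<Longrightarrow> fst s 0 = off \<Longrightarrow> fst s 3 = N \<Longrightarrow> fst s 1 = j \<Longrightarrow>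
    (\<forall>ks. snd s (off + code ks) = \<mu> ks) \<Longrightarrow> (\<forall>i<j. snd s (Suc i) = \<mu> [0, i]) \<Longrightarrow>
    \<exists>s'. exec (V ^ K) out_loop s (1 + 3 * d) s' \<and> bnd V s' \<and> fst s' 3 = N \<and> (\<forall>i<N. snd s' (Suc i) = \<mu> [0, i])"
proof (induction d arbitrary: j s)
  case 0
  have "exec (V ^ K) out_loop s 1 s"
    unfolding out_loop_def using 0 K V
    by (intro exec.WhileFalse fits_esz) (auto simp: out_loop_def)
  then show ?case using 0 by (intro exI[of _ s]) auto
next
  case (Suc d)
  let ?e = "compile_exp (HGet [HNum 0, HReg 0])"
  let ?s1 = "(fst s, (snd s)(Suc j := \<mu> [0, j]))"
  let ?s2 = "((fst s)(1 := Suc j), (snd s)(Suc j := \<mu> [0, j]))"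
  have K': "esz (Sub (Reg 3) (Reg 1)) \<le> K" "esz (Add (Reg 1) (Num 1)) \<le> K" "esz ?e \<le> K"
    using K by (auto simp: out_loop_def out_body_def)
  have "val (Add (Reg 0) (addr [Num 0, Reg 1])) s = off + code [0, j]"
    using Suc.prems by (simp only: val.simps val_addr list.map)
  then have v: "val ?e s = \<mu> [0, j]"
    using Suc.prems(8)[rule_format, of "[0, j]"] by (simp del: addr.simps code.simps)
  have b1: "bnd V ?s1" using Suc.prems(4,8) unfolding bnd_def by (auto simp del: code.simps) metis
  have b2: "bnd V ?s2" using b1 Suc.prems(1-3) unfolding bnd_def by auto
  have "exec (V ^ K) (Store (Add (Reg 1) (Num 1)) ?e) s 1 ?s1"
    using exec.Store[OF fits_esz[OF Suc.prems(4) V K'(2)] fits_esz[OF Suc.prems(4) V K'(3)]]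
    unfolding v using Suc.prems(7) by simp
  moreover have "exec (V ^ K) (Assign 1 (Add (Reg 1) (Num 1))) ?s1 1 ?s2"
    using exec.Assign[OF fits_esz[OF b1 V K'(2)], of 1] Suc.prems(7) by simp
  ultimately have body: "exec (V ^ K) out_body s (1 + 1) ?s2"
    unfolding out_body_def by (rule exec.Seq)
  have k: "\<forall>ks. snd ?s2 (off + code ks) = \<mu> ks" using Suc.prems(1,2,8) by auto
  have l: "\<forall>i<Suc j. snd ?s2 (Suc i) = \<mu> [0, i]" using Suc.prems(9) by (auto simp: less_Suc_eq)
  obtain s' where s': "exec (V ^ K) out_loop ?s2 (1 + 3 * d) s'" "bnd V s'" "fst s' 3 = N" "\<forall>i<N. snd s' (Suc i) = \<mu> [0, i]"
    using Suc.IH[of "Suc j" ?s2, OF _ Suc.prems(2,3) b2 _ _ _ k l] Suc.prems by auto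
  have "exec (V ^ K) out_loop s (Suc ((1 + 1) + (1 + 3 * d))) s'"
    unfolding out_loop_def
    by (rule exec.WhileTrue[OF fits_esz[OF Suc.prems(4) V K'(1)] _ body s'(1)[unfolded out_loop_def]])
      (use Suc.prems in simp)
  then show ?case using s' by (intro exI[of _ s']) (simp add: numeral_eq_Suc)
qed

lemma program_correct:
  assumes wf: "wf_prog p" and V: "2 \<le> V" "Suc (length ws) \<le> V" "\<forall>w\<in>set ws. w \<le> V"
    and wp: "wp (input_memory ws) V p (\<lambda>r \<mu> t. r 1 \<le> length ws \<and> t \<le> T \<and> Q (map (\<lambda>j. \<mu> [0, j]) [0..<r 1])) (\<lambda>_. 0) (\<lambda>_. 0)"
  shows "\<exists>t \<sigma> \<mu>. exec (V ^ prog_esz p) (program p) (\<lambda>_. 0, input_memory ws) t (\<sigma>, \<mu>) \<and>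
    t \<le> tsz p * Suc T + 3 * length ws + 5 \<and> Q (output_of \<mu>)"
proof -
  let ?inp = "input_memory ws"
  let ?off = "Suc (length ws)"
  let ?K = "prog_esz p"
  let ?s0 = "(\<lambda>_. 0, ?inp) :: state"
  let ?s1 = "((\<lambda>_. 0)(0 := ?off), ?inp) :: state"
  have inpV: "?inp a \<le> V" for a
    using V by (auto simp: input_memory_def)
  then have b0: "bnd V ?s0" by (simp add: bnd_def)
  have b1: "bnd V ?s1" using V inpV by (auto simp: bnd_def)
  have f0: "esz (Add (Load (Num 0)) (Num 1)) \<le> ?K" by (simp add: prog_esz_def)
  have e0: "exec (V ^ ?K) (Assign 0 (Add (Load (Num 0)) (Num 1))) ?s0 1 ?s1"
    using exec.Assign[OF fits_esz[OF b0 V(1) f0], of 0] by (simp add: input_memory_def)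
  have c1: "conc ?inp ?off (\<lambda>_. 0) (\<lambda>_. 0) ?s1" by (auto simp: conc_def input_memory_def)
  obtain u s' r \<mu> t where 1: "exec (V ^ ?K) (compile p) ?s1 u s'" "conc ?inp ?off r \<mu> s'" "bnd V s'"
      "r 1 \<le> length ws \<and> t \<le> T \<and> Q (map (\<lambda>j. \<mu> [0, j]) [0..<r 1])" "u \<le> tsz p * Suc t"
    using compile_correct[where K = ?K, OF V(1) _ wf wp c1 b1] by (auto simp: prog_esz_def input_memory_def)
  let ?s2 = "((fst s')(1 := 0), snd s')"
  have f1: "esz (Num 0) \<le> ?K" "esz (Reg 3) \<le> ?K" by (simp_all add: prog_esz_def)
  have e1: "exec (V ^ ?K) (Assign 1 (Num 0)) s' 1 ?s2"
    using exec.Assign[OF fits_esz[OF 1(3) V(1) f1(1)], of 1] by simp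
  have b2: "bnd V ?s2" using 1(3) by (auto simp: bnd_def)
  \<comment> \<open>Machine register \<open>3 = 2 * 1 + 1\<close> is program register 1, the output
    length.\<close>
  have r3: "fst s' 3 = r 1" using 1(2) by (simp add: conc_def) (metis One_nat_def Suc_1 mult.right_neutral numeral_3_eq_3)
  obtain s'' where 2: "exec (V ^ ?K) out_loop ?s2 (1 + 3 * r 1) s''" "bnd V s''" "fst s'' 3 = r 1" "\<forall>i<r 1. snd s'' (Suc i) = \<mu> [0, i]"
    using out_loop_correct[where K = ?K and \<mu> = \<mu> and j = 0 and d = "r 1" and N = "r 1" and off = ?off and s = ?s2, OF V(1) _ _ _ V(2) b2]
      1(2,4) r3 by (auto simp: prog_esz_def conc_def)
  let ?s3 = "(fst s'', (snd s'')(0 := r 1))"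
  have e3: "exec (V ^ ?K) (Store (Num 0) (Reg 3)) s'' 1 ?s3"
    using exec.Store[OF fits_esz[OF 2(2) V(1) f1(1)] fits_esz[OF 2(2) V(1) f1(2)]] 2(3) by simp
  have "exec (V ^ ?K) (program p) ?s0 (1 + (u + (1 + ((1 + 3 * r 1) + 1)))) ?s3"
    unfolding program_def by (intro exec.Seq[OF e0] exec.Seq[OF 1(1)] exec.Seq[OF e1] exec.Seq[OF 2(1)] e3)
  moreover have "1 + (u + (1 + ((1 + 3 * r 1) + 1))) \<le> tsz p * Suc T + 3 * length ws + 5"
  proof -
    have "u \<le> tsz p * Suc T"
      using 1(4) by (intro order.trans[OF 1(5)] mult_le_mono2) simp
    then show ?thesis using 1(4) by linarith
  qed
  moreover have "output_of (snd ?s3) = map (\<lambda>j. \<mu> [0, j]) [0..<r 1]"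
    using 2(4) by (auto simp: output_of_def)
  ultimately show ?thesis using 1(4) by (metis prod.collapse snd_conv)
qed

text \<open>Input length, words and loop iterations are all linear in \<open>T\<close>, with factors
  \<open>a\<close>, \<open>v\<close> and \<open>b\<close>. The word bound \<open>(v * T) ^ e\<close>
  is at most \<open>c * T ^ c\<close> once \<open>c\<close> exceeds both \<open>v ^ e\<close> and
  \<open>e\<close>, so one constant serves time and word size.\<close>

lemma computes_within_program:
  assumes "wf_prog p" "1 \<le> T" "length ws \<le> a * T" "\<forall>w\<in>set ws. w \<le> v * T" "2 \<le> v" "Suc a \<le> v"
    and wp: "wp (input_memory ws) (v * T) p (\<lambda>r \<mu> t. r 1 \<le> length ws \<and> t \<le> b * T \<and> Q (map (\<lambda>j. \<mu> [0, j]) [0..<r 1])) (\<lambda>_. 0) (\<lambda>_. 0)"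
    and c: "v ^ prog_esz p + prog_esz p + (tsz p * Suc b + 3 * a + 5) \<le> c"
  shows "computes_within (program p) c T ws Q"
proof -
  have V: "2 \<le> v * T" "Suc (length ws) \<le> v * T"
  proof -
    show "2 \<le> v * T" using mult_le_mono[OF assms(5,2)] by simp
    have "Suc (length ws) \<le> Suc a * T" using assms(2,3) by simp
    also have "\<dots> \<le> v * T" using assms(6) by (rule mult_le_mono1)
    finally show "Suc (length ws) \<le> v * T" .
  qed
  obtain t \<sigma> \<mu> where e: "exec ((v * T) ^ prog_esz p) (program p) (\<lambda>_. 0, input_memory ws) t (\<sigma>, \<mu>)"
    "t \<le> tsz p * Suc (b * T) + 3 * length ws + 5" "Q (output_of \<mu>)"
    using program_correct[OF assms(1) V assms(4) wp] by blast
  have "(v * T) ^ prog_esz p \<le> c * T ^ c"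
    unfolding power_mult_distrib using assms(2) c by (intro mult_le_mono power_increasing) auto
  then have "exec (c * T ^ c) (program p) (\<lambda>_. 0, input_memory ws) t (\<sigma>, \<mu>)"
    using e(1) exec_mono by blast
  moreover have "t \<le> c * T"
  proof -
    have "t \<le> tsz p * (T + b * T) + 3 * (a * T) + 5 * T"
      using e(2) assms(2,3) mult_le_mono2[of "Suc (b * T)" "T + b * T" "tsz p"] by linarith
    also have "\<dots> = (tsz p * Suc b + 3 * a + 5) * T" by (simp add: algebra_simps)
    also have "\<dots> \<le> c * T" using c by (intro mult_le_mono1) simp
    finally show ?thesis .
  qed
  ultimately show ?thesis using e(3) unfolding computes_within_def by blast
qed

section \<open>Dynamic programming along an elimination order\<close>

text \<open>Level \<open>Suc i\<close> arises from level \<open>i\<close> by branching on one element: every set gains the clauses with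
  \<open>lit i b\<close> and is restricted to those with \<open>msk i\<close>.\<close>

primrec psets :: "nat \<Rightarrow> (nat \<Rightarrow> nat) \<Rightarrow> (nat \<Rightarrow> nat \<Rightarrow> bool) \<Rightarrow> (nat \<Rightarrow> nat \<Rightarrow> nat \<Rightarrow> bool) \<Rightarrow> nat \<Rightarrow> nat set set" where
  "psets m nb msk lit 0 = {{}}"
| "psets m nb msk lit (Suc i) =
     {{c. c < m \<and> msk i c \<and> (c \<in> S \<or> lit i b c)} | b S. b < nb i \<and> S \<in> psets m nb msk lit i}"

text \<open>The interface between combinatorics and memory: the dynamic programming handles sets
  only through their indices. Injectivity of \<open>A i\<close> ties the number of indices to the
  number of sets, and so to the width.\<close>

definition ps_table ::
  "nat \<Rightarrow> nat \<Rightarrow> (nat \<Rightarrow> nat) \<Rightarrow> (nat \<Rightarrow> nat \<Rightarrow> bool) \<Rightarrow> (nat \<Rightarrow> nat \<Rightarrow> nat \<Rightarrow> bool) \<Rightarrow>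
   (nat \<Rightarrow> nat) \<Rightarrow> (nat \<Rightarrow> nat \<Rightarrow> nat set) \<Rightarrow> (nat \<Rightarrow> nat \<Rightarrow> nat \<Rightarrow> nat) \<Rightarrow> bool" where
  "ps_table m N nb msk lit cnt A F \<longleftrightarrow>
     (\<forall>i\<le>N. inj_on (A i) {..<cnt i} \<and> A i ` {..<cnt i} = psets m nb msk lit i) \<and>
     (\<forall>i<N. \<forall>b<nb i. \<forall>p<cnt i. F i b p < cnt (Suc i) \<and>
        A (Suc i) (F i b p) = {c. c < m \<and> msk i c \<and> (c \<in> A i p \<or> lit i b c)})"

text \<open>A path lists the branches that are taken, the latest one first.\<close>

primrec paths :: "(nat \<Rightarrow> nat) \<Rightarrow> nat \<Rightarrow> nat list set" where
  "paths nb 0 = {[]}"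
| "paths nb (Suc i) = {b # bs | b bs. b < nb i \<and> bs \<in> paths nb i}"

lemma length_paths: "bs \<in> paths nb i \<Longrightarrow> length bs = i"
  by (induction i arbitrary: bs) auto

lemma nth_paths: "bs \<in> paths nb i \<Longrightarrow> j < i \<Longrightarrow> rev bs ! j < nb j"
proof (induction i arbitrary: bs)
  case (Suc i)
  then obtain b bs' where bs: "bs = b # bs'" "b < nb i" "bs' \<in> paths nb i" by auto
  then show ?case using Suc length_paths[OF bs(3)] by (cases "j < i") (auto simp: nth_append less_Suc_eq)
qed simp

lemma pathsI: "length bs = i \<Longrightarrow> (\<And>j. j < i \<Longrightarrow> rev bs ! j < nb j) \<Longrightarrow> bs \<in> paths nb i"
proof (induction i arbitrary: bs)
  case (Suc i)
  then obtain b bs' where bs: "bs = b # bs'" "length bs' = i" by (cases bs) auto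
  have "rev bs' ! j < nb j" if "j < i" for j
    using Suc.prems(2)[of j] that bs by (simp add: nth_append)
  moreover have "b < nb i" using Suc.prems(2)[of i] bs by (simp add: nth_append)
  ultimately show ?case using Suc.IH bs by auto
qed simp

primrec idx :: "(nat \<Rightarrow> nat \<Rightarrow> nat \<Rightarrow> nat) \<Rightarrow> nat list \<Rightarrow> nat" where
  "idx F [] = 0"
| "idx F (b # bs) = F (length bs) b (idx F bs)"

text \<open>The order \<open>E\<close> enumerates the labels: clause \<open>c < m\<close> has label \<open>c\<close> and position \<open>PC c\<close>, the labels
  from \<open>m\<close> on are variables.  Branch \<open>0\<close> of a variable makes it true, branch \<open>1\<close> false; a clause has only
  the branch \<open>0\<close>, which satisfies nothing.  \<open>L e b c\<close> holds if branch \<open>b\<close> of \<open>e\<close> satisfies clause \<open>c\<close>.\<close>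

locale elimination_order =
  fixes m N :: nat and E PC :: "nat \<Rightarrow> nat" and L :: "nat \<Rightarrow> nat \<Rightarrow> nat \<Rightarrow> bool"
    and w :: "nat \<Rightarrow> nat"
  assumes E_less: "i < N \<Longrightarrow> E i < N"
    and E_inj: "inj_on E {..<N}"
    and PC: "c < m \<Longrightarrow> PC c < N \<and> E (PC c) = c"
    and L_var: "L e b c \<Longrightarrow> m \<le> e"
begin

definition "nb i = (if E i < m then 1 else (2::nat))"
text \<open>Forward level \<open>Suc i\<close> keeps the clauses behind position \<open>i\<close>;
  backward level \<open>Suc j\<close> keeps those before position \<open>N - 1 - j\<close>, the
  element on which it branches. \<open>maskB\<close> uses additions to avoid truncated
  subtraction.\<close>

definition "maskA i c \<longleftrightarrow> i < PC c"
definition "litA i b c \<longleftrightarrow> L (E i) b c"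
definition "maskB j c \<longleftrightarrow> Suc (PC c + j) < N"
definition "litB j b c \<longleftrightarrow> L (E (N - 1 - j)) b c"
definition "nbB j = nb (N - 1 - j)"

primrec rset :: "nat list \<Rightarrow> nat set" where
  "rset [] = {}"
| "rset (b # bs) = rset bs \<union> {c. L (E (length bs)) b c}"

lemma rset_iff: "c \<in> rset bs \<longleftrightarrow> (\<exists>j<length bs. L (E j) (rev bs ! j) c)"
  by (induction bs) (auto simp: nth_append less_Suc_eq)

lemma PC_E: "i < N \<Longrightarrow> E i < m \<Longrightarrow> PC (E i) = i"
  using PC[of "E i"] E_inj unfolding inj_on_def by auto

text \<open>Dropping clauses level by level loses nothing: the masks only shrink, so a clause of the
  final set has survived every earlier restriction.\<close>

lemma psetsA: "i \<le> N \<Longrightarrow> psets m nb maskA litA i = (\<lambda>bs. {c \<in> rset bs. c < m \<and> i \<le> PC c}) ` paths nb i"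
proof (induction i)
  case (Suc i)
  show ?case
  proof (intro equalityI subsetI)
    fix S assume "S \<in> psets m nb maskA litA (Suc i)"
    then obtain b bs where "b < nb i" "bs \<in> paths nb i"
      "S = {c. c < m \<and> maskA i c \<and> (c \<in> {c \<in> rset bs. c < m \<and> i \<le> PC c} \<or> litA i b c)}"
      using Suc by auto
    then show "S \<in> (\<lambda>bs. {c \<in> rset bs. c < m \<and> Suc i \<le> PC c}) ` paths nb (Suc i)"
      by (intro image_eqI[of _ _ "b # bs"]) (auto simp: maskA_def litA_def length_paths)
  next
    fix S assume "S \<in> (\<lambda>bs. {c \<in> rset bs. c < m \<and> Suc i \<le> PC c}) ` paths nb (Suc i)"
    then obtain b bs where b: "b < nb i" "bs \<in> paths nb i" "S = {c \<in> rset (b # bs). c < m \<and> Suc i \<le> PC c}"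
      by auto
    then have "{c \<in> rset bs. c < m \<and> i \<le> PC c} \<in> psets m nb maskA litA i" using Suc by auto
    moreover have "S = {c. c < m \<and> maskA i c \<and> (c \<in> {c \<in> rset bs. c < m \<and> i \<le> PC c} \<or> litA i b c)}"
      using b by (auto simp: maskA_def litA_def length_paths)
    ultimately show "S \<in> psets m nb maskA litA (Suc i)" using b(1) by auto
  qed
qed auto

text \<open>Backward level \<open>j\<close> concerns the assignments of the last \<open>j\<close> elements.\<close>

lemma psetsB_sub: "j \<le> N \<Longrightarrow> S \<in> psets m nbB maskB litB j \<Longrightarrow>
   \<exists>\<beta>. (\<forall>i<N. \<beta> i < nb i) \<and> S = {c. c < m \<and> PC c + j < N \<and> (\<exists>i<N. N - j \<le> i \<and> L (E i) (\<beta> i) c)}"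
proof (induction j arbitrary: S)
  case 0
  then show ?case by (intro exI[of _ "\<lambda>_. 0"]) (auto simp: nb_def)
next
  case (Suc j)
  from Suc.prems(2) obtain b S' where b: "b < nb (N - 1 - j)" "S' \<in> psets m nbB maskB litB j"
    "S = {c. c < m \<and> maskB j c \<and> (c \<in> S' \<or> litB j b c)}"
    by (auto simp: nbB_def[of j])
  from b(2) obtain \<beta> where \<beta>: "\<forall>i<N. \<beta> i < nb i"
    "S' = {c. c < m \<and> PC c + j < N \<and> (\<exists>i<N. N - j \<le> i \<and> L (E i) (\<beta> i) c)}"
    using Suc.IH[of S'] Suc.prems(1) by auto
  let ?k = "N - 1 - j"
  have k: "i < N \<Longrightarrow> N - Suc j \<le> i \<longleftrightarrow> i = ?k \<or> N - j \<le> i" "?k < N" "\<not> N - j \<le> ?k" "N - Suc j \<le> ?k" for i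
    using Suc.prems by auto
  have "(\<exists>i<N. N - Suc j \<le> i \<and> L (E i) ((\<beta>(?k := b)) i) c) \<longleftrightarrow>
     L (E ?k) b c \<or> (\<exists>i<N. N - j \<le> i \<and> L (E i) (\<beta> i) c)" for c
    using k by (metis fun_upd_other fun_upd_same)
  then have "S = {c. c < m \<and> PC c + Suc j < N \<and> (\<exists>i<N. N - Suc j \<le> i \<and> L (E i) ((\<beta>(?k := b)) i) c)}"
    unfolding b(3) \<beta>(2) by (auto simp: maskB_def litB_def)
  then show ?case using b(1) \<beta>(1) by (intro exI[of _ "\<beta>(?k := b)"]) auto
qed

end

section \<open>Paths described by pairs of table indices\<close>

locale elimination_tables = elimination_order +
  fixes cntA cntB :: "nat \<Rightarrow> nat" and A B :: "nat \<Rightarrow> nat \<Rightarrow> nat set" and FA FB :: "nat \<Rightarrow> nat \<Rightarrow> nat \<Rightarrow> nat"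
  assumes tabA: "ps_table m N nb maskA litA cntA A FA"
    and tabB: "ps_table m N nbB maskB litB cntB B FB"
begin

lemma cnt0: "cntA 0 = 1" "cntB 0 = 1" "A 0 0 = {}" "B 0 0 = {}"
proof -
  have *: "c = 1 \<and> f 0 = {}" if "inj_on f {..<c}" "f ` {..<c} = {{}}" for f :: "nat \<Rightarrow> nat set" and c
  proof -
    have "card (f ` {..<c}) = c" using that(1) by (simp add: card_image)
    then have c: "c = 1" using that(2) by simp
    then show ?thesis using that(2) by auto
  qed
  show "cntA 0 = 1" "A 0 0 = {}" using *[of "A 0" "cntA 0"] tabA unfolding ps_table_def by auto
  show "cntB 0 = 1" "B 0 0 = {}" using *[of "B 0" "cntB 0"] tabB unfolding ps_table_def by auto
qed

lemma FA: "i < N \<Longrightarrow> b < nb i \<Longrightarrow> p < cntA i \<Longrightarrow>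
    FA i b p < cntA (Suc i) \<and> A (Suc i) (FA i b p) = {c. c < m \<and> i < PC c \<and> (c \<in> A i p \<or> L (E i) b c)}"
  using tabA unfolding ps_table_def maskA_def litA_def by auto

text \<open>Backward level \<open>N - 1 - i\<close> concerns the elements behind \<open>i\<close>,
  level \<open>N - i\<close> those from \<open>i\<close> on. So the map pulls a promise made for
  after \<open>i\<close> back over element \<open>i\<close>.\<close>

lemma FB: "i < N \<Longrightarrow> b < nb i \<Longrightarrow> q < cntB (N - 1 - i) \<Longrightarrow>
    FB (N - 1 - i) b q < cntB (N - i) \<and>
    B (N - i) (FB (N - 1 - i) b q) = {c. c < m \<and> PC c < i \<and> (c \<in> B (N - 1 - i) q \<or> L (E i) b c)}"
proof -
  assume a: "i < N" "b < nb i" "q < cntB (N - 1 - i)"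
  then have e: "N - 1 - i < N" "N - 1 - (N - 1 - i) = i" "Suc (N - 1 - i) = N - i" by auto
  have mb: "maskB (N - 1 - i) c \<longleftrightarrow> PC c < i" for c using a by (auto simp: maskB_def)
  have "\<forall>b<nbB (N - 1 - i). \<forall>p<cntB (N - 1 - i). FB (N - 1 - i) b p < cntB (Suc (N - 1 - i)) \<and>
        B (Suc (N - 1 - i)) (FB (N - 1 - i) b p) =
        {c. c < m \<and> maskB (N - 1 - i) c \<and> (c \<in> B (N - 1 - i) p \<or> litB (N - 1 - i) b c)}"
    using tabB e(1) unfolding ps_table_def by blast
  then show ?thesis using a(2,3) unfolding mb litB_def nbB_def e by blast
qed

lemma idx_bound: "bs \<in> paths nb i \<Longrightarrow> i \<le> N \<Longrightarrow>
   idx FA bs < cntA i \<and> A i (idx FA bs) = {c \<in> rset bs. c < m \<and> i \<le> PC c}"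
proof (induction i arbitrary: bs)
  case 0
  then show ?case using cnt0 by simp
next
  case (Suc i)
  then obtain b bs' where bs: "bs = b # bs'" "b < nb i" "bs' \<in> paths nb i" by auto
  then show ?case using Suc FA[of i b "idx FA bs'"] length_paths[OF bs(3)] by auto
qed

text \<open>Forward level \<open>i\<close> keeps the positions from \<open>i\<close> on, backward
  level \<open>N - 1 - i\<close> those up to \<open>i\<close>. The clause at \<open>i\<close> is the
  only one both speak about, so its fate is decided by \<open>p\<close> and \<open>q\<close> exactly
  here.\<close>

definition "cond i p q \<longleftrightarrow> m \<le> E i \<or> E i \<in> A i p \<or> E i \<in> B (N - 1 - i) q"

definition "inc i p q = (if E i < m \<and> cond i p q then w (E i) else 0)"

text \<open>The index \<open>q\<close> stands for the set of earlier clauses that the remaining elements are promised to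
  satisfy.\<close>

primrec okp :: "nat list \<Rightarrow> nat \<Rightarrow> bool" where
  "okp [] q = True"
| "okp (b # bs) q = (okp bs (FB (N - 1 - length bs) b q) \<and> cond (length bs) (idx FA bs) q)"

text \<open>The weight of a clause is credited at its own position, hence once.\<close>

primrec wpath :: "nat list \<Rightarrow> nat \<Rightarrow> nat" where
  "wpath [] q = 0"
| "wpath (b # bs) q = wpath bs (FB (N - 1 - length bs) b q) + inc (length bs) (idx FA bs) q"

lemma cond_iff:
  assumes "bs \<in> paths nb i" "i < N" "b < nb i" "q < cntB (N - 1 - i)" "E i < m"
  shows "cond i (idx FA bs) q \<longleftrightarrow> E i \<in> rset (b # bs) \<union> B (N - 1 - i) q"
proof -
  have "PC (E i) = i" "\<not> L (E i) b c" for c using assms PC_E L_var[of "E i" b c] by auto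
  then show ?thesis
    using idx_bound[OF assms(1)] assms by (auto simp: cond_def length_paths)
qed

text \<open>Local checks become a global condition by an invariance: stepping back over
  \<open>b\<close> removes from the path what \<open>b\<close> satisfies and adds it to the promise,
  so their union is unchanged on the clauses before \<open>i\<close>. The check at \<open>i\<close>
  supplies the one missing clause.\<close>

lemma okp_iff: "bs \<in> paths nb i \<Longrightarrow> i \<le> N \<Longrightarrow> q < cntB (N - i) \<Longrightarrow>
   okp bs q \<longleftrightarrow> (\<forall>c<m. PC c < i \<longrightarrow> c \<in> rset bs \<union> B (N - i) q)"
proof (induction i arbitrary: bs q)
  case 0
  then show ?case by simp
next
  case (Suc i)
  then obtain b bs' where bs: "bs = b # bs'" "b < nb i" "bs' \<in> paths nb i" by auto
  have q: "q < cntB (N - 1 - i)" "N - Suc i = N - 1 - i" "i < N" using Suc.prems by auto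
  have l: "length bs' = i" using bs length_paths by auto
  note f = FB[OF q(3) bs(2) q(1)]
  have 1: "okp bs' (FB (N - 1 - i) b q) \<longleftrightarrow> (\<forall>c<m. PC c < i \<longrightarrow> c \<in> rset bs \<union> B (N - 1 - i) q)"
  proof -
    have "okp bs' (FB (N - 1 - i) b q) \<longleftrightarrow> (\<forall>c<m. PC c < i \<longrightarrow> c \<in> rset bs' \<union> B (N - i) (FB (N - 1 - i) b q))"
      using Suc.IH[OF bs(3), of "FB (N - 1 - i) b q"] f q(3) by simp
    then show ?thesis unfolding f[THEN conjunct2] by (auto simp: bs(1) l)
  qed
  have 2: "cond i (idx FA bs') q \<longleftrightarrow> (\<forall>c<m. PC c = i \<longrightarrow> c \<in> rset bs \<union> B (N - 1 - i) q)"
  proof (cases "E i < m")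
    case True
    then show ?thesis
      using cond_iff[OF bs(3) q(3) bs(2) q(1) True] PC_E[OF q(3) True] PC by (auto simp: bs(1))
  next
    case False
    then have "PC c \<noteq> i" if "c < m" for c using PC[OF that] that by auto
    then show ?thesis using False by (auto simp: cond_def)
  qed
  have "okp bs q \<longleftrightarrow> okp bs' (FB (N - 1 - i) b q) \<and> cond i (idx FA bs') q"
    by (simp only: bs(1) l okp.simps)
  then show ?case unfolding q(2) 1 2 by (auto simp: less_Suc_eq)
qed

text \<open>The same invariance as for \<open>okp_iff\<close>; \<open>inc\<close> accounts for the
  clause at the new position, if there is one.\<close>

lemma wpath_eq: "bs \<in> paths nb i \<Longrightarrow> i \<le> N \<Longrightarrow> q < cntB (N - i) \<Longrightarrow>
   wpath bs q = (\<Sum>c\<in>{c. c < m \<and> PC c < i \<and> c \<in> rset bs \<union> B (N - i) q}. w c)"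
proof (induction i arbitrary: bs q)
  case 0
  then show ?case by simp
next
  case (Suc i)
  then obtain b bs' where bs: "bs = b # bs'" "b < nb i" "bs' \<in> paths nb i" by auto
  have q: "q < cntB (N - 1 - i)" "N - Suc i = N - 1 - i" "i < N" using Suc.prems by auto
  have l: "length bs' = i" using bs length_paths by auto
  note f = FB[OF q(3) bs(2) q(1)]
  let ?U = "rset bs \<union> B (N - 1 - i) q"
  have "{c. c < m \<and> PC c < i \<and> c \<in> rset bs' \<union> B (N - i) (FB (N - 1 - i) b q)} = {c. c < m \<and> PC c < i \<and> c \<in> ?U}"
    unfolding f[THEN conjunct2] by (auto simp: bs(1) l)
  then have 1: "wpath bs' (FB (N - 1 - i) b q) = (\<Sum>c\<in>{c. c < m \<and> PC c < i \<and> c \<in> ?U}. w c)"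
    using Suc.IH[OF bs(3), of "FB (N - 1 - i) b q"] f q(3) by simp
  have 2: "{c. c < m \<and> PC c < Suc i \<and> c \<in> ?U} = {c. c < m \<and> PC c < i \<and> c \<in> ?U} \<union> {c. c < m \<and> PC c = i \<and> c \<in> ?U}"
    by (auto simp: less_Suc_eq)
  have 3: "inc i (idx FA bs') q = (\<Sum>c\<in>{c. c < m \<and> PC c = i \<and> c \<in> ?U}. w c)"
  proof (cases "E i < m")
    case True
    have "{c. c < m \<and> PC c = i \<and> c \<in> ?U} = (if E i \<in> ?U then {E i} else {})"
      using True PC_E[OF q(3) True] PC by auto
    then show ?thesis
      using cond_iff[OF bs(3) q(3) bs(2) q(1) True] True by (simp add: inc_def bs(1))
  next
    case False
    then have "{c. c < m \<and> PC c = i \<and> c \<in> ?U} = {}" using PC by auto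
    then show ?thesis using False by (simp only: inc_def sum.empty) simp
  qed
  have "wpath bs q = wpath bs' (FB (N - 1 - i) b q) + inc i (idx FA bs') q"
    by (simp only: bs(1) l wpath.simps)
  then show ?case unfolding q(2) 2 1 3
    by (subst sum.union_disjoint) auto
qed

lemma okp_full: "bs \<in> paths nb N \<Longrightarrow> okp bs 0 \<longleftrightarrow> (\<forall>c<m. c \<in> rset bs)"
  using okp_iff[of bs N 0] cnt0 PC by auto

lemma wpath_full: "bs \<in> paths nb N \<Longrightarrow> wpath bs 0 = (\<Sum>c\<in>{c. c < m \<and> c \<in> rset bs}. w c)"
proof -
  assume a: "bs \<in> paths nb N"
  have "{c. c < m \<and> PC c < N \<and> c \<in> rset bs \<union> B (N - N) 0} = {c. c < m \<and> c \<in> rset bs}"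
    using PC cnt0 by auto
  then show ?thesis using wpath_eq[OF a, of 0] cnt0 by simp
qed

lemma psetsA_N: "psets m nb maskA litA N \<subseteq> {{}}"
  using psetsA[of N] PC by fastforce

text \<open>No clause lies at position \<open>N\<close> or beyond, so the last forward level has at
  most one set. Hence the single entry \<open>(0, 0)\<close> of level \<open>N\<close> summarizes
  all full paths.\<close>

lemma idx_full: "bs \<in> paths nb N \<Longrightarrow> idx FA bs = 0"
proof -
  assume a: "bs \<in> paths nb N"
  have "inj_on (A N) {..<cntA N}" and sub: "A N ` {..<cntA N} \<subseteq> {{}}"
    using tabA psetsA_N unfolding ps_table_def by auto
  then have "card (A N ` {..<cntA N}) = cntA N" by (simp add: card_image)
  then have "cntA N \<le> 1" using card_mono[OF _ sub] by simp
  then show ?thesis using idx_bound[OF a] by simp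
qed

section \<open>The counting recurrence\<close>

definition "cnt_tab i p q = card {bs \<in> paths nb i. idx FA bs = p \<and> okp bs q}"

text \<open>Partial counts of the summation over the pairs \<open>(b, p)\<close> that precede the given one
  lexicographically.\<close>

definition "cnt_part i b p p' q = card {b' # bs | b' bs. b' < nb i \<and> bs \<in> paths nb i \<and>
   (b' < b \<or> b' = b \<and> idx FA bs < p) \<and> idx FA (b' # bs) = p' \<and> okp (b' # bs) q}"

lemma finite_paths: "finite (paths nb i)"
proof (induction i)
  case (Suc i)
  have "paths nb (Suc i) = (\<lambda>(b, bs). b # bs) ` ({..<nb i} \<times> paths nb i)" by auto
  then show ?case using Suc by (metis finite_SigmaI finite_imageI finite_lessThan)
qed simp

lemma card_paths: "card (paths nb i) \<le> 2 ^ i"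
proof (induction i)
  case (Suc i)
  have "paths nb (Suc i) = (\<lambda>(b, bs). b # bs) ` ({..<nb i} \<times> paths nb i)" by auto
  then have "card (paths nb (Suc i)) \<le> card ({..<nb i} \<times> paths nb i)"
    using finite_paths by (metis card_image_le finite_SigmaI finite_lessThan)
  also have "\<dots> \<le> 2 * 2 ^ i" unfolding card_cartesian_product using Suc by (intro mult_le_mono) (auto simp: nb_def[of i])
  finally show ?case by simp
qed simp

lemma cnt_part_finite: "finite {b' # bs | b' bs. b' < nb i \<and> bs \<in> paths nb i \<and> P b' bs}"
  by (rule finite_subset[OF _ finite_paths[of "Suc i"]]) auto

lemma cnt_part_0: "cnt_part i 0 0 p' q = 0"
  by (simp add: cnt_part_def)

text \<open>Rules out overflow: intermediate sums are themselves numbers of paths, so they stay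
  below \<open>2 ^ l\<close> for every \<open>l\<close> greater than \<open>N\<close>.\<close>

lemma cnt_part_bound: "cnt_part i b p p' q \<le> 2 ^ Suc i"
proof -
  have "cnt_part i b p p' q \<le> card (paths nb (Suc i))"
    unfolding cnt_part_def by (rule card_mono[OF finite_paths]) auto
  then show ?thesis using card_paths[of "Suc i"] by linarith
qed

lemma cnt_part_next_b:
  assumes "i \<le> N"
  shows "cnt_part i b (cntA i) p' q = cnt_part i (Suc b) 0 p' q"
proof -
  have "{b' # bs | b' bs. b' < nb i \<and> bs \<in> paths nb i \<and> (b' < b \<or> b' = b \<and> idx FA bs < cntA i) \<and> idx FA (b' # bs) = p' \<and> okp (b' # bs) q} =
    {b' # bs | b' bs. b' < nb i \<and> bs \<in> paths nb i \<and> (b' < Suc b \<or> b' = Suc b \<and> idx FA bs < 0) \<and> idx FA (b' # bs) = p' \<and> okp (b' # bs) q}"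
    using idx_bound[OF _ assms] by (auto simp: less_Suc_eq)
  then show ?thesis unfolding cnt_part_def by simp
qed

lemma cnt_part_end: "cnt_part i (nb i) 0 p' q = cnt_tab (Suc i) p' q"
  unfolding cnt_part_def cnt_tab_def by (rule arg_cong[where f = card]) auto

text \<open>The paths gained end with branch \<open>b\<close> and come from forward index
  \<open>p\<close>. Their new index \<open>FA i b p\<close> and old promise
  \<open>FB (N - 1 - i) b q\<close> are fixed, so the gain is a single entry of the previous level
  or nothing.\<close>

lemma cnt_part_Suc:
  assumes "b < nb i"
  shows "cnt_part i b (Suc p) p' q = cnt_part i b p p' q +
    (if FA i b p = p' \<and> cond i p q then cnt_tab i p (FB (N - 1 - i) b q) else 0)"
proof -
  let ?X = "{b' # bs | b' bs. b' < nb i \<and> bs \<in> paths nb i \<and>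
   (b' < b \<or> b' = b \<and> idx FA bs < p) \<and> idx FA (b' # bs) = p' \<and> okp (b' # bs) q}"
  let ?Y = "{b' # bs | b' bs. b' < nb i \<and> bs \<in> paths nb i \<and>
   (b' = b \<and> idx FA bs = p) \<and> idx FA (b' # bs) = p' \<and> okp (b' # bs) q}"
  have "{b' # bs | b' bs. b' < nb i \<and> bs \<in> paths nb i \<and>
   (b' < b \<or> b' = b \<and> idx FA bs < Suc p) \<and> idx FA (b' # bs) = p' \<and> okp (b' # bs) q} = ?X \<union> ?Y"
    by (auto simp: less_Suc_eq)
  then have "cnt_part i b (Suc p) p' q = card (?X \<union> ?Y)" unfolding cnt_part_def by simp
  also have "\<dots> = card ?X + card ?Y" by (intro card_Un_disjoint cnt_part_finite) auto
  also have "?Y = (#) b ` {bs \<in> paths nb i. idx FA bs = p \<and> FA i b p = p' \<and> cond i p q \<and> okp bs (FB (N - 1 - i) b q)}"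
    using assms by (auto simp: length_paths)
  also have "card \<dots> = card {bs \<in> paths nb i. idx FA bs = p \<and> FA i b p = p' \<and> cond i p q \<and> okp bs (FB (N - 1 - i) b q)}"
    by (intro card_image) auto
  also have "\<dots> = (if FA i b p = p' \<and> cond i p q then cnt_tab i p (FB (N - 1 - i) b q) else 0)"
    unfolding cnt_tab_def by auto
  finally show ?thesis unfolding cnt_part_def .
qed

lemma cnt_tab_0: "cnt_tab 0 0 q = 1"
proof -
  have "{bs \<in> paths nb 0. idx FA bs = 0 \<and> okp bs q} = {[]}" by auto
  then show ?thesis unfolding cnt_tab_def by simp
qed

lemma cnt_tab_N: "cnt_tab N 0 0 = card {bs \<in> paths nb N. \<forall>c<m. c \<in> rset bs}"
  unfolding cnt_tab_def using idx_full okp_full by (intro arg_cong[where f = card]) auto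

section \<open>Optimal paths: bounds from above and reconstruction\<close>

lemma FA_surj:
  assumes "i < N" "p' < cntA (Suc i)"
  shows "\<exists>b<nb i. \<exists>p<cntA i. FA i b p = p'"
proof -
  have t: "A i ` {..<cntA i} = psets m nb maskA litA i" "inj_on (A (Suc i)) {..<cntA (Suc i)}"
    "A (Suc i) ` {..<cntA (Suc i)} = psets m nb maskA litA (Suc i)"
    using tabA assms(1) unfolding ps_table_def by auto
  have "A (Suc i) p' \<in> psets m nb maskA litA (Suc i)" using t(3) assms(2) by blast
  then obtain b S where b: "b < nb i" "S \<in> psets m nb maskA litA i"
    "A (Suc i) p' = {c. c < m \<and> i < PC c \<and> (c \<in> S \<or> L (E i) b c)}"
    by (auto simp: maskA_def litA_def)
  obtain p where p: "p < cntA i" "S = A i p" using b(2) t(1) by blast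
  have "FA i b p < cntA (Suc i)" "A (Suc i) (FA i b p) = A (Suc i) p'"
    using FA[OF assms(1) b(1) p(1)] b(3) p(2) by auto
  then have "FA i b p = p'" using t(2) assms(2) by (auto dest: inj_onD)
  then show ?thesis using b(1) p(1) by blast
qed

text \<open>One half of the optimality principle: a table satisfying all step inequalities dominates
  every path. The \<open>+ 1\<close> is the value given to the empty path, which keeps real entries
  apart from missing ones.\<close>

lemma wpath_le:
  assumes v0: "\<And>q. q < cntB N \<Longrightarrow> 1 \<le> v 0 0 q"
    and step: "\<And>i b p q. i < N \<Longrightarrow> b < nb i \<Longrightarrow> p < cntA i \<Longrightarrow> q < cntB (N - 1 - i) \<Longrightarrow>
      v i p (FB (N - 1 - i) b q) + inc i p q \<le> v (Suc i) (FA i b p) q"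
  shows "bs \<in> paths nb i \<Longrightarrow> i \<le> N \<Longrightarrow> q < cntB (N - i) \<Longrightarrow> wpath bs q + 1 \<le> v i (idx FA bs) q"
proof (induction i arbitrary: bs q)
  case 0
  then show ?case using v0 by simp
next
  case (Suc i)
  then obtain b bs' where bs: "bs = b # bs'" "b < nb i" "bs' \<in> paths nb i" by auto
  have q: "q < cntB (N - 1 - i)" "i < N" using Suc.prems by auto
  have l: "length bs' = i" using bs length_paths by auto
  have 1: "wpath bs q = wpath bs' (FB (N - 1 - i) b q) + inc i (idx FA bs') q"
    by (simp only: bs(1) l wpath.simps)
  have 2: "wpath bs' (FB (N - 1 - i) b q) + 1 \<le> v i (idx FA bs') (FB (N - 1 - i) b q)"
    using Suc.IH[OF bs(3), of "FB (N - 1 - i) b q"] FB[OF q(2) bs(2) q(1)] q(2) by simp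
  have 3: "v i (idx FA bs') (FB (N - 1 - i) b q) + inc i (idx FA bs') q \<le> v (Suc i) (FA i b (idx FA bs')) q"
    using idx_bound[OF bs(3)] q(2) by (intro step[OF q(2) bs(2) _ q(1)]) simp
  have 4: "idx FA bs = FA i b (idx FA bs')" by (simp add: bs(1) l)
  show ?case unfolding 4 using 1 2 3 by linarith
qed

text \<open>Follows recorded choices downwards from level \<open>i\<close>; the latest branch comes
  first, which is the format of \<open>paths\<close>.\<close>

primrec track :: "(nat \<Rightarrow> nat \<Rightarrow> nat \<Rightarrow> nat) \<Rightarrow> (nat \<Rightarrow> nat \<Rightarrow> nat \<Rightarrow> nat) \<Rightarrow> nat \<Rightarrow> nat \<Rightarrow> nat \<Rightarrow> nat list" where
  "track CB CP 0 p q = []"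
| "track CB CP (Suc i) p q =
     CB i p q # track CB CP i (CP i p q) (FB (N - 1 - i) (CB i p q) q)"

text \<open>The other half: if every entry is attained by its recorded choice, the traced path
  realizes the stored value.\<close>

lemma wpath_track:
  assumes v0: "\<And>q. q < cntB N \<Longrightarrow> v 0 0 q = 1"
    and step: "\<And>i p q. i < N \<Longrightarrow> p < cntA (Suc i) \<Longrightarrow> q < cntB (N - 1 - i) \<Longrightarrow>
      CB i p q < nb i \<and> CP i p q < cntA i \<and> FA i (CB i p q) (CP i p q) = p \<and>
      v (Suc i) p q = v i (CP i p q) (FB (N - 1 - i) (CB i p q) q) + inc i (CP i p q) q"
  shows "i \<le> N \<Longrightarrow> p < cntA i \<Longrightarrow> q < cntB (N - i) \<Longrightarrow> track CB CP i p q \<in> paths nb i \<and>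
    idx FA (track CB CP i p q) = p \<and> v i p q = wpath (track CB CP i p q) q + 1"
proof (induction i arbitrary: p q)
  case 0
  then show ?case using v0 cnt0 by simp
next
  case (Suc i)
  have q: "q < cntB (N - 1 - i)" "i < N" using Suc.prems by auto
  note st = step[OF q(2) Suc.prems(2) q(1)]
  let ?bs = "track CB CP i (CP i p q) (FB (N - 1 - i) (CB i p q) q)"
  have IH: "?bs \<in> paths nb i \<and> idx FA ?bs = CP i p q \<and>
      v i (CP i p q) (FB (N - 1 - i) (CB i p q) q) = wpath ?bs (FB (N - 1 - i) (CB i p q) q) + 1"
    using Suc.IH[of "CP i p q" "FB (N - 1 - i) (CB i p q) q"] st FB[OF q(2) _ q(1), of "CB i p q"] q(2) by simp
  then have l: "length ?bs = i" using length_paths by blast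
  have "CB i p q # ?bs \<in> paths nb (Suc i)" using IH st by simp
  then show ?case using IH st unfolding track.simps wpath.simps idx.simps l by simp
qed

end

section \<open>From branch decompositions to elimination orders\<close>

text \<open>The leaves hanging off a descending path, from the top; in the last pair the left one
  comes first. The value \<open>[]\<close> is a dummy for trees in which some node has two inner
  children.\<close>

fun spine :: "'a btree \<Rightarrow> 'a list" where
  "spine (Leaf a) = [a]"
| "spine (Node (Leaf a) r) = a # spine r"
| "spine (Node (Node l l') (Leaf b)) = b # spine (Node l l')"
| "spine (Node (Node l l') (Node r r')) = []"

fun caterpillar :: "'a btree \<Rightarrow> bool" where
  "caterpillar (Leaf a) = True"
| "caterpillar (Node (Leaf a) r) = caterpillar r"
| "caterpillar (Node (Node l l') (Leaf b)) = caterpillar (Node l l')"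
| "caterpillar (Node (Node l l') (Node r r')) = False"

text \<open>The path of inner nodes may pass through the root, so both children can be long
  caterpillars. Reading the left spine upwards and the right one downwards walks along the whole
  path.\<close>

fun leaf_order :: "'a btree \<Rightarrow> 'a list" where
  "leaf_order (Leaf a) = [a]"
| "leaf_order (Node l r) = rev (spine l) @ spine r"

lemma not_caterpillarD:
  "\<not> caterpillar t \<Longrightarrow> \<exists>p. p \<in> inner_nodes t \<and> p @ [False] \<in> inner_nodes t \<and> p @ [True] \<in> inner_nodes t"
proof (induction t rule: caterpillar.induct)
  case (2 a r)
  then obtain p where "p \<in> inner_nodes r \<and> p @ [False] \<in> inner_nodes r \<and> p @ [True] \<in> inner_nodes r" by auto
  then show ?case by (intro exI[of _ "True # p"]) auto
next
  case (3 l l' b)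
  then obtain p where "p \<in> inner_nodes (Node l l') \<and> p @ [False] \<in> inner_nodes (Node l l') \<and> p @ [True] \<in> inner_nodes (Node l l')"
    by auto
  then show ?case by (intro exI[of _ "False # p"]) (auto simp del: inner_nodes.simps(2) simp: inner_nodes.simps(2)[of _ "Leaf b"])
next
  case (4 l l' r r')
  show ?case by (intro exI[of _ "[]"]) auto
qed simp

lemma inner_nodes_butlast: "p \<in> inner_nodes t \<Longrightarrow> p \<noteq> [] \<Longrightarrow> butlast p \<in> inner_nodes t"
proof (induction t arbitrary: p)
  case (Node l r)
  then obtain b p' where p: "p = b # p'" by (cases p) auto
  then have "p' \<in> inner_nodes (if b then r else l)" using Node.prems by (auto split: if_splits)
  then show ?case using Node.IH p by (cases "p' = []") (auto split: if_splits)
qed simp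

lemma induces_path_degree:
  assumes "induces_path adj V" "v \<in> V" "a \<in> V" "b \<in> V" "c \<in> V"
    "adj v a" "adj v b" "adj v c" "a \<noteq> b" "a \<noteq> c" "b \<noteq> c"
  shows False
proof -
  obtain ps where ps: "distinct ps" "set ps = V"
    "\<forall>i<length ps. \<forall>j<length ps. adj (ps ! i) (ps ! j) \<longleftrightarrow> j = Suc i \<or> i = Suc j"
    using assms(1) unfolding induces_path_def by blast
  have "\<exists>i<length ps. ps ! i = x" if "x \<in> V" for x using that ps(2) by (metis in_set_conv_nth)
  then obtain i ia ib ic where i: "i < length ps" "ps ! i = v" "ia < length ps" "ps ! ia = a"
      "ib < length ps" "ps ! ib = b" "ic < length ps" "ps ! ic = c"
    using assms(2-5) by metis
  have "ia = Suc i \<or> i = Suc ia" "ib = Suc i \<or> i = Suc ib" "ic = Suc i \<or> i = Suc ic"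
    using ps(3) i assms(6-8) by auto
  then have "ia = ib \<or> ia = ic \<or> ib = ic" by auto
  then show False using i assms(9-11) by auto
qed

text \<open>If a child were not a caterpillar, some inner node below the root would have two inner
  children besides its inner parent: three neighbours, which a path does not allow.\<close>

lemma caterpillar_children:
  assumes "linear_decomposition (Node l r)"
  shows "caterpillar l \<and> caterpillar r"
proof -
  let ?V = "inner_nodes (Node l r)"
  have False if nc: "\<not> caterpillar (if x then r else l)" for x
  proof -
    obtain p where p: "p \<in> inner_nodes (if x then r else l)" "p @ [False] \<in> inner_nodes (if x then r else l)"
      "p @ [True] \<in> inner_nodes (if x then r else l)"
      using not_caterpillarD[OF nc] by blast
    have V: "x # p \<in> ?V" "x # p @ [False] \<in> ?V" "x # p @ [True] \<in> ?V" using p by (auto split: if_splits)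
    then have "butlast (x # p) \<in> ?V" using inner_nodes_butlast by blast
    moreover have "x # p = butlast (x # p) @ [last (x # p)]" by (metis append_butlast_last_id list.distinct(1))
    moreover have ne: "length (butlast (x # p)) \<noteq> length (x # p @ [y])" for y by simp
    have "butlast (x # p) \<noteq> x # p @ [y]" for y using ne[of y] by metis
    ultimately show False
      using induces_path_degree[of tree_adj ?V "x # p" "butlast (x # p)" "x # p @ [False]" "x # p @ [True]"] V assms
      unfolding linear_decomposition_def tree_adj_def by (metis append_Cons list.inject same_append_eq)
  qed
  from this[of True] this[of False] show ?thesis by auto
qed

lemma set_spine: "caterpillar t \<Longrightarrow> set (spine t) = set (leaves t) \<and> length (spine t) = length (leaves t)"
  by (induction t rule: caterpillar.induct) auto

lemma leaf_order_set:
  assumes "linear_decomposition D"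
  shows "set (leaf_order D) = set (leaves D) \<and> length (leaf_order D) = length (leaves D)"
  using caterpillar_children set_spine assms by (cases D) auto

lemma root_node: "[] \<in> nodes t"
  by (cases t) auto

lemma drop_spine:
  "caterpillar t \<Longrightarrow> i < length (spine t) \<Longrightarrow> \<exists>p\<in>nodes t. set (leaves (subtree t p)) = set (drop i (spine t))"
proof (induction t arbitrary: i rule: caterpillar.induct)
  case (1 a)
  then show ?case by auto
next
  case (2 a r)
  show ?case
  proof (cases i)
    case 0
    then show ?thesis using set_spine[of "Node (Leaf a) r"] 2(2) root_node[of "Node (Leaf a) r"] by (intro bexI[of _ "[]"]) auto
  next
    case (Suc i')
    then obtain p where "p \<in> nodes r" "set (leaves (subtree r p)) = set (drop i' (spine r))"
      using 2 by auto
    then show ?thesis using Suc by (intro bexI[of _ "True # p"]) auto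
  qed
next
  case (3 l l' b)
  show ?case
  proof (cases i)
    case 0
    then show ?thesis using set_spine[of "Node (Node l l') (Leaf b)"] 3(2)
        root_node[of "Node (Node l l') (Leaf b)"] by (intro bexI[of _ "[]"]) auto
  next
    case (Suc i')
    have "caterpillar (Node l l')" "i' < length (spine (Node l l'))" using 3(2,3) Suc by auto
    from 3(1)[OF this] obtain p where p: "p \<in> nodes (Node l l')" "set (leaves (subtree (Node l l') p)) = set (drop i' (spine (Node l l')))"
      by blast
    have "False # p \<in> nodes (Node (Node l l') (Leaf b))" using p(1) by (simp only: nodes.simps(2)[of "Node l l'"]) blast
    then show ?thesis using Suc p(2) by (intro bexI[of _ "False # p"]) auto
  qed
qed simp

text \<open>A prefix inside the left part is a suffix of the left spine, hence the leaf set of a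
  node in the left subtree. For a longer prefix the complement is a suffix of the right
  spine.\<close>

lemma take_leaf_order:
  assumes "linear_decomposition D" "distinct (leaves D)" "i \<le> length (leaves D)"
  shows "\<exists>p\<in>nodes D. set (leaves (subtree D p)) = set (take i (leaf_order D)) \<or>
     set (leaves (subtree D p)) = set (leaves D) - set (take i (leaf_order D))"
proof -
  have st: "set (leaf_order D) = set (leaves D)" "length (leaf_order D) = length (leaves D)"
    using leaf_order_set[OF assms(1)] by auto
  then have d: "distinct (leaf_order D)" using distinct_card[OF assms(2)] by (intro card_distinct) simp
  have compl: "set (leaves D) - set (take i (leaf_order D)) = set (drop i (leaf_order D))"
  proof -
    have "set (take i (leaf_order D)) \<inter> set (drop i (leaf_order D)) = {}"
      using d by (metis append_take_drop_id distinct_append)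
    moreover have "set (take i (leaf_order D)) \<union> set (drop i (leaf_order D)) = set (leaf_order D)"
      by (simp flip: set_append)
    ultimately show ?thesis unfolding st(1)[symmetric] by blast
  qed
  show ?thesis
  proof (cases "i = 0 \<or> i = length (leaves D)")
    case True
    \<comment> \<open>The empty prefix is no leaf set of a node, but its complement is that of the
      root.\<close>
    then have "set (take i (leaf_order D)) = {} \<or> set (take i (leaf_order D)) = set (leaves D)"
      using st by (metis order_refl set_empty take_0 take_all)
    then show ?thesis by (intro bexI[of _ "[]"] root_node) (metis Diff_empty subtree.simps(1))
  next
    case False
    show ?thesis
    proof (cases D)
      case (Leaf a)
      then show ?thesis using False assms(3) by auto
    next
      case (Node l r)
      then have c: "caterpillar l" "caterpillar r" using caterpillar_children assms(1) by auto
      show ?thesis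
      proof (cases "i \<le> length (spine l)")
        case True
        then have "length (spine l) - i < length (spine l)" using False by linarith
        from drop_spine[OF c(1) this] obtain p where "p \<in> nodes l"
          "set (leaves (subtree l p)) = set (drop (length (spine l) - i) (spine l))"
          by blast
        then show ?thesis using True Node by (intro bexI[of _ "False # p"]) (auto simp: take_rev)
      next
        case F: False
        then have "i - length (spine l) < length (spine r)"
          using assms(3) False Node st by auto
        then obtain p where "p \<in> nodes r" "set (leaves (subtree r p)) = set (drop (i - length (spine l)) (spine r))"
          using drop_spine[OF c(2)] by blast
        then show ?thesis unfolding compl using F Node by (intro bexI[of _ "True # p"]) auto
      qed
    qed
  qed
qed

section \<open>The \<open>ps\<close>-value of prefixes of the leaf order\<close>

lemma finite_nodes: "finite (nodes t)"
  by (induction t) auto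

lemma ps_value_le_width: "p \<in> nodes D \<Longrightarrow> ps_value F (set (leaves (subtree D p))) \<le> ps_width F D"
  unfolding ps_width_def using finite_nodes by (intro Max_ge) auto

text \<open>Passing to the complement exchanges the two restricted formulas in the maximum, so it
  does not matter on which side of a cut the node lies.\<close>

lemma ps_value_compl:
  assumes "S \<subseteq> cla F <+> vars F"
  shows "ps_value F ((cla F <+> vars F) - S) = ps_value F S"
proof -
  have "Inl -` ((cla F <+> vars F) - S) = cla F - Inl -` S" "Inr -` ((cla F <+> vars F) - S) = vars F - Inr -` S"
    "cla F - (cla F - Inl -` S) = Inl -` S" "vars F - (vars F - Inr -` S) = Inr -` S"
    using assms by auto
  then show ?thesis unfolding ps_value_def Let_def by (simp only: max.commute)
qed

lemma ps_value_prefix: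
  assumes "branch_decomposition F D" "linear_decomposition D" "i \<le> length (leaf_order D)"
  shows "ps_value F (set (take i (leaf_order D))) \<le> ps_width F D"
proof -
  note st = leaf_order_set[OF assms(2)]
  have b: "distinct (leaves D)" "set (leaves D) = cla F <+> vars F" using assms(1) unfolding branch_decomposition_def by auto
  have "set (take i (leaf_order D)) \<subseteq> cla F <+> vars F" using st b(2) set_take_subset by fastforce
  then show ?thesis
    using take_leaf_order[OF assms(2) b(1), of i] ps_value_le_width[of _ D F] ps_value_compl[of _ F] assms(3) st b(2) by metis
qed

section \<open>Positions\<close>

lemma pos_in: "x \<in> set xs \<Longrightarrow> pos_in xs x < length xs \<and> xs ! pos_in xs x = x"
  unfolding pos_in_def by (induction xs) auto

lemma pos_in_nth: "distinct xs \<Longrightarrow> i < length xs \<Longrightarrow> pos_in xs (xs ! i) = i"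
  using pos_in[of "xs ! i" xs] nth_eq_iff_index_eq[of xs "pos_in xs (xs ! i)" i] by simp

section \<open>Precise satisfiability of restricted formulas\<close>

lemma count_cla: "c \<in> cla F \<longleftrightarrow> snd c < count F (fst c)"
  unfolding cla_def by (cases c) auto

lemma in_cla_0: "(C, 0) \<in> cla F \<longleftrightarrow> C \<in># F"
  by (simp add: cla_def)

lemma fst_cla: "c \<in> cla F \<Longrightarrow> fst c \<in># F"
  using count_cla[of c F] count_greater_zero_iff[of F "fst c"] by linarith

lemma vars_iff: "x \<in> vars F \<longleftrightarrow> (\<exists>C\<in>#F. x \<in> lvar ` C)"
proof
  assume "x \<in> vars F"
  then obtain c where "c \<in> cla F" "x \<in> lvar ` fst c" unfolding vars_def by auto
  then show "\<exists>C\<in>#F. x \<in> lvar ` C" using fst_cla by blast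
next
  assume "\<exists>C\<in>#F. x \<in> lvar ` C"
  then obtain C where "(C, 0) \<in> cla F" "x \<in> lvar ` C" using in_cla_0 by blast
  then show "x \<in> vars F" unfolding vars_def by (intro UN_I[of "(C, 0)"]) auto
qed

lemma satisfies_cong: "(\<And>l. l \<in> C \<Longrightarrow> \<tau> (lvar l) = \<tau>' (lvar l)) \<Longrightarrow> satisfies \<tau> C \<longleftrightarrow> satisfies \<tau>' C"
proof -
  assume a: "\<And>l. l \<in> C \<Longrightarrow> \<tau> (lvar l) = \<tau>' (lvar l)"
  have "lit_val \<tau> l = lit_val \<tau>' l" if "l \<in> C" for l using a[OF that] by (cases l) auto
  then show ?thesis unfolding satisfies_def by auto
qed

text \<open>The family speaks about positions of clauses, \<open>PS\<close> about occurrences of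
  restricted clauses. Equal restricted clauses are satisfied together, so occurrence 0 decides for
  all positions whose clause restricts to it; reading off these positions maps \<open>PS\<close>
  onto a superset of the family.\<close>

lemma card_PS_restrict:
  assumes fin: "finite (cla F)" "finite (vars F)" and sub: "\<C> \<subseteq> cla F" and cs: "\<And>c. c < m \<Longrightarrow> cs ! c \<in> cla F"
    and S: "\<And>S. S \<in> \<S> \<Longrightarrow> \<exists>\<tau>. S = {c. c < m \<and> cs ! c \<in> \<C> \<and> (\<exists>l\<in>fst (cs ! c). lvar l \<in> X \<and> lit_val \<tau> l)}"
  shows "card \<S> \<le> card (PS (restrict_cnf F \<C> X))"
proof -
  let ?F = "restrict_cnf F \<C> X"
  let ?r = "\<lambda>C. {l \<in> C. lvar l \<in> X}"
  have fC: "finite \<C>" using fin(1) sub finite_subset by blast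
  have F: "C \<in># ?F \<longleftrightarrow> (\<exists>c\<in>\<C>. C = ?r (fst c))" for C
  proof -
    have "restrict_cnf F \<C> X = image_mset (\<lambda>c. ?r (fst c)) (mset_set \<C>)"
      unfolding restrict_cnf_def by (rule arg_cong[where f = "\<lambda>f. image_mset f _"]) auto
    then show ?thesis using fC by auto
  qed
  have "vars ?F \<subseteq> vars F"
  proof
    fix x assume "x \<in> vars ?F"
    then obtain C where "C \<in># ?F" "x \<in> lvar ` C" unfolding vars_iff by blast
    then obtain c where "c \<in> \<C>" "x \<in> lvar ` ?r (fst c)" unfolding F by blast
    then show "x \<in> vars F" unfolding vars_iff using sub fst_cla by blast
  qed
  then have "finite (vars ?F)" using fin(2) finite_subset by blast
  then have finPS: "finite (PS ?F)"
    unfolding PS_def assignments_def by (intro finite_imageI finite_PiE) auto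
  let ?h = "\<lambda>U. {c. c < m \<and> cs ! c \<in> \<C> \<and> (?r (fst (cs ! c)), 0) \<in> U}"
  have "\<S> \<subseteq> ?h ` PS ?F"
  proof
    fix S assume "S \<in> \<S>"
    then obtain \<tau> where \<tau>: "S = {c. c < m \<and> cs ! c \<in> \<C> \<and> (\<exists>l\<in>fst (cs ! c). lvar l \<in> X \<and> lit_val \<tau> l)}"
      using S by blast
    let ?\<tau> = "restrict \<tau> (vars ?F)"
    have "(?r (fst (cs ! c)), 0) \<in> sat ?F ?\<tau> \<longleftrightarrow> (\<exists>l\<in>fst (cs ! c). lvar l \<in> X \<and> lit_val \<tau> l)"
      if c: "cs ! c \<in> \<C>" for c
    proof -
      have in': "?r (fst (cs ! c)) \<in># ?F" unfolding F using c by blast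
      have "satisfies ?\<tau> (?r (fst (cs ! c))) \<longleftrightarrow> satisfies \<tau> (?r (fst (cs ! c)))"
        using in' by (intro satisfies_cong) (auto simp: vars_iff restrict_def)
      then show ?thesis unfolding sat_def using in' by (auto simp: in_cla_0 satisfies_def)
    qed
    then have "S = ?h (sat ?F ?\<tau>)" unfolding \<tau> by blast
    moreover have "sat ?F ?\<tau> \<in> PS ?F" unfolding PS_def assignments_def by auto
    ultimately show "S \<in> ?h ` PS ?F" by blast
  qed
  then have "card \<S> \<le> card (?h ` PS ?F)" using finPS by (intro card_mono) auto
  also have "\<dots> \<le> card (PS ?F)" using finPS by (rule card_image_le)
  finally show ?thesis .
qed

section \<open>The elimination order of an instance\<close>

locale lin_inst =
  fixes F :: "nat cnf" and D xs cs ls n m s k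
  assumes inst: "linear_instance F D xs cs ls n m s k"
begin

definition "es = leaf_order D"
definition "E i = encode_label xs cs (es ! i)"
definition "PC c = pos_in es (Inl (cs ! c))"
definition "lit_of b = (if b = (0::nat) then Pos else Neg)"
definition "L e b c \<longleftrightarrow> m \<le> e \<and> e < m + n \<and> b < 2 \<and> c < m \<and> lit_of b (xs ! (e - m)) \<in> fst (cs ! c)"
abbreviation "N \<equiv> m + n"

lemma inst_facts:
  shows "is_cnf F" "card (vars F) = n" "card (cla F) = m" "cnf_size F = s"
    "branch_decomposition F D" "linear_decomposition D" "ps_width F D = k"
    "distinct xs" "set xs = vars F" "distinct cs" "set cs = cla F"
    "\<And>c. c \<in> cla F \<Longrightarrow> distinct (ls c) \<and> set (ls c) = fst c"
    "length xs = n" "length cs = m" "finite (vars F)" "finite (cla F)"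
    "distinct es" "set es = cla F <+> vars F" "length es = N"
proof -
  show a: "is_cnf F" "card (vars F) = n" "card (cla F) = m" "cnf_size F = s"
    "branch_decomposition F D" "linear_decomposition D" "ps_width F D = k"
    "distinct xs" "set xs = vars F" "distinct cs" "set cs = cla F"
    "\<And>c. c \<in> cla F \<Longrightarrow> distinct (ls c) \<and> set (ls c) = fst c"
    using inst unfolding linear_instance_def presentation_def by auto
  show b: "length xs = n" "length cs = m" using a(2,3,8-11) distinct_card by metis+
  show c: "finite (vars F)" "finite (cla F)" using a(9,11) by (metis finite_set)+
  have l: "length (leaves D) = N"
    using a(2,3,5) c distinct_card[of "leaves D"] unfolding branch_decomposition_def by (simp add: card_Plus)
  show "set es = cla F <+> vars F" "length es = N"
    using leaf_order_set[OF a(6)] a(5) l unfolding branch_decomposition_def es_def by auto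
  then show "distinct es" using a(2,3) c by (intro card_distinct) (simp add: card_Plus)
qed

lemma cs_nth: "c < m \<Longrightarrow> cs ! c \<in> cla F" "c < m \<Longrightarrow> fst (cs ! c) \<in># F"
  using inst_facts(11,14) fst_cla nth_mem by metis+

lemma xs_nth: "v < n \<Longrightarrow> xs ! v \<in> vars F"
  using inst_facts(9,13) nth_mem by metis

lemma es_nth: "i < N \<Longrightarrow> es ! i \<in> cla F <+> vars F"
  using inst_facts(18,19) nth_mem by metis

lemma encode_label: "x \<in> cla F <+> vars F \<Longrightarrow> encode_label xs cs x < N \<and>
   x = (if encode_label xs cs x < m then Inl (cs ! encode_label xs cs x) else Inr (xs ! (encode_label xs cs x - m)))"
  using pos_in[of _ cs] pos_in[of _ xs] inst_facts by (auto elim!: PlusE)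

lemma E_less: "i < N \<Longrightarrow> E i < N"
  using encode_label es_nth unfolding E_def by blast

lemma es_E: "i < N \<Longrightarrow> es ! i = (if E i < m then Inl (cs ! E i) else Inr (xs ! (E i - m)))"
  using encode_label es_nth unfolding E_def by blast

lemma E_inj: "inj_on E {..<N}"
proof (rule inj_onI)
  fix i j assume "i \<in> {..<N}" "j \<in> {..<N}" "E i = E j"
  then have "es ! i = es ! j" "i < length es" "j < length es" using es_E inst_facts(19) by auto
  then show "i = j" using inst_facts(17) nth_eq_iff_index_eq by blast
qed

lemma PC_pos: "c < m \<Longrightarrow> PC c < N \<and> es ! PC c = Inl (cs ! c) \<and> E (PC c) = c"
proof -
  assume c: "c < m"
  have "PC c < N \<and> es ! PC c = Inl (cs ! c)"
    unfolding PC_def using pos_in[of "Inl (cs ! c)" es] cs_nth(1)[OF c] inst_facts(18,19) by (metis InlI)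
  then show ?thesis using pos_in_nth[of cs c] c inst_facts(10,14) by (simp add: E_def)
qed

sublocale elimination_order m N E PC L w for w
  by unfold_locales (use E_less E_inj PC_pos in \<open>auto simp: L_def\<close>)

definition "vpos v = pos_in es (Inr v)"

lemma vpos: "v \<in> vars F \<Longrightarrow> vpos v < N \<and> es ! vpos v = Inr v \<and> m \<le> E (vpos v) \<and> xs ! (E (vpos v) - m) = v"
proof -
  assume v: "v \<in> vars F"
  have "vpos v < N \<and> es ! vpos v = Inr v"
    unfolding vpos_def using pos_in[of "Inr v" es] v inst_facts(18,19) by (metis InrI)
  then show ?thesis using pos_in[of v xs] v inst_facts(9,14) by (simp add: E_def)
qed

lemma vpos_eq: "i < N \<Longrightarrow> es ! i = Inr v \<Longrightarrow> vpos v = i"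
  using pos_in_nth inst_facts unfolding vpos_def by metis

text \<open>Branches become truth values. \<open>J\<close> is one side of a cut: an initial segment
  for the forward family, a final one for the backward family, and everything for full
  assignments.\<close>

lemma L_lit:
  assumes "\<And>i. i < N \<Longrightarrow> \<beta> i < 2" "c < m"
  shows "(\<exists>j<N. j \<in> J \<and> L (E j) (\<beta> j) c) \<longleftrightarrow>
    (\<exists>l\<in>fst (cs ! c). vpos (lvar l) \<in> J \<and> lit_val (\<lambda>v. \<beta> (vpos v) = 0) l)"
proof
  assume "\<exists>j<N. j \<in> J \<and> L (E j) (\<beta> j) c"
  then obtain j where j: "j < N" "j \<in> J" "L (E j) (\<beta> j) c" by blast
  let ?l = "lit_of (\<beta> j) (xs ! (E j - m))"
  have "vpos (xs ! (E j - m)) = j" using j es_E by (intro vpos_eq) (auto simp: L_def)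
  then have "vpos (lvar ?l) \<in> J \<and> lit_val (\<lambda>v. \<beta> (vpos v) = 0) ?l" using j(2) by (auto simp: lit_of_def)
  then show "\<exists>l\<in>fst (cs ! c). vpos (lvar l) \<in> J \<and> lit_val (\<lambda>v. \<beta> (vpos v) = 0) l"
    using j(3) unfolding L_def by blast
next
  assume "\<exists>l\<in>fst (cs ! c). vpos (lvar l) \<in> J \<and> lit_val (\<lambda>v. \<beta> (vpos v) = 0) l"
  then obtain l where l: "l \<in> fst (cs ! c)" "vpos (lvar l) \<in> J" "lit_val (\<lambda>v. \<beta> (vpos v) = 0) l" by blast
  have "lvar l \<in> vars F" using l(1) cs_nth(2)[OF assms(2)] unfolding vars_iff by blast
  note v = vpos[OF this]
  have "lit_of (\<beta> (vpos (lvar l))) (lvar l) = l" using l(3) by (cases l) (auto simp: lit_of_def)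
  then have "L (E (vpos (lvar l))) (\<beta> (vpos (lvar l))) c"
    unfolding L_def using v l assms E_less by auto
  then show "\<exists>j<N. j \<in> J \<and> L (E j) (\<beta> j) c" using v l(2) by blast
qed

lemma nb_le: "b < nb i \<Longrightarrow> b < 2"
  by (auto simp: nb_def split: if_splits)

lemma nth_in_take: "i \<le> N \<Longrightarrow> j < N \<Longrightarrow> es ! j \<in> set (take i es) \<longleftrightarrow> j < i"
proof
  assume a: "i \<le> N" "j < N" "es ! j \<in> set (take i es)"
  then obtain j' where "j' < i" "es ! j' = es ! j" using inst_facts(19) by (auto simp: in_set_conv_nth)
  then show "j < i" using nth_eq_iff_index_eq[OF inst_facts(17), of j' j] inst_facts(19) a(1,2) by auto
next
  assume a: "i \<le> N" "j < N" "j < i"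
  then show "es ! j \<in> set (take i es)" using inst_facts(19) by (auto simp: in_set_conv_nth intro!: exI[of _ j])
qed

lemma PC_take: "c < m \<Longrightarrow> i \<le> N \<Longrightarrow> Inl (cs ! c) \<in> set (take i es) \<longleftrightarrow> PC c < i"
  using PC_pos[of c] nth_in_take by metis

lemma vpos_take: "v \<in> vars F \<Longrightarrow> i \<le> N \<Longrightarrow> Inr v \<in> set (take i es) \<longleftrightarrow> vpos v < i"
  using vpos[of v] nth_in_take by metis

lemma lvar_vars: "c < m \<Longrightarrow> l \<in> fst (cs ! c) \<Longrightarrow> lvar l \<in> vars F"
  using cs_nth(2) unfolding vars_iff by blast

text \<open>For the cut after \<open>i\<close> elements, forward sets are what the variables inside
  can satisfy among the clauses outside, which is the formula \<open>F_v\<close> of the cut.\<close>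

lemma card_psetsA:
  assumes "i \<le> N"
  shows "card (psets m nb maskA litA i) \<le> k"
proof -
  let ?S = "set (take i es)"
  let ?C = "cla F - Inl -` ?S" and ?X = "Inr -` ?S"
  have "card (psets m nb maskA litA i) \<le> card (PS (restrict_cnf F ?C ?X))"
  proof (rule card_PS_restrict[where m = m and cs = cs, OF inst_facts(16,15)])
    fix S assume "S \<in> psets m nb maskA litA i"
    then obtain bs where bs: "bs \<in> paths nb i" "S = {c \<in> rset bs. c < m \<and> i \<le> PC c}"
      using psetsA[OF assms] by auto
    \<comment> \<open>The path says nothing about positions from \<open>i\<close> on. Branch 0 is an
      arbitrary default there, invisible because only positions below \<open>i\<close> are looked
      at.\<close>
    let ?\<beta> = "\<lambda>j. if j < i then rev bs ! j else 0"
    let ?\<tau> = "\<lambda>v. ?\<beta> (vpos v) = 0"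
    have \<beta>: "?\<beta> j < 2" for j using nth_paths[OF bs(1)] nb_le by auto
    have "c \<in> S \<longleftrightarrow> cs ! c \<in> ?C \<and> (\<exists>l\<in>fst (cs ! c). lvar l \<in> ?X \<and> lit_val ?\<tau> l)" if c: "c < m" for c
    proof -
      have "c \<in> rset bs \<longleftrightarrow> (\<exists>j<N. j \<in> {..<i} \<and> L (E j) (?\<beta> j) c)"
        unfolding rset_iff using length_paths[OF bs(1)] assms by auto
      also have "\<dots> \<longleftrightarrow> (\<exists>l\<in>fst (cs ! c). vpos (lvar l) \<in> {..<i} \<and> lit_val ?\<tau> l)"
        using \<beta> c by (intro L_lit) auto
      also have "\<dots> \<longleftrightarrow> (\<exists>l\<in>fst (cs ! c). lvar l \<in> ?X \<and> lit_val ?\<tau> l)"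
        using vpos_take[OF lvar_vars[OF c] assms] by auto
      finally show ?thesis unfolding bs(2) using c cs_nth[OF c] PC_take[OF c assms] by auto
    qed
    then have "S = {c. c < m \<and> cs ! c \<in> ?C \<and> (\<exists>l\<in>fst (cs ! c). lvar l \<in> ?X \<and> lit_val ?\<tau> l)}"
      using bs(2) by blast
    then show "\<exists>\<tau>. S = {c. c < m \<and> cs ! c \<in> ?C \<and> (\<exists>l\<in>fst (cs ! c). lvar l \<in> ?X \<and> lit_val \<tau> l)}" by blast
  qed (use cs_nth in auto)
  also have "\<dots> \<le> ps_value F ?S" unfolding ps_value_def Let_def by simp
  also have "\<dots> \<le> k" using ps_value_prefix[OF inst_facts(5,6), of i] inst_facts(7,19) assms unfolding es_def by simp
  finally show ?thesis .
qed

text \<open>Dually, backward sets are what the variables outside a prefix can satisfy among the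
  clauses inside it, which is the second formula of the \<open>ps\<close>-value.\<close>

lemma card_psetsB:
  assumes "j \<le> N"
  shows "card (psets m nbB maskB litB j) \<le> k"
proof -
  let ?S = "set (take (N - j) es)"
  let ?C = "Inl -` ?S" and ?X = "vars F - Inr -` ?S"
  have "card (psets m nbB maskB litB j) \<le> card (PS (restrict_cnf F ?C ?X))"
  proof (rule card_PS_restrict[where m = m and cs = cs, OF inst_facts(16,15)])
    fix S assume "S \<in> psets m nbB maskB litB j"
    then obtain \<beta> where \<beta>: "\<forall>i<N. \<beta> i < nb i" "S = {c. c < m \<and> PC c + j < N \<and> (\<exists>i<N. N - j \<le> i \<and> L (E i) (\<beta> i) c)}"
      using psetsB_sub[OF assms] by blast
    let ?\<tau> = "\<lambda>v. \<beta> (vpos v) = 0"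
    have "c \<in> S \<longleftrightarrow> cs ! c \<in> ?C \<and> (\<exists>l\<in>fst (cs ! c). lvar l \<in> ?X \<and> lit_val ?\<tau> l)" if c: "c < m" for c
    proof -
      have "(\<exists>i<N. N - j \<le> i \<and> L (E i) (\<beta> i) c) \<longleftrightarrow> (\<exists>i<N. i \<in> {N - j..} \<and> L (E i) (\<beta> i) c)" by auto
      also have "\<dots> \<longleftrightarrow> (\<exists>l\<in>fst (cs ! c). vpos (lvar l) \<in> {N - j..} \<and> lit_val ?\<tau> l)"
        using \<beta>(1) nb_le c by (intro L_lit) auto
      also have "\<dots> \<longleftrightarrow> (\<exists>l\<in>fst (cs ! c). lvar l \<in> ?X \<and> lit_val ?\<tau> l)"
        using vpos_take[OF lvar_vars[OF c], of _ "N - j"] lvar_vars[OF c] by (auto simp: not_less)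
      finally show ?thesis unfolding \<beta>(2) using c cs_nth[OF c] PC_take[OF c, of "N - j"] by auto
    qed
    then have "S = {c. c < m \<and> cs ! c \<in> ?C \<and> (\<exists>l\<in>fst (cs ! c). lvar l \<in> ?X \<and> lit_val ?\<tau> l)}"
      using \<beta>(2) by blast
    then show "\<exists>\<tau>. S = {c. c < m \<and> cs ! c \<in> ?C \<and> (\<exists>l\<in>fst (cs ! c). lvar l \<in> ?X \<and> lit_val \<tau> l)}" by blast
  next
    show "?C \<subseteq> cla F" using inst_facts(18) set_take_subset[of "N - j" es] by auto
  qed (use cs_nth in auto)
  also have "\<dots> \<le> ps_value F ?S" unfolding ps_value_def Let_def by simp
  also have "\<dots> \<le> k" using ps_value_prefix[OF inst_facts(5,6), of "N - j"] inst_facts(7,19) assms unfolding es_def by simp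
  finally show ?thesis .
qed

subsection \<open>Paths and assignments\<close>

definition "asg (bs :: nat list) = (\<lambda>v\<in>vars F. rev bs ! vpos v = 0)"

lemma asg_assignment: "asg bs \<in> assignments (vars F)"
  unfolding asg_def assignments_def by auto

lemma satisfies_asg:
  assumes "bs \<in> paths nb N" "c < m"
  shows "satisfies (asg bs) (fst (cs ! c)) \<longleftrightarrow> c \<in> rset bs"
proof -
  have "c \<in> rset bs \<longleftrightarrow> (\<exists>j<N. j \<in> UNIV \<and> L (E j) (rev bs ! j) c)"
    unfolding rset_iff using length_paths[OF assms(1)] by auto
  also have "\<dots> \<longleftrightarrow> (\<exists>l\<in>fst (cs ! c). vpos (lvar l) \<in> UNIV \<and> lit_val (\<lambda>v. rev bs ! vpos v = 0) l)"
    using nth_paths[OF assms(1)] nb_le assms(2) by (intro L_lit) auto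
  also have "\<dots> \<longleftrightarrow> satisfies (\<lambda>v. rev bs ! vpos v = 0) (fst (cs ! c))" unfolding satisfies_def by simp
  also have "\<dots> \<longleftrightarrow> satisfies (asg bs) (fst (cs ! c))"
    using lvar_vars[OF assms(2)] by (intro satisfies_cong) (auto simp: asg_def)
  finally show ?thesis by simp
qed

text \<open>Clause positions admit only branch 0, so a full path carries no information beyond the
  values of the variables. With surjectivity, counting paths is counting assignments.\<close>

lemma asg_inj: "inj_on asg (paths nb N)"
proof (rule inj_onI)
  fix bs bs' assume a: "bs \<in> paths nb N" "bs' \<in> paths nb N" "asg bs = asg bs'"
  have "rev bs ! i = rev bs' ! i" if "i < N" for i
  proof (cases "E i < m")
    case True
    then show ?thesis using nth_paths[OF a(1) that] nth_paths[OF a(2) that] by (simp add: nb_def)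
  next
    case False
    then have e: "es ! i = Inr (xs ! (E i - m))" "xs ! (E i - m) \<in> vars F"
      using es_E[OF that] E_less[OF that] xs_nth[of "E i - m"] by auto
    have "(rev bs ! i = 0) = (rev bs' ! i = 0)"
      using fun_cong[OF a(3), of "xs ! (E i - m)"] vpos_eq[OF that e(1)] e(2) by (simp add: asg_def)
    then show ?thesis using nth_paths[OF a(1) that] nth_paths[OF a(2) that] False
      by (simp add: nb_def) linarith
  qed
  then have "rev bs = rev bs'" using a length_paths by (intro nth_equalityI) auto
  then show "bs = bs'" by simp
qed

lemma asg_surj:
  assumes "\<tau> \<in> assignments (vars F)"
  shows "\<tau> \<in> asg ` paths nb N"
proof
  let ?f = "\<lambda>j. if E j < m \<or> \<tau> (xs ! (E j - m)) then 0 else 1"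
  let ?bs = "rev (map ?f [0..<N])"
  show "?bs \<in> paths nb N" by (rule pathsI) (auto simp: nb_def)
  show "\<tau> = asg ?bs"
  proof
    fix v show "\<tau> v = asg ?bs v"
    proof (cases "v \<in> vars F")
      case True
      then show ?thesis using vpos[OF True] by (auto simp: asg_def)
    next
      case False
      then show ?thesis using assms by (auto simp: asg_def assignments_def PiE_def extensional_def)
    qed
  qed
qed

lemma cla_cs: "cla F = (\<lambda>c. cs ! c) ` {..<m}"
  using inst_facts(11,14) by (metis atLeast0LessThan list.set_map map_nth set_upt)

lemma sat_asg: "bs \<in> paths nb N \<Longrightarrow> sat F (asg bs) = (\<lambda>c. cs ! c) ` {c. c < m \<and> c \<in> rset bs}"
proof -
  assume a: "bs \<in> paths nb N"
  have "sat F (asg bs) = {c \<in> cla F. satisfies (asg bs) (fst c)}" unfolding sat_def by auto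
  then show ?thesis unfolding cla_cs using satisfies_asg[OF a] by auto
qed

lemma num_models_paths: "num_models F = card {bs \<in> paths nb N. \<forall>c<m. c \<in> rset bs}"
proof -
  have "sat F (asg bs) = cla F \<longleftrightarrow> (\<forall>c<m. c \<in> rset bs)" if "bs \<in> paths nb N" for bs
  proof -
    have "sat F (asg bs) = cla F \<longleftrightarrow> (\<forall>c\<in>cla F. satisfies (asg bs) (fst c))" unfolding sat_def by auto
    also have "\<dots> \<longleftrightarrow> (\<forall>c<m. c \<in> rset bs)" unfolding cla_cs using satisfies_asg[OF that] by auto
    finally show ?thesis .
  qed
  then have eq: "{\<tau> \<in> assignments (vars F). sat F \<tau> = cla F} = asg ` {bs \<in> paths nb N. \<forall>c<m. c \<in> rset bs}"
    using asg_surj asg_assignment by (fastforce simp: image_iff)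
  show ?thesis unfolding num_models_def eq
    by (rule card_image, rule inj_on_subset[OF asg_inj]) auto
qed

lemma weight_asg:
  "bs \<in> paths nb N \<Longrightarrow> (\<Sum>c\<in>sat F (asg bs). w c) = (\<Sum>c\<in>{c. c < m \<and> c \<in> rset bs}. w (cs ! c))"
  unfolding sat_asg using inst_facts(10,14)
  by (subst sum.reindex) (auto simp: inj_on_def nth_eq_iff_index_eq)

lemma max_weight_asg:
  assumes "bs \<in> paths nb N" "\<And>bs'. bs' \<in> paths nb N \<Longrightarrow>
    (\<Sum>c\<in>{c. c < m \<and> c \<in> rset bs'}. w (cs ! c)) \<le> (\<Sum>c\<in>{c. c < m \<and> c \<in> rset bs}. w (cs ! c))"
  shows "max_weight_assignment F w (asg bs)"
  unfolding max_weight_assignment_def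
proof (intro conjI ballI asg_assignment)
  fix \<tau> assume "\<tau> \<in> assignments (vars F)"
  then obtain bs' where "bs' \<in> paths nb N" "\<tau> = asg bs'" using asg_surj by blast
  then show "(\<Sum>c\<in>sat F \<tau>. w c) \<le> (\<Sum>c\<in>sat F (asg bs). w c)"
    using assms(2)[of bs'] weight_asg[OF assms(1), of w] weight_asg[of bs' w] by simp
qed

text \<open>Branch 0 means true, so the output bit is one minus the branch.\<close>

lemma represents_asg:
  "represents_assignment xs (map (\<lambda>v. 1 - rev bs ! vpos (xs ! v)) [0..<n]) (asg bs)"
  unfolding represents_assignment_def
  by (rule nth_equalityI) (use inst_facts(13) xs_nth in \<open>auto simp: asg_def\<close>)

end

section \<open>Programming notation\<close>

notation HAdd (infixl "\<oplus>" 65) and HSub (infixl "\<ominus>" 65) and HMul (infixl "\<otimes>" 70)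
  and HDiv (infixl "\<oslash>" 70) and PSeq (infixr ";;" 60) and PAsg (infix "::=" 61) and PSto (infix "\<lhd>" 61)
  and HReg ("$_" [100] 100)

text \<open>Registers: 2, 3, 4 hold \<open>m\<close>, \<open>n\<close>, \<open>m + n\<close>; 5 the input address; 15 the level; 16 the branch; 17 and 18
  the indices of a forward and a backward set; 19 the label; 25 the number of bits of table entries.
  Arrays: 2 literals, indexed by label, branch and clause; 3 the order; 4 positions of the clauses;
  5, 6, 7 the forward sets, their number per level and the maps between levels; 8, 9, 10 the same
  backwards; 11 the table; 12, 13 the choices attaining a maximum; 14 weights; 15 a number.\<close>

declare wp.simps(6) [simp del]

lemma frame_reg: "frame p r \<mu> r' \<mu>' \<Longrightarrow> x \<notin> modr p \<Longrightarrow> r' x = r x"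
  by (simp add: frame_def)

lemma frame_mem: "frame p r \<mu> r' \<mu>' \<Longrightarrow> a \<notin> modm p \<Longrightarrow> \<mu>' (a # ks) = \<mu> (a # ks)"
  by (simp add: frame_def)

definition min1 :: "hexp \<Rightarrow> hexp" where
  "min1 e = HNum 1 \<ominus> (HNum 1 \<ominus> e)"

lemma hval_min1 [simp]: "hval inp (min1 e) r \<mu> = of_bool (hval inp e r \<mu> \<noteq> 0)"
  by (simp add: min1_def)

definition vec :: "nat \<Rightarrow> (nat list \<Rightarrow> nat) \<Rightarrow> nat \<Rightarrow> nat \<Rightarrow> nat \<Rightarrow> nat set" where
  "vec m \<mu> a i p = {c. c < m \<and> \<mu> [a, i, p, c] \<noteq> 0}"

definition bits :: "nat \<Rightarrow> (nat list \<Rightarrow> nat) \<Rightarrow> nat \<Rightarrow> nat \<Rightarrow> nat \<Rightarrow> bool" where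
  "bits m \<mu> a i p \<longleftrightarrow> (\<forall>c<m. \<mu> [a, i, p, c] \<le> 1)"

lemma vec_eq_iff:
  assumes "bits m \<mu> a i p" "bits m \<mu> a i q"
  shows "vec m \<mu> a i p = vec m \<mu> a i q \<longleftrightarrow> (\<forall>c<m. \<mu> [a, i, p, c] = \<mu> [a, i, q, c])"
proof
  assume eq: "vec m \<mu> a i p = vec m \<mu> a i q"
  show "\<forall>c<m. \<mu> [a, i, p, c] = \<mu> [a, i, q, c]"
  proof (intro allI impI)
    fix c assume c: "c < m"
    then have "\<mu> [a, i, p, c] \<noteq> 0 \<longleftrightarrow> \<mu> [a, i, q, c] \<noteq> 0" using eq unfolding vec_def by blast
    moreover have "\<mu> [a, i, p, c] \<le> 1" "\<mu> [a, i, q, c] \<le> 1" using assms c by (auto simp: bits_def)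
    ultimately show "\<mu> [a, i, p, c] = \<mu> [a, i, q, c]" by linarith
  qed
qed (auto simp: vec_def)

lemma finite_psets: "finite (psets m nb msk lit i)"
  by (rule finite_subset[of _ "Pow {..<m}"]) (cases i; auto)+

section \<open>Enumerating precisely satisfiable sets\<close>

definition build :: "nat \<Rightarrow> hexp \<Rightarrow> prog" where
  "build a msk = PFor 6 ($2) ([HNum a, $15 \<oplus> HNum 1, $20, $6] \<lhd>
     min1 msk \<otimes> min1 (HGet [HNum a, $15, $17, $6] \<oplus> HGet [HNum 2, $19, $16, $6]))"

text \<open>Linear search for the candidate in row \<open>$20\<close> among the rows before it. The
  two truncated differences add up to an absolute difference, so register 22 counts disagreements;
  register 21 remains \<open>$20\<close> if no row agrees.\<close>

definition search :: "nat \<Rightarrow> prog" where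
  "search a = 21 ::= $20 ;; PFor 18 ($20)
     (22 ::= HNum 0 ;;
      PFor 6 ($2) (22 ::= $22 \<oplus>
        ((HGet [HNum a, $15 \<oplus> HNum 1, $18, $6] \<ominus> HGet [HNum a, $15 \<oplus> HNum 1, $20, $6]) \<oplus>
         (HGet [HNum a, $15 \<oplus> HNum 1, $20, $6] \<ominus> HGet [HNum a, $15 \<oplus> HNum 1, $18, $6]))) ;;
      PIf ($22) PSkip (21 ::= $18))"

text \<open>The candidate is written behind the rows found so far. It becomes permanent only if the
  search found no equal row, since otherwise \<open>$20\<close> is not advanced and the next
  candidate overwrites it.\<close>

definition ps_step :: "nat \<Rightarrow> nat \<Rightarrow> hexp \<Rightarrow> prog" where
  "ps_step a f msk = build a msk ;; search a ;; [HNum f, $15, $16, $17] \<lhd> $21 ;;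
     PIf ($20 \<ominus> $21) PSkip (20 ::= $20 \<oplus> HNum 1)"

text \<open>The innermost difference is positive exactly for clause labels, so the value is 1 for
  clauses and 2 for variables.\<close>

definition branches :: hexp where
  "branches = HNum 1 \<oplus> (HNum 1 \<ominus> ($2 \<ominus> $19))"

definition ps_level :: "nat \<Rightarrow> nat \<Rightarrow> nat \<Rightarrow> hexp \<Rightarrow> hexp \<Rightarrow> prog" where
  "ps_level a cn f lab msk = 19 ::= lab ;; 20 ::= HNum 0 ;;
     PFor 16 branches (PFor 17 (HGet [HNum cn, $15]) (ps_step a f msk)) ;;
     [HNum cn, $15 \<oplus> HNum 1] \<lhd> $20"

definition ps_gen :: "nat \<Rightarrow> nat \<Rightarrow> nat \<Rightarrow> hexp \<Rightarrow> hexp \<Rightarrow> prog" where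
  "ps_gen a cn f lab msk = [HNum cn, HNum 0] \<lhd> HNum 1 ;; PFor 15 ($4) (ps_level a cn f lab msk)"

lemma mod_build [simp]: "modr (build a msk) = {6}" "modm (build a msk) = {a}" "wf_prog (build a msk)"
  by (auto simp: build_def)

lemma mod_search [simp]: "modr (search a) = {6, 18, 21, 22}" "modm (search a) = {}" "wf_prog (search a)"
  by (auto simp: search_def)

lemma mod_ps_step [simp]: "modr (ps_step a f msk) = {6, 18, 20, 21, 22}" "modm (ps_step a f msk) = {a, f}"
    "wf_prog (ps_step a f msk)"
  by (auto simp: ps_step_def)

lemma mod_ps_level [simp]: "modr (ps_level a cn f lab msk) = {6, 16, 17, 18, 19, 20, 21, 22}"
    "modm (ps_level a cn f lab msk) = {a, f, cn}" "wf_prog (ps_level a cn f lab msk)"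
  by (auto simp: ps_level_def)

lemma mod_ps_gen [simp]: "modr (ps_gen a cn f lab msk) = {6, 15, 16, 17, 18, 19, 20, 21, 22}"
    "modm (ps_gen a cn f lab msk) = {a, f, cn}" "wf_prog (ps_gen a cn f lab msk)"
  by (auto simp: ps_gen_def)

lemma wp_build:
  assumes "r 2 \<le> V" "1 \<le> V" "a \<noteq> 2"
    and msk: "\<And>r' \<mu>' c. c < r 2 \<Longrightarrow> r' 6 = c \<Longrightarrow> (\<And>x. x \<noteq> 6 \<Longrightarrow> r' x = r x) \<Longrightarrow>
      (\<And>b ks. b \<noteq> a \<Longrightarrow> \<mu>' (b # ks) = \<mu> (b # ks)) \<Longrightarrow> hval inp msk r' \<mu>' \<noteq> 0 \<longleftrightarrow> M c"
    and Q: "\<And>r' \<mu>' t. frame (build a msk) r \<mu> r' \<mu>' \<Longrightarrow> t \<le> r 2 \<Longrightarrow>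
      (\<And>c. c < r 2 \<Longrightarrow> \<mu>' [a, Suc (r 15), r 20, c] =
         of_bool (M c \<and> (\<mu> [a, r 15, r 17, c] \<noteq> 0 \<or> \<mu> [2, r 19, r 16, c] \<noteq> 0))) \<Longrightarrow>
      (\<And>k. (\<And>c. k \<noteq> [a, Suc (r 15), r 20, c]) \<Longrightarrow> \<mu>' k = \<mu> k) \<Longrightarrow> Q r' \<mu>' t"
  shows "wp inp V (build a msk) Q r \<mu>"
  unfolding build_def
proof (rule wp_For[where T = 0 and I = "\<lambda>j r' \<mu>'.
   (\<forall>c<j. \<mu>' [a, Suc (r 15), r 20, c] = of_bool (M c \<and> (\<mu> [a, r 15, r 17, c] \<noteq> 0 \<or> \<mu> [2, r 19, r 16, c] \<noteq> 0))) \<and>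
   (\<forall>k. (\<forall>c. k \<noteq> [a, Suc (r 15), r 20, c]) \<longrightarrow> \<mu>' k = \<mu> k)"], goal_cases)
  case (3 j r' \<mu>')
  have fr: "r' x = r x" if "x \<noteq> 6" for x using frame_reg[OF 3(4), of x] that by simp
  have m: "\<mu>' (b # ks) = \<mu> (b # ks)" if "b \<noteq> a" for b ks using frame_mem[OF 3(4), of b ks] that by simp
  have v: "hval inp msk r' \<mu>' \<noteq> 0 \<longleftrightarrow> M j" using 3 fr m by (intro msk) auto
  have o: "\<mu>' [a, r 15, r 17, j] = \<mu> [a, r 15, r 17, j]" using 3(2) by auto
  show ?case
    using 3 assms(2,3) fr v o m by (auto simp: less_Suc_eq)
next
  case (4 r' \<mu>' t)
  show ?case using 4 by (intro Q) (auto simp: build_def)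
qed (use assms in auto)

lemma wp_search:
  assumes "r 2 \<le> V" "r 20 \<le> V" and b: "\<And>q. q \<le> r 20 \<Longrightarrow> bits (r 2) \<mu> a (Suc (r 15)) q"
    and Q: "\<And>r' \<mu>' t. frame (search a) r \<mu> r' \<mu>' \<Longrightarrow> t \<le> r 20 * Suc (r 2) \<Longrightarrow>
      r' 21 \<le> r 20 \<Longrightarrow> vec (r 2) \<mu> a (Suc (r 15)) (r' 21) = vec (r 2) \<mu> a (Suc (r 15)) (r 20) \<Longrightarrow>
      (r' 21 = r 20 \<Longrightarrow> \<forall>q<r 20. vec (r 2) \<mu> a (Suc (r 15)) q \<noteq> vec (r 2) \<mu> a (Suc (r 15)) (r 20)) \<Longrightarrow> Q r' \<mu>' t"
  shows "wp inp V (search a) Q r \<mu>"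
proof -
  let ?v = "vec (r 2) \<mu> a (Suc (r 15))"
  have *: "wp inp V (search a) (\<lambda>r' \<mu>' t. t \<le> r 20 * Suc (r 2) \<and> (r' 21 = r 20 \<and> (\<forall>q<r 20. ?v q \<noteq> ?v (r 20)) \<or>
      r' 21 < r 20 \<and> ?v (r' 21) = ?v (r 20))) r \<mu>"
    unfolding search_def wp.simps(2,4)
  proof (intro conjI, goal_cases)
    case 2
    show ?case
    proof (rule wp_For[where T = "r 2" and I = "\<lambda>j r' \<mu>'. r' 21 = r 20 \<and> (\<forall>q<j. ?v q \<noteq> ?v (r 20)) \<or>
      r' 21 < r 20 \<and> ?v (r' 21) = ?v (r 20)"], goal_cases)
      case (3 j r' \<mu>')
      have fr: "r' x = r x" if "x \<noteq> 6" "x \<noteq> 18" "x \<noteq> 21" "x \<noteq> 22" for x using frame_reg[OF 3(4), of x] that by simp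
      have m: "\<mu>' (b # ks) = \<mu> (b # ks)" for b ks using frame_mem[OF 3(4), of b ks] by simp
      have j: "j < r 20" using 3(1) by simp
      show ?case
        unfolding wp.simps(2,4)
      proof (intro conjI, goal_cases)
        case 2
        show ?case
        proof (rule wp_For[where T = 0 and I = "\<lambda>d r'' \<mu>''. r'' 22 \<le> d \<and>
            (r'' 22 = 0 \<longleftrightarrow> (\<forall>c<d. \<mu> [a, Suc (r 15), j, c] = \<mu> [a, Suc (r 15), r 20, c]))"], goal_cases)
          case (3 d r'' \<mu>'')
          have fr2: "r'' x = r' x" if "x \<noteq> 6" "x \<noteq> 22" for x using frame_reg[OF 3(4), of x] that by simp
          have m2: "\<mu>'' (b # ks) = \<mu> (b # ks)" for b ks using frame_mem[OF 3(4), of b ks] m by simp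
          have d: "d < r 2" using 3(1) fr by simp
          have "\<mu> [a, Suc (r 15), j, d] \<le> 1" "\<mu> [a, Suc (r 15), r 20, d] \<le> 1"
            using b[of j] b[of "r 20"] j d by (auto simp: bits_def)
          then show ?case using 3 fr fr2 m2 d assms(1) \<open>r' 18 = j\<close> by (auto simp: less_Suc_eq)
        next
          case (4 r'' \<mu>'' t)
          have fr2: "r'' x = r' x" if "x \<noteq> 6" "x \<noteq> 22" for x using frame_reg[OF 4(3), of x] that by simp
          have "r'' 22 = 0 \<longleftrightarrow> ?v j = ?v (r 20)"
            using 4(1) vec_eq_iff[OF b b, of j "r 20"] j fr by simp
          then show ?case using 4 3(2,3) j fr fr2 assms(2) by (auto simp: less_Suc_eq)
        qed (use fr assms in auto)
      qed simp
    next
      case (4 r' \<mu>' t)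
      then show ?case by auto
    qed (use assms in auto)
  qed (use assms in simp)
  show ?thesis by (rule wp_mono[OF wp_frame[OF *]], rule Q) auto
qed

definition base :: "nat \<Rightarrow> nat \<Rightarrow> (nat \<Rightarrow> nat) \<Rightarrow> (nat \<Rightarrow> nat) \<Rightarrow> (nat \<Rightarrow> nat \<Rightarrow> nat \<Rightarrow> bool) \<Rightarrow>
    (nat \<Rightarrow> nat) \<Rightarrow> (nat list \<Rightarrow> nat) \<Rightarrow> bool" where
  "base m n E PC L r \<mu> \<longleftrightarrow> r 2 = m \<and> r 3 = n \<and> r 4 = m + n \<and>
     (\<forall>e<m+n. \<forall>b<2. \<forall>c<m. \<mu> [2, e, b, c] = of_bool (L e b c)) \<and>
     (\<forall>i<m+n. \<mu> [3, i] = E i) \<and> (\<forall>c<m. \<mu> [4, c] = PC c)"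

lemma base_cong:
  assumes "base m n E PC L r \<mu>" "\<And>x. x \<in> {2, 3, 4} \<Longrightarrow> r' x = r x"
    "\<And>b ks. b \<in> {2, 3, 4} \<Longrightarrow> \<mu>' (b # ks) = \<mu> (b # ks)"
  shows "base m n E PC L r' \<mu>'"
  using assms unfolding base_def by simp

text \<open>The forward and the backward enumeration differ only in the element handled at a level
  (\<open>lev\<close>), the mask and the arrays; both are verified here at once.\<close>

locale ps_context =
  fixes inp :: "nat \<Rightarrow> nat" and V m n K :: nat and E PC :: "nat \<Rightarrow> nat" and L :: "nat \<Rightarrow> nat \<Rightarrow> nat \<Rightarrow> bool"
    and lev :: "nat \<Rightarrow> nat" and M :: "nat \<Rightarrow> nat \<Rightarrow> bool" and nb :: "nat \<Rightarrow> nat" and lt :: "nat \<Rightarrow> nat \<Rightarrow> nat \<Rightarrow> bool"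
    and a cn f :: nat and lab msk :: hexp
  assumes names: "distinct [2, 3, 4, a, cn, f]"
    and lab: "\<And>r \<mu> i. base m n E PC L r \<mu> \<Longrightarrow> r 15 = i \<Longrightarrow> i < m + n \<Longrightarrow> hval inp lab r \<mu> = E (lev i)"
    and msk: "\<And>r \<mu> i c. base m n E PC L r \<mu> \<Longrightarrow> r 15 = i \<Longrightarrow> i < m + n \<Longrightarrow> r 6 = c \<Longrightarrow> c < m \<Longrightarrow>
      hval inp msk r \<mu> \<noteq> 0 \<longleftrightarrow> M i c"
    and E_lev: "\<And>i. i < m + n \<Longrightarrow> E (lev i) < m + n"
    and nb: "\<And>i. i < m + n \<Longrightarrow> nb i = (if E (lev i) < m then 1 else 2)"
    and lt: "\<And>i b c. i < m + n \<Longrightarrow> lt i b c \<longleftrightarrow> L (E (lev i)) b c"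
    and K: "\<And>i. i \<le> m + n \<Longrightarrow> card (psets m nb M lt i) \<le> K"
    and V: "m + n \<le> V" "K \<le> V" "2 \<le> V"
begin

abbreviation "N \<equiv> m + n"

definition "stp i b S = {c. c < m \<and> M i c \<and> (c \<in> S \<or> lt i b c)}"

definition "good i \<mu> \<longleftrightarrow>
  (\<forall>i'\<le>i. (\<forall>p<\<mu> [cn, i']. bits m \<mu> a i' p) \<and> inj_on (vec m \<mu> a i') {..<\<mu> [cn, i']} \<and>
     vec m \<mu> a i' ` {..<\<mu> [cn, i']} = psets m nb M lt i') \<and>
  (\<forall>i'<i. \<forall>b<nb i'. \<forall>p<\<mu> [cn, i']. \<mu> [f, i', b, p] < \<mu> [cn, Suc i'] \<and>
     vec m \<mu> a (Suc i') (\<mu> [f, i', b, p]) = stp i' b (vec m \<mu> a i' p))"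

definition "precedes i b p \<mu> b' p' \<longleftrightarrow> p' < \<mu> [cn, i] \<and> (b' < b \<or> b' = b \<and> p' < (p::nat))"

text \<open>The state in the middle of a level: the \<open>k\<close> rows of the next level
  enumerate the successors along all pairs lexicographically before \<open>(b, p)\<close>.\<close>

definition "part i b p k \<mu> \<longleftrightarrow> (\<forall>q<k. bits m \<mu> a (Suc i) q) \<and> inj_on (vec m \<mu> a (Suc i)) {..<k} \<and>
   vec m \<mu> a (Suc i) ` {..<k} = {stp i b' (vec m \<mu> a i p') | b' p'. precedes i b p \<mu> b' p'} \<and>
   (\<forall>b' p'. precedes i b p \<mu> b' p' \<longrightarrow> \<mu> [f, i, b', p'] < k \<and>
      vec m \<mu> a (Suc i) (\<mu> [f, i, b', p']) = stp i b' (vec m \<mu> a i p'))"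

lemma good_cong:
  assumes "good i \<mu>" "\<And>i'. i' \<le> i \<Longrightarrow> \<mu>' [cn, i'] = \<mu> [cn, i']"
    "\<And>i' p c. i' \<le> i \<Longrightarrow> \<mu>' [a, i', p, c] = \<mu> [a, i', p, c]"
    "\<And>i' b p. i' < i \<Longrightarrow> \<mu>' [f, i', b, p] = \<mu> [f, i', b, p]"
  shows "good i \<mu>'"
proof -
  have v: "vec m \<mu>' a i' p = vec m \<mu> a i' p" "bits m \<mu>' a i' p = bits m \<mu> a i' p" if "i' \<le> i" for i' p
    using assms(3)[OF that] by (auto simp: vec_def bits_def)
  have v': "vec m \<mu>' a i' = vec m \<mu> a i'" if "i' \<le> i" for i' using v(1)[OF that] by blast
  show ?thesis using assms(1,2,4) unfolding good_def by (simp add: v v')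
qed

text \<open>The rows found so far are distinct members of the next level, whose size is at most
  \<open>K\<close>. The disjunction on \<open>p\<close> and \<open>b\<close> admits the final state
  \<open>(nb i, 0)\<close>.\<close>

lemma part_bound:
  assumes "part i b p k \<mu>" "good i \<mu>" "i < N" "b \<le> nb i" "p = 0 \<or> b < nb i"
  shows "k \<le> K"
proof -
  have "{stp i b' (vec m \<mu> a i p') | b' p'. precedes i b p \<mu> b' p'} \<subseteq> psets m nb M lt (Suc i)"
  proof
    fix S assume "S \<in> {stp i b' (vec m \<mu> a i p') | b' p'. precedes i b p \<mu> b' p'}"
    then obtain b' p' where S: "S = stp i b' (vec m \<mu> a i p')" "p' < \<mu> [cn, i]" "b' < nb i"
      using assms(4,5) unfolding precedes_def by auto
    then have "vec m \<mu> a i p' \<in> psets m nb M lt i" using assms(2) unfolding good_def by blast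
    then show "S \<in> psets m nb M lt (Suc i)" using S by (auto simp: stp_def)
  qed
  moreover have "inj_on (vec m \<mu> a (Suc i)) {..<k}"
    using assms(1) unfolding part_def by blast
  then have "card (vec m \<mu> a (Suc i) ` {..<k}) = k" by (simp add: card_image)
  ultimately have "k \<le> card (psets m nb M lt (Suc i))"
    using assms(1) card_mono[OF finite_psets] unfolding part_def by metis
  then show ?thesis using K[of "Suc i"] assms(3) by simp
qed

text \<open>The time is \<open>m\<close> for writing the candidate plus at most \<open>K\<close>
  comparisons, each charged \<open>Suc m\<close>.\<close>

lemma wp_ps_step:
  assumes st: "base m n E PC L r \<mu>" "r 15 = i" "r 16 = b" "r 17 = p" "r 19 = E (lev i)"
    and i: "i < N" "b < nb i" "p < \<mu> [cn, i]"
    and gp: "good i \<mu>" "part i b p (r 20) \<mu>"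
  shows "wp inp V (ps_step a f msk) (\<lambda>r' \<mu>' t. t \<le> m + K * Suc m \<and> good i \<mu>' \<and> part i b (Suc p) (r' 20) \<mu>') r \<mu>"
proof -
  have r2: "r 2 = m" using st(1) by (simp add: base_def)
  have k: "r 20 \<le> K" using part_bound[OF gp(2,1) i(1)] i(2) by simp
  have b2: "b < 2" using i nb by (auto split: if_splits)
  define k where "k = r 20"
  define X where "X = stp i b (vec m \<mu> a i p)"
  have nm: "a \<noteq> cn" "a \<noteq> f" "cn \<noteq> f" "a \<noteq> 2" "a \<noteq> 3" "a \<noteq> 4" "f \<noteq> 2" "f \<noteq> 3" "f \<noteq> 4"
    using names by auto
  show ?thesis
    unfolding ps_step_def wp.simps(4)
  proof (rule wp_build[where M = "M i"], goal_cases)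
    case 1
    then show ?case using r2 V by simp
  next
    case (4 r1 \<mu>1 c)
    have "base m n E PC L r1 \<mu>1" using nm 4 by (intro base_cong[OF st(1)]) auto
    then show ?case using 4 st i r2 by (intro msk) auto
  next
    case (5 r1 \<mu>1 t1)
    note row = 5(3)[unfolded r2 st(2,3,4,5), folded k_def] and old = 5(4)[unfolded st(2), folded k_def]
    have r1: "r1 x = r x" if "x \<noteq> 6" for x using frame_reg[OF 5(1), of x] that by simp
    have L: "\<mu> [2, E (lev i), b, c] = of_bool (lt i b c)" if "c < m" for c
      using st(1) that b2 E_lev[OF i(1)] lt[OF i(1)] by (simp add: base_def)
    have newrow: "vec m \<mu>1 a (Suc i) k = X" "bits m \<mu>1 a (Suc i) k"
      using row L by (auto simp: vec_def bits_def X_def stp_def)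
    have oldrow: "vec m \<mu>1 a i' q = vec m \<mu> a i' q" "bits m \<mu>1 a i' q = bits m \<mu> a i' q" if "i' \<noteq> Suc i \<or> q \<noteq> k" for i' q
      using that old by (auto simp: vec_def bits_def)
    have good1: "good i \<mu>1" using old nm by (intro good_cong[OF gp(1)]) auto
    have oc: "\<mu>1 [cn, i] = \<mu> [cn, i]" and of: "\<mu>1 [f, i', b', p'] = \<mu> [f, i', b', p']" for i' b' p'
      using old nm by auto
    show ?case
    proof (rule wp_search, goal_cases)
      case 1
      then show ?case using r1 r2 V by simp
    next
      case 2
      then show ?case using r1 k V by simp
    next
      case (3 q)
      then show ?case using newrow(2) oldrow(2)[of "Suc i" q] gp(2) r1 r2 st(2)
        unfolding part_def k_def by (cases "q = k") (auto simp: k_def)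
    next
      case (4 r2' \<mu>2 t2)
      note found = 4(3-5)
      have m2: "\<mu>2 (b # ks) = \<mu>1 (b # ks)" for b ks using frame_mem[OF 4(1), of b ks] by simp
      have r2: "r2' x = r x" if "x \<noteq> 6" "x \<noteq> 18" "x \<noteq> 21" "x \<noteq> 22" for x
        using frame_reg[OF 4(1), of x] r1 that by simp
      define ix where "ix = r2' 21"
      have ix: "ix \<le> k" "vec m \<mu>1 a (Suc i) ix = X" "ix = k \<Longrightarrow> \<forall>q<k. vec m \<mu>1 a (Suc i) q \<noteq> X"
        using found newrow(1) r1 st(2) \<open>r 2 = m\<close> unfolding ix_def k_def by auto
      have tm: "t1 + t2 \<le> m + K * Suc m"
      proof -
        have "r1 20 * Suc (r1 2) \<le> K * Suc m"
          unfolding r1[of 20, simplified] r1[of 2, simplified] \<open>r 2 = m\<close> by (rule mult_le_mono1[OF k])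
        then have "t2 \<le> K * Suc m" using 4(2) by linarith
        then show ?thesis using 5(2) \<open>r 2 = m\<close> by simp
      qed
      define \<mu>3 where "\<mu>3 = \<mu>2([f, i, b, p] := ix)"
      have v3: "vec m \<mu>3 a i' q = vec m \<mu>1 a i' q" "bits m \<mu>3 a i' q = bits m \<mu>1 a i' q" for i' q
        unfolding \<mu>3_def vec_def bits_def using nm m2 by auto
      have v3': "vec m \<mu>3 a i' = vec m \<mu>1 a i'" for i' using v3(1) by blast
      have c3: "\<mu>3 [cn, i'] = \<mu>1 [cn, i']" for i' unfolding \<mu>3_def using nm m2 by auto
      have good3: "good i \<mu>3" unfolding \<mu>3_def using nm m2 by (intro good_cong[OF good1]) auto
      have vi: "vec m \<mu>3 a i p' = vec m \<mu> a i p'" for p' using v3(1) oldrow(1)[of i p'] by simp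
      have prec: "precedes i b (Suc p) \<mu>3 b' p' \<longleftrightarrow> precedes i b p \<mu> b' p' \<or> b' = b \<and> p' = p" for b' p'
        using i(3) unfolding precedes_def c3 oc by auto
      have nprec: "\<not> precedes i b p \<mu> b p" by (simp add: precedes_def)
      have img: "{stp i b' (vec m \<mu>3 a i p') | b' p'. precedes i b (Suc p) \<mu>3 b' p'} =
          insert X {stp i b' (vec m \<mu> a i p') | b' p'. precedes i b p \<mu> b' p'}"
        unfolding vi prec X_def by blast
      have rows: "vec m \<mu>3 a (Suc i) q = vec m \<mu> a (Suc i) q" "bits m \<mu>3 a (Suc i) q = bits m \<mu> a (Suc i) q" if "q < k" for q
        using that v3 oldrow[of "Suc i" q] by auto
      have im: "vec m \<mu>3 a (Suc i) ` {..<k} = vec m \<mu> a (Suc i) ` {..<k}"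
        using rows(1) by (intro image_cong) auto
      have inj: "inj_on (vec m \<mu>3 a (Suc i)) {..<k}"
        using gp(2) rows(1) unfolding part_def k_def[symmetric] by (auto simp: inj_on_def)
      have f3: "\<mu>3 [f, i, b', p'] = (if b' = b \<and> p' = p then ix else \<mu> [f, i, b', p'])" for b' p'
        unfolding \<mu>3_def using m2 of by auto
      \<comment> \<open>Either the candidate is new and row \<open>k\<close> is kept, or the map
        points to an equal older row and row \<open>k\<close> is abandoned.\<close>
      have part3: "part i b (Suc p) (if ix = k then Suc k else k) \<mu>3"
      proof (cases "ix = k")
        case True
        have nX: "X \<notin> vec m \<mu>3 a (Suc i) ` {..<k}" using ix(3)[OF True] v3 by auto
        have Xk: "vec m \<mu>3 a (Suc i) k = X" using ix(2) v3 True by simp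
        show ?thesis
          unfolding part_def img
        proof (intro conjI allI impI)
          show "bits m \<mu>3 a (Suc i) q" if "q < (if ix = k then Suc k else k)" for q
            using that rows(2) gp(2) newrow(2) v3(2) True unfolding part_def k_def[symmetric]
            by (cases "q = k") auto
          show "inj_on (vec m \<mu>3 a (Suc i)) {..<if ix = k then Suc k else k}"
            using inj nX Xk True by (simp add: lessThan_Suc)
          show "vec m \<mu>3 a (Suc i) ` {..<if ix = k then Suc k else k} =
              insert X {stp i b' (vec m \<mu> a i p') | b' p'. precedes i b p \<mu> b' p'}"
            using im gp(2) Xk True unfolding part_def k_def[symmetric] by (simp add: lessThan_Suc)
          fix b' p' assume "precedes i b (Suc p) \<mu>3 b' p'"
          then have "precedes i b p \<mu> b' p' \<and> \<not> (b' = b \<and> p' = p) \<or> b' = b \<and> p' = p" using prec nprec by blast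
          then show "\<mu>3 [f, i, b', p'] < (if ix = k then Suc k else k)"
            "vec m \<mu>3 a (Suc i) (\<mu>3 [f, i, b', p']) = stp i b' (vec m \<mu>3 a i p')"
            using gp(2) Xk True rows(1) unfolding part_def k_def[symmetric] f3 vi X_def by (auto simp: less_SucI)
        qed
      next
        case False
        then have lt: "ix < k" using ix(1) by simp
        have Xk: "vec m \<mu>3 a (Suc i) ix = X" using ix(2) v3 by simp
        then have "X \<in> vec m \<mu> a (Suc i) ` {..<k}" using lt im by (metis imageI lessThan_iff)
        then have X: "insert X {stp i b' (vec m \<mu> a i p') | b' p'. precedes i b p \<mu> b' p'} = vec m \<mu> a (Suc i) ` {..<k}"
          using gp(2) unfolding part_def k_def[symmetric] by blast
        show ?thesis
          unfolding part_def img X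
        proof (intro conjI allI impI)
          show "bits m \<mu>3 a (Suc i) q" if "q < (if ix = k then Suc k else k)" for q
            using that rows(2) gp(2) False unfolding part_def k_def[symmetric] by auto
          show "inj_on (vec m \<mu>3 a (Suc i)) {..<if ix = k then Suc k else k}" using inj False by simp
          show "vec m \<mu>3 a (Suc i) ` {..<if ix = k then Suc k else k} = vec m \<mu> a (Suc i) ` {..<k}"
            using im False by simp
          fix b' p' assume "precedes i b (Suc p) \<mu>3 b' p'"
          then have "precedes i b p \<mu> b' p' \<and> \<not> (b' = b \<and> p' = p) \<or> b' = b \<and> p' = p" using prec nprec by blast
          then show "\<mu>3 [f, i, b', p'] < (if ix = k then Suc k else k)"
            "vec m \<mu>3 a (Suc i) (\<mu>3 [f, i, b', p']) = stp i b' (vec m \<mu>3 a i p')"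
            using gp(2) Xk False lt rows(1) unfolding part_def k_def[symmetric] f3 vi X_def by auto
        qed
      qed
      \<comment> \<open>After a new row the larger state is again a valid partial level, so even the
        incremented number obeys the bound and fits into a word.\<close>
      have kK: "Suc k \<le> K" if "ix = k"
        using part_bound[OF part3 good3 i(1)] i(2) that by simp
      have regs: "r2' 15 = i" "r2' 16 = b" "r2' 17 = p" "r2' 20 = k" "r2' 21 = ix"
        using r2 st by (simp_all add: k_def ix_def)
      show ?case
        using good3 part3 tm regs ix(1) kK V k_def \<open>r 20 \<le> K\<close> by (auto simp: \<mu>3_def[symmetric])
    qed
  qed (use V nm in auto)
qed

lemma cnt_le: "good i \<mu> \<Longrightarrow> i' \<le> i \<Longrightarrow> i \<le> N \<Longrightarrow> \<mu> [cn, i'] \<le> K"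
proof -
  assume a: "good i \<mu>" "i' \<le> i" "i \<le> N"
  then have g: "inj_on (vec m \<mu> a i') {..<\<mu> [cn, i']}" "vec m \<mu> a i' ` {..<\<mu> [cn, i']} = psets m nb M lt i'"
    unfolding good_def by blast+
  have "card (psets m nb M lt i') = \<mu> [cn, i']" unfolding g(2)[symmetric] using g(1) by (simp add: card_image)
  then show ?thesis using K[of i'] a by simp
qed

lemma part_start: "part i 0 0 0 \<mu>"
  by (auto simp: part_def precedes_def)

lemma part_next: "part i b (\<mu> [cn, i]) k \<mu> \<longleftrightarrow> part i (Suc b) 0 k \<mu>"
proof -
  have "precedes i b (\<mu> [cn, i]) \<mu> b' p' \<longleftrightarrow> precedes i (Suc b) 0 \<mu> b' p'" for b' p'
    by (auto simp: precedes_def)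
  then show ?thesis unfolding part_def by simp
qed

lemma part_finish:
  assumes "good i \<mu>" "part i (nb i) 0 k \<mu>"
  shows "good (Suc i) (\<mu>([cn, Suc i] := k))"
proof -
  let ?\<mu> = "\<mu>([cn, Suc i] := k)"
  have nm: "a \<noteq> cn" "f \<noteq> cn" using names by auto
  have g: "good i ?\<mu>" using nm by (intro good_cong[OF assms(1)]) auto
  have v: "vec m ?\<mu> a i' q = vec m \<mu> a i' q" "bits m ?\<mu> a i' q = bits m \<mu> a i' q" for i' q
    using nm by (auto simp: vec_def bits_def)
  have v': "vec m ?\<mu> a i' = vec m \<mu> a i'" for i' using v(1) by blast
  have prec: "precedes i (nb i) 0 \<mu> b' p' \<longleftrightarrow> p' < \<mu> [cn, i] \<and> b' < nb i" for b' p'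
    by (auto simp: precedes_def)
  have "vec m \<mu> a i ` {..<\<mu> [cn, i]} = psets m nb M lt i" using assms(1) unfolding good_def by blast
  then have "psets m nb M lt (Suc i) = {stp i b' S | b' S. b' < nb i \<and> S \<in> vec m \<mu> a i ` {..<\<mu> [cn, i]}}"
    unfolding stp_def by simp
  also have "\<dots> = {stp i b' (vec m \<mu> a i p') | b' p'. precedes i (nb i) 0 \<mu> b' p'}"
    unfolding prec by auto
  finally have "psets m nb M lt (Suc i) = \<dots>" .
  then have new: "vec m \<mu> a (Suc i) ` {..<k} = psets m nb M lt (Suc i)"
    using assms(2) unfolding part_def by simp
  show ?thesis
    unfolding good_def
  proof (intro conjI allI impI)
    fix i' assume i': "i' \<le> Suc i"
    show "bits m ?\<mu> a i' p" if "p < ?\<mu> [cn, i']" for p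
      using that i' assms(2) g unfolding v good_def part_def by (cases "i' = Suc i") (auto simp: v)
    show "inj_on (vec m ?\<mu> a i') {..<?\<mu> [cn, i']}"
      using i' assms(2) g unfolding good_def part_def by (cases "i' = Suc i") (auto simp: v')
    show "vec m ?\<mu> a i' ` {..<?\<mu> [cn, i']} = psets m nb M lt i'"
      using i' new g unfolding good_def by (cases "i' = Suc i") (auto simp: v')
  next
    fix i' b p assume i': "i' < Suc i" "b < nb i'" "p < ?\<mu> [cn, i']"
    have "?\<mu> [f, i', b, p] < ?\<mu> [cn, Suc i'] \<and> vec m ?\<mu> a (Suc i') (?\<mu> [f, i', b, p]) = stp i' b (vec m ?\<mu> a i' p)"
    proof (cases "i' = i")
      case True
      then show ?thesis using i' assms(2) prec nm unfolding part_def v by auto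
    next
      case False
      then show ?thesis using i' g unfolding good_def by auto
    qed
    then show "?\<mu> [f, i', b, p] < ?\<mu> [cn, Suc i']" "vec m ?\<mu> a (Suc i') (?\<mu> [f, i', b, p]) = stp i' b (vec m ?\<mu> a i' p)"
      by auto
  qed
qed

lemma wp_ps_level:
  assumes st: "base m n E PC L r \<mu>" "r 15 = i" and i: "i < N" and g: "good i \<mu>"
  shows "wp inp V (ps_level a cn f lab msk)
    (\<lambda>r' \<mu>' t. t \<le> 2 * Suc (K * Suc (m + K * Suc m)) \<and> good (Suc i) \<mu>') r \<mu>"
proof -
  have nm: "a \<noteq> cn" "f \<noteq> cn" "a \<notin> {2, 3, 4}" "f \<notin> {2, 3, 4}" using names by auto
  have h: "hval inp lab r \<mu> = E (lev i)" using lab[OF st i] .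
  have e: "E (lev i) \<le> V" using E_lev[OF i] V by simp
  have ck: "\<mu> [cn, i] \<le> K" using cnt_le[OF g, of i] i by simp
  show ?thesis
    unfolding ps_level_def wp.simps(2,4)
  proof (intro conjI, goal_cases)
    case 3
    let ?r = "r(19 := hval inp lab r \<mu>, 20 := hval inp (HNum 0) (r(19 := hval inp lab r \<mu>)) \<mu>)"
    have hb: "hval inp branches ?r \<mu> = nb i"
      using st(1) nb[OF i] unfolding h by (simp add: branches_def base_def)
    show ?case
    proof (rule wp_For[where T = "K * Suc (m + K * Suc m)" and
          I = "\<lambda>b r' \<mu>'. good i \<mu>' \<and> part i b 0 (r' 20) \<mu>'"], goal_cases)
      case 1
      then show ?case unfolding hb using nb[OF i] V by simp
    next
      case (2 r')
      then show ?case using g part_start by simp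
    next
      case (3 b r1 \<mu>1)
      have b: "b < nb i" using 3(1) unfolding hb .
      have r1: "r1 x = ?r x" if "x \<notin> {6, 16, 17, 18, 20, 21, 22}" for x using frame_reg[OF 3(4), of x] that by simp
      have m1: "\<mu>1 (c # ks) = \<mu> (c # ks)" if "c \<notin> {a, f}" for c ks using frame_mem[OF 3(4), of c ks] that by simp
      have c1: "\<mu>1 [cn, i] = \<mu> [cn, i]" using m1 nm by simp
      have h1: "hval inp (HGet [HNum cn, $15]) r1 \<mu>1 = \<mu> [cn, i]" using r1[of 15] st(2) c1 by simp
      show ?case
      proof (rule wp_For[where T = "m + K * Suc m" and
            I = "\<lambda>p r' \<mu>'. good i \<mu>' \<and> part i b p (r' 20) \<mu>'"], goal_cases)
        case 1
        then show ?case unfolding h1 using ck V by simp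
      next
        case (2 r')
        then show ?case using 3(2) by simp
      next
        case (3 p r2 \<mu>2)
        have r2: "r2 x = ?r x" if "x \<notin> {6, 16, 17, 18, 20, 21, 22}" for x
          using frame_reg[OF 3(4), of x] r1 that by simp
        have r16: "r2 16 = b" using frame_reg[OF 3(4), of 16] \<open>r1 16 = b\<close> by simp
        have m2: "\<mu>2 (c # ks) = \<mu> (c # ks)" if "c \<notin> {a, f}" for c ks
          using frame_mem[OF 3(4), of c ks] m1 that by simp
        have p: "p < \<mu>2 [cn, i]" using 3(1) m2[of cn] nm unfolding h1 by simp
        have bs: "base m n E PC L r2 \<mu>2" by (rule base_cong[OF st(1)]) (use r2 m2 nm in auto)
        have "wp inp V (ps_step a f msk) (\<lambda>r' \<mu>' t. t \<le> m + K * Suc m \<and> good i \<mu>' \<and> part i b (Suc p) (r' 20) \<mu>') r2 \<mu>2"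
          using r2[of 15] r2[of 19] st(2) h r16 3(2,3) by (intro wp_ps_step[OF bs _ _ _ _ i b p]) auto
        then show ?case by (rule wp_mono) simp
      next
        case (4 r2 \<mu>2 t)
        have c2: "\<mu>2 [cn, i] = \<mu> [cn, i]"
          using frame_mem[OF 4(3), of cn] c1 nm by simp
        have "t \<le> K * Suc (m + K * Suc m)"
          using 4(4) mult_le_mono1[OF ck, of "Suc (m + K * Suc m)"] unfolding h1 by linarith
        moreover have "part i (Suc b) 0 (r2 20) \<mu>2"
          using 4(1) unfolding h1 c2[symmetric] part_next by blast
        ultimately show ?case using 4(1) by simp
      qed
    next
      case (4 r1 \<mu>1 t)
      have r1: "r1 x = ?r x" if "x \<notin> {6, 16, 17, 18, 20, 21, 22}" for x using frame_reg[OF 4(3), of x] that by simp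
      have p: "good i \<mu>1" "part i (nb i) 0 (r1 20) \<mu>1" using 4(1) unfolding hb by auto
      have k: "r1 20 \<le> K" using part_bound[OF p(2,1) i] by simp
      have t: "t \<le> 2 * Suc (K * Suc (m + K * Suc m))"
      proof -
        have "nb i \<le> 2" using nb[OF i] by simp
        then show ?thesis using 4(4) mult_le_mono1[of "nb i" 2 "Suc (K * Suc (m + K * Suc m))"] unfolding hb by linarith
      qed
      show ?case
        using part_finish[OF p] t k V r1[of 15] st(2) by simp
    qed
  qed (use e h in simp_all)
qed

lemma wp_ps_gen:
  assumes st: "base m n E PC L r \<mu>" and z: "\<And>c. c < m \<Longrightarrow> \<mu> [a, 0, 0, c] = 0"
  shows "wp inp V (ps_gen a cn f lab msk)
    (\<lambda>r' \<mu>' t. t \<le> N * Suc (2 * Suc (K * Suc (m + K * Suc m))) \<and> good N \<mu>') r \<mu>"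
proof -
  have nm: "a \<noteq> cn" "f \<noteq> cn" "a \<notin> {2, 3, 4}" "f \<notin> {2, 3, 4}" "cn \<notin> {2, 3, 4}" using names by auto
  let ?\<mu> = "\<mu>([cn, 0] := 1)"
  \<comment> \<open>The array is still zero, so row 0 of level 0 already is the empty set and only
    the number of rows has to be stored.\<close>
  have vz: "vec m ?\<mu> a 0 0 = {}" "bits m ?\<mu> a 0 0" using z nm by (auto simp: vec_def bits_def)
  have g0: "good 0 ?\<mu>" unfolding good_def using vz by (auto simp: lessThan_Suc)
  have r4: "r 4 = N" using st by (simp add: base_def)
  have "wp inp V (PFor 15 ($4) (ps_level a cn f lab msk))
    (\<lambda>r' \<mu>' t. t \<le> N * Suc (2 * Suc (K * Suc (m + K * Suc m))) \<and> good N \<mu>') r ?\<mu>"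
  proof (rule wp_For[where T = "2 * Suc (K * Suc (m + K * Suc m))" and I = "\<lambda>i r' \<mu>'. good i \<mu>'"], goal_cases)
    case (3 i r1 \<mu>1)
    have bs: "base m n E PC L r1 \<mu>1"
      by (rule base_cong[OF st]) (use frame_reg[OF 3(4)] frame_mem[OF 3(4)] nm in auto)
    have "wp inp V (ps_level a cn f lab msk) (\<lambda>r' \<mu>' t. t \<le> 2 * Suc (K * Suc (m + K * Suc m)) \<and> good (Suc i) \<mu>') r1 \<mu>1"
      using 3 r4 by (intro wp_ps_level[OF bs]) auto
    then show ?case by (rule wp_mono) simp
  next
    case (4 r1 \<mu>1 t)
    then show ?case using r4 by simp
  qed (use V r4 g0 in auto)
  then show ?thesis using V by (simp add: ps_gen_def fun_upd_def)
qed

lemma good_table: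
  "good N \<mu> \<Longrightarrow> ps_table m N nb M lt (\<lambda>i. \<mu> [cn, i]) (vec m \<mu> a) (\<lambda>i b p. \<mu> [f, i, b, p])"
  unfolding good_def ps_table_def stp_def by simp

end

section \<open>Numbers bit by bit\<close>

definition num :: "(nat list \<Rightarrow> nat) \<Rightarrow> nat list \<Rightarrow> nat \<Rightarrow> nat" where
  "num \<mu> ks l = (\<Sum>j<l. \<mu> (ks @ [j]) * 2 ^ j)"

definition isbits :: "(nat list \<Rightarrow> nat) \<Rightarrow> nat list \<Rightarrow> nat \<Rightarrow> bool" where
  "isbits \<mu> ks l \<longleftrightarrow> (\<forall>j<l. \<mu> (ks @ [j]) \<le> 1)"

lemma num_Suc: "num \<mu> ks (Suc l) = num \<mu> ks l + \<mu> (ks @ [l]) * 2 ^ l"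
  by (simp add: num_def)

lemma num_0 [simp]: "num \<mu> ks 0 = 0"
  by (simp add: num_def)

lemma num_cong: "(\<And>j. j < l \<Longrightarrow> \<mu> (ks @ [j]) = \<mu>' (ks' @ [j])) \<Longrightarrow> num \<mu> ks l = num \<mu>' ks' l"
  by (simp add: num_def)

lemma isbits_cong: "(\<And>j. j < l \<Longrightarrow> \<mu> (ks @ [j]) = \<mu>' (ks' @ [j])) \<Longrightarrow> isbits \<mu> ks l = isbits \<mu>' ks' l"
  by (simp add: isbits_def)

lemma num_less: "isbits \<mu> ks l \<Longrightarrow> num \<mu> ks l < 2 ^ l"
proof (induction l)
  case (Suc l)
  then have "\<mu> (ks @ [l]) \<le> 1" "num \<mu> ks l < 2 ^ l" by (auto simp: isbits_def)
  then have "\<mu> (ks @ [l]) * 2 ^ l \<le> 1 * 2 ^ l" by (intro mult_le_mono1)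
  then show ?case using \<open>num \<mu> ks l < 2 ^ l\<close> unfolding num_Suc power_Suc by linarith
qed simp

text \<open>School addition in place: register 24 holds the sum of two bits and the carry, register
  23 the next carry.\<close>

definition add_to :: "hexp list \<Rightarrow> hexp list \<Rightarrow> prog" where
  "add_to dst src = 23 ::= HNum 0 ;; PFor 8 ($25)
     (24 ::= HGet (dst @ [$8]) \<oplus> HGet (src @ [$8]) \<oplus> $23 ;;
      23 ::= $24 \<oslash> HNum 2 ;;
      (dst @ [$8]) \<lhd> $24 \<ominus> HNum 2 \<otimes> $23)"

definition copy :: "hexp list \<Rightarrow> hexp list \<Rightarrow> prog" where
  "copy dst src = PFor 8 ($25) ((dst @ [$8]) \<lhd> HGet (src @ [$8]))"

text \<open>The highest position at which the numbers differ decides the comparison.\<close>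

definition greater :: "hexp list \<Rightarrow> hexp list \<Rightarrow> prog" where
  "greater x y = 26 ::= HNum 0 ;; PFor 8 ($25)
     (PIf (HGet (x @ [$8]) \<ominus> HGet (y @ [$8])) (26 ::= HNum 1)
       (PIf (HGet (y @ [$8]) \<ominus> HGet (x @ [$8])) (26 ::= HNum 0) PSkip))"

lemma mod_bignum [simp]:
  "modr (add_to (HNum a # dst) src) = {8, 23, 24}" "modm (add_to (HNum a # dst) src) = {a}" "wf_prog (add_to (HNum a # dst) src)"
  "modr (copy (HNum a # dst) src) = {8}" "modm (copy (HNum a # dst) src) = {a}" "wf_prog (copy (HNum a # dst) src)"
  "modr (greater x y) = {8, 26}" "modm (greater x y) = {}" "wf_prog (greater x y)"
  by (auto simp: add_to_def copy_def greater_def)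

text \<open>The assumptions on \<open>dst\<close> and \<open>src\<close> say that both keys evaluate
  independently of the loop counter and the memory, so they name fixed numbers during the
  loop.\<close>

lemma wp_copy:
  assumes "r 25 = l" "l \<le> V" "1 \<le> V"
    and dk: "\<And>r' \<mu>'. (\<And>x. x \<noteq> 8 \<Longrightarrow> r' x = r x) \<Longrightarrow> map (\<lambda>e. hval inp e r' \<mu>') dst = dk"
    and sk: "\<And>r' \<mu>'. (\<And>x. x \<noteq> 8 \<Longrightarrow> r' x = r x) \<Longrightarrow> map (\<lambda>e. hval inp e r' \<mu>') src = sk"
    and ne: "dk \<noteq> sk" and bs: "isbits \<mu> sk l"
  shows "wp inp V (copy dst src) (\<lambda>r' \<mu>' t. t \<le> l \<and> isbits \<mu>' dk l \<and> num \<mu>' dk l = num \<mu> sk l \<and>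
     (\<forall>k. (\<forall>j. k \<noteq> dk @ [j]) \<longrightarrow> \<mu>' k = \<mu> k)) r \<mu>"
  unfolding copy_def
proof (rule wp_For[where T = 0 and I = "\<lambda>j r' \<mu>'. (\<forall>d<j. \<mu>' (dk @ [d]) = \<mu> (sk @ [d])) \<and>
    (\<forall>k. (\<forall>j. k \<noteq> dk @ [j]) \<longrightarrow> \<mu>' k = \<mu> k)"], goal_cases)
  case (3 j r' \<mu>')
  have r': "r' x = r x" if "x \<noteq> 8" for x using frame_reg[OF 3(4), of x] that by simp
  have k: "map (\<lambda>e. hval inp e r' \<mu>') dst = dk" "map (\<lambda>e. hval inp e r' \<mu>') src = sk"
    using r' by (auto intro!: dk sk)
  have "\<mu>' (sk @ [j]) = \<mu> (sk @ [j])" using 3(2) ne by simp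
  moreover have "\<mu> (sk @ [j]) \<le> 1" using bs 3(1) assms(1) by (simp add: isbits_def)
  ultimately show ?case using 3(2,3) assms(3) by (auto simp: k less_Suc_eq)
next
  case (4 r' \<mu>' t)
  then have e: "\<And>j. j < l \<Longrightarrow> \<mu>' (dk @ [j]) = \<mu> (sk @ [j])" using assms(1) by simp
  show ?case using 4 assms(1) bs num_cong[of l \<mu>' dk \<mu> sk, OF e] isbits_cong[of l \<mu>' dk \<mu> sk, OF e] by simp
qed (use assms in auto)

lemma wp_greater:
  assumes "r 25 = l" "l \<le> V" "1 \<le> V"
    and dk: "\<And>r' \<mu>'. (\<And>x. x \<notin> {8, 26} \<Longrightarrow> r' x = r x) \<Longrightarrow> map (\<lambda>e. hval inp e r' \<mu>') x = xk"
    and sk: "\<And>r' \<mu>'. (\<And>x. x \<notin> {8, 26} \<Longrightarrow> r' x = r x) \<Longrightarrow> map (\<lambda>e. hval inp e r' \<mu>') y = yk"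
    and ne: "xk \<noteq> []" "yk \<noteq> []" and bs: "isbits \<mu> xk l" "isbits \<mu> yk l"
  shows "wp inp V (greater x y) (\<lambda>r' \<mu>' t. t \<le> l \<and> (r' 26 \<noteq> 0 \<longleftrightarrow> num \<mu> yk l < num \<mu> xk l)) r \<mu>"
  unfolding greater_def wp.simps(2,4)
proof (intro conjI, goal_cases)
  case 2
  show ?case
  proof (rule wp_For[where T = 0 and I = "\<lambda>j r' \<mu>'. r' 26 \<noteq> 0 \<longleftrightarrow> num \<mu> yk j < num \<mu> xk j"], goal_cases)
    case (3 j r' \<mu>')
    have r': "r' x = r x" if "x \<notin> {8, 26}" for x using frame_reg[OF 3(4), of x] that by simp
    have m': "\<mu>' (b # ks) = \<mu> (b # ks)" for b ks using frame_mem[OF 3(4), of b ks] by simp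
    have k: "map (\<lambda>e. hval inp e r' \<mu>') x = xk" "map (\<lambda>e. hval inp e r' \<mu>') y = yk"
      using r' by (auto intro!: dk sk)
    have m: "\<mu>' (xk @ [j]) = \<mu> (xk @ [j])" "\<mu>' (yk @ [j]) = \<mu> (yk @ [j])"
      using ne m' by (metis append_Cons neq_Nil_conv)+
    have j: "j < l" using 3(1) assms(1) by simp
    have b: "\<mu> (xk @ [j]) \<le> 1" "\<mu> (yk @ [j]) \<le> 1" using bs j by (auto simp: isbits_def)
    have n: "num \<mu> xk j < 2 ^ j" "num \<mu> yk j < 2 ^ j" using bs j by (auto intro!: num_less simp: isbits_def)
    have "\<mu> (xk @ [j]) = 0 \<or> \<mu> (xk @ [j]) = 1" "\<mu> (yk @ [j]) = 0 \<or> \<mu> (yk @ [j]) = 1" using b by linarith+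
    then show ?case using 3(2,3) assms(3) n by (elim disjE) (auto simp: k m num_Suc)
  qed (use assms in auto)
qed (use assms in simp)

lemma wp_add_to:
  assumes "r 25 = l" "l \<le> V" "3 \<le> V"
    and dk: "\<And>r' \<mu>'. (\<And>x. x \<notin> {8, 23, 24} \<Longrightarrow> r' x = r x) \<Longrightarrow> map (\<lambda>e. hval inp e r' \<mu>') dst = dk"
    and sk: "\<And>r' \<mu>'. (\<And>x. x \<notin> {8, 23, 24} \<Longrightarrow> r' x = r x) \<Longrightarrow> map (\<lambda>e. hval inp e r' \<mu>') src = sk"
    and ne: "dk \<noteq> sk" and bs: "isbits \<mu> dk l" "isbits \<mu> sk l" and lt: "num \<mu> dk l + num \<mu> sk l < 2 ^ l"
  shows "wp inp V (add_to dst src) (\<lambda>r' \<mu>' t. t \<le> l \<and> isbits \<mu>' dk l \<and> num \<mu>' dk l = num \<mu> dk l + num \<mu> sk l \<and>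
     (\<forall>k. (\<forall>j. k \<noteq> dk @ [j]) \<longrightarrow> \<mu>' k = \<mu> k)) r \<mu>"
  unfolding add_to_def wp.simps(2,4)
proof (intro conjI, goal_cases)
  case 2
  show ?case
  \<comment> \<open>The lower \<open>j\<close> bits already written, together with the carry at
    weight \<open>2 ^ j\<close>, make up the sum of the lower parts; the higher bits of the
    destination are still the old ones.\<close>
  proof (rule wp_For[where T = 0 and I = "\<lambda>j r' \<mu>'. r' 23 \<le> 1 \<and> isbits \<mu>' dk j \<and>
     num \<mu>' dk j + r' 23 * 2 ^ j = num \<mu> dk j + num \<mu> sk j \<and> (\<forall>d\<ge>j. \<mu>' (dk @ [d]) = \<mu> (dk @ [d])) \<and>
     (\<forall>k. (\<forall>j. k \<noteq> dk @ [j]) \<longrightarrow> \<mu>' k = \<mu> k)"], goal_cases)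
    case (2 r')
    then show ?case by (simp add: isbits_def)
  next
    case (3 j r' \<mu>')
    have r': "r' x = r x" if "x \<notin> {8, 23, 24}" for x using frame_reg[OF 3(4), of x] that by simp
    have k: "map (\<lambda>e. hval inp e r' \<mu>') dst = dk" "map (\<lambda>e. hval inp e r' \<mu>') src = sk"
      if "\<And>x. x \<notin> {8, 23, 24} \<Longrightarrow> r' x = r x" for r' \<mu>'
      using that by (auto intro!: dk sk)
    have j: "j < l" using 3(1) assms(1) by simp
    have m: "\<mu>' (dk @ [j]) = \<mu> (dk @ [j])" "\<mu>' (sk @ [j]) = \<mu> (sk @ [j])" using 3(2) ne by auto
    let ?s = "\<mu> (dk @ [j]) + \<mu> (sk @ [j]) + r' 23"
    have b: "\<mu> (dk @ [j]) \<le> 1" "\<mu> (sk @ [j]) \<le> 1" "r' 23 \<le> 1" using bs j 3(2) by (auto simp: isbits_def)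
    then have s: "?s \<le> 3" "?s div 2 \<le> 1" "?s - 2 * (?s div 2) = ?s mod 2" "?s mod 2 \<le> 1"
      by (auto simp: minus_mult_div_eq_mod)
    define \<mu>1 where "\<mu>1 = \<mu>'(dk @ [j] := ?s mod 2)"
    have v: "?s mod 2 * 2 ^ j + (?s div 2) * 2 ^ Suc j = ?s * 2 ^ j"
    proof -
      have "x * 2 ^ j + y * 2 ^ Suc j = (x + 2 * y) * 2 ^ j" for x y :: nat
        by (simp add: algebra_simps)
      then show ?thesis by simp
    qed
    have n1: "num \<mu>1 dk j = num \<mu>' dk j" by (rule num_cong) (simp add: \<mu>1_def)
    have "num \<mu>1 dk (Suc j) + (?s div 2) * 2 ^ Suc j = num \<mu>' dk j + (?s mod 2 * 2 ^ j + (?s div 2) * 2 ^ Suc j)"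
      by (simp add: num_Suc n1) (simp add: \<mu>1_def)
    also have "\<dots> = num \<mu>' dk j + r' 23 * 2 ^ j + (\<mu> (dk @ [j]) + \<mu> (sk @ [j])) * 2 ^ j"
      unfolding v by (simp add: algebra_simps)
    also have "\<dots> = num \<mu> dk (Suc j) + num \<mu> sk (Suc j)"
      using 3(2) by (simp add: num_Suc algebra_simps)
    finally have sum: "num \<mu>1 dk (Suc j) + (?s div 2) * 2 ^ Suc j = num \<mu> dk (Suc j) + num \<mu> sk (Suc j)" .
    have ib: "isbits \<mu>1 dk (Suc j)" using 3(2) s(4) by (auto simp: isbits_def \<mu>1_def less_Suc_eq)
    have rest: "\<forall>d\<ge>Suc j. \<mu>1 (dk @ [d]) = \<mu> (dk @ [d])" "\<forall>k. (\<forall>j. k \<noteq> dk @ [j]) \<longrightarrow> \<mu>1 k = \<mu> k"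
      using 3(2) by (auto simp: \<mu>1_def)
    have kk: "map (\<lambda>e. hval inp e (r'(24 := ?s, 23 := ?s div 2)) \<mu>') dst = dk" by (rule k) (use r' in auto)
    have kk0: "map (\<lambda>e. hval inp e r' \<mu>') dst = dk" "map (\<lambda>e. hval inp e r' \<mu>') src = sk"
      using k[of r' \<mu>'] r' by auto
    show ?case
      using s assms(3) 3(3) sum ib rest by (simp add: kk0 kk m \<mu>1_def[symmetric]) (use 3(2) in auto)
  next
    case (4 r' \<mu>' t)
    have "num \<mu>' dk l + r' 23 * 2 ^ l = num \<mu> dk l + num \<mu> sk l" using 4(1) assms(1) by simp
    \<comment> \<open>A carry out of the top bit would make the sum at least \<open>2 ^ l\<close>,
      against \<open>lt\<close>.\<close>
    then have "r' 23 * 2 ^ l < 2 ^ l" using lt by linarith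
    then have "r' 23 = 0" by simp
    then show ?case using 4 assms(1) by simp
  qed (use assms in auto)
qed (use assms in simp)

section \<open>Dynamic programming\<close>

text \<open>Level 0 receives the number 1, by setting its lowest bit, for every promise: this is the
  one empty path when counting and weight zero plus one when maximizing. Register 27 is the promise
  at the source entry, register 28 the forward index of the target entry.\<close>

definition sweep :: "prog \<Rightarrow> prog" where
  "sweep p = PFor 18 (HGet [HNum 9, $4]) ([HNum 11, HNum 0, HNum 0, $18, HNum 0] \<lhd> HNum 1) ;;
     PFor 15 ($4) (19 ::= HGet [HNum 3, $15] ;;
       PFor 16 branches (PFor 17 (HGet [HNum 6, $15]) (PFor 18 (HGet [HNum 9, $4 \<ominus> HNum 1 \<ominus> $15])
         (27 ::= HGet [HNum 10, $4 \<ominus> HNum 1 \<ominus> $15, $16, $18] ;;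
          28 ::= HGet [HNum 7, $15, $16, $17] ;; p))))"

definition cond_exp :: hexp where
  "cond_exp = (HNum 1 \<ominus> ($2 \<ominus> $19)) \<oplus> (HGet [HNum 5, $15, $17, $19] \<oplus> HGet [HNum 8, $4 \<ominus> HNum 1 \<ominus> $15, $18, $19])"

definition count_step :: prog where
  "count_step = PIf cond_exp
     (add_to [HNum 11, $15 \<oplus> HNum 1, $28, $18] [HNum 11, $15, $17, $27]) PSkip"

lemma mod_count_step [simp]: "modr count_step = {8, 23, 24}" "modm count_step = {11}" "wf_prog count_step"
  by (auto simp: count_step_def)

text \<open>\<open>\<mu>\<^sub>0\<close> is a snapshot of the memory with finished tables. The sweep
  leaves those arrays alone, so the tables can be fixed as parameters while the running memory
  changes.\<close>

locale dp_context = elimination_tables m N E PC L w "\<lambda>i. \<mu>\<^sub>0 [6, i]" "\<lambda>i. \<mu>\<^sub>0 [9, i]" "vec m \<mu>\<^sub>0 5" "vec m \<mu>\<^sub>0 8"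
    "\<lambda>i b p. \<mu>\<^sub>0 [7, i, b, p]" "\<lambda>i b p. \<mu>\<^sub>0 [10, i, b, p]"
  for m N :: nat and E PC :: "nat \<Rightarrow> nat" and L :: "nat \<Rightarrow> nat \<Rightarrow> nat \<Rightarrow> bool" and w :: "nat \<Rightarrow> nat"
    and \<mu>\<^sub>0 :: "nat list \<Rightarrow> nat" +
  fixes inp :: "nat \<Rightarrow> nat" and V n K l :: nat
  assumes N: "N = m + n"
    and K: "\<And>i. i \<le> N \<Longrightarrow> \<mu>\<^sub>0 [6, i] \<le> K" "\<And>i. i \<le> N \<Longrightarrow> \<mu>\<^sub>0 [9, i] \<le> K"
    and V: "N \<le> V" "K \<le> V" "l \<le> V" "3 \<le> V"
    and E0: "\<And>i. i < N \<Longrightarrow> \<mu>\<^sub>0 [3, i] = E i"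
    and l0: "0 < l"
begin

abbreviation "cA i \<equiv> \<mu>\<^sub>0 [6, i]"
abbreviation "cB i \<equiv> \<mu>\<^sub>0 [9, i]"
abbreviation "fA i b p \<equiv> \<mu>\<^sub>0 [7, i, b, p]"
abbreviation "fB i b p \<equiv> \<mu>\<^sub>0 [10, i, b, p]"

definition "static r \<mu> \<longleftrightarrow> r 2 = m \<and> r 3 = n \<and> r 4 = N \<and> r 25 = l \<and>
  (\<forall>a\<in>{2, 3, 4, 5, 6, 7, 8, 9, 10, 14}. \<forall>ks. \<mu> (a # ks) = \<mu>\<^sub>0 (a # ks))"

lemma staticD:
  assumes "static r \<mu>"
  shows "r 2 = m" "r 3 = n" "r 4 = N" "r 25 = l" "a \<in> {2, 3, 4, 5, 6, 7, 8, 9, 10, 14} \<Longrightarrow> \<mu> (a # ks) = \<mu>\<^sub>0 (a # ks)"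
  using assms unfolding static_def by auto

lemma static_cong:
  assumes "static r \<mu>" "\<And>x. x \<in> {2, 3, 4, 25} \<Longrightarrow> r' x = r x"
    "\<And>b ks. b \<in> {2, 3, 4, 5, 6, 7, 8, 9, 10, 14} \<Longrightarrow> \<mu>' (b # ks) = \<mu> (b # ks)"
  shows "static r' \<mu>'"
  using assms unfolding static_def by simp

lemma cond_val:
  assumes "static r \<mu>" "r 15 = i" "r 17 = p" "r 18 = q" "r 19 = E i" "i < N"
  shows "hval inp cond_exp r \<mu> \<noteq> 0 \<longleftrightarrow> cond i p q"
  using assms(2-) staticD[OF assms(1)] by (auto simp: cond_exp_def cond_def vec_def)

text \<open>The state after the pairs \<open>(b, p)\<close> and \<open>q\<close> that precede the given ones lexicographically is
  described by an invariant \<open>J i b p q\<close>.\<close>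

lemma wp_sweep:
  fixes J :: "nat \<Rightarrow> nat \<Rightarrow> nat \<Rightarrow> nat \<Rightarrow> (nat list \<Rightarrow> nat) \<Rightarrow> bool" and Z :: "nat \<Rightarrow> (nat list \<Rightarrow> nat) \<Rightarrow> bool"
  assumes st: "static r \<mu>"
    and mods: "modr p \<subseteq> {8, 23, 24, 26}" "modm p \<subseteq> {11, 12, 13, 15}"
    and init: "\<And>\<mu>'. (\<And>q. q < cB N \<Longrightarrow> \<mu>' [11, 0, 0, q, 0] = 1) \<Longrightarrow>
        (\<And>k. (\<And>q. k \<noteq> [11, 0, 0, q, 0]) \<Longrightarrow> \<mu>' k = \<mu> k) \<Longrightarrow> Z 0 \<mu>'"
    and start: "\<And>i \<mu>. i < N \<Longrightarrow> Z i \<mu> \<Longrightarrow> J i 0 0 0 \<mu>"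
    and step: "\<And>i b p' q r \<mu>. static r \<mu> \<Longrightarrow> i < N \<Longrightarrow> b < nb i \<Longrightarrow> p' < cA i \<Longrightarrow> q < cB (N - 1 - i) \<Longrightarrow>
        r 15 = i \<Longrightarrow> r 16 = b \<Longrightarrow> r 17 = p' \<Longrightarrow> r 18 = q \<Longrightarrow> r 19 = E i \<Longrightarrow>
        r 27 = fB (N - 1 - i) b q \<Longrightarrow> r 28 = fA i b p' \<Longrightarrow> J i b p' q \<mu> \<Longrightarrow>
        wp inp V p (\<lambda>r' \<mu>' t. t \<le> T \<and> J i b p' (Suc q) \<mu>') r \<mu>"
    and next_p: "\<And>i b p \<mu>. i < N \<Longrightarrow> b < nb i \<Longrightarrow> p < cA i \<Longrightarrow> J i b p (cB (N - 1 - i)) \<mu> \<Longrightarrow> J i b (Suc p) 0 \<mu>"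
    and next_b: "\<And>i b \<mu>. i < N \<Longrightarrow> b < nb i \<Longrightarrow> J i b (cA i) 0 \<mu> \<Longrightarrow> J i (Suc b) 0 0 \<mu>"
    and fin: "\<And>i \<mu>. i < N \<Longrightarrow> J i (nb i) 0 0 \<mu> \<Longrightarrow> Z (Suc i) \<mu>"
  shows "wp inp V (sweep p) (\<lambda>r' \<mu>' t. t \<le> K + N * Suc (2 * Suc (K * Suc (K * Suc T))) \<and> Z N \<mu>') r \<mu>"
proof -
  have mr: "x \<notin> modr p" if "x \<notin> {8, 23, 24, 26}" for x using that mods(1) by blast
  have mm: "x \<notin> modm p" if "x \<notin> {11, 12, 13, 15}" for x using that mods(2) by blast
  show ?thesis
    unfolding sweep_def wp.simps(4)
  proof (rule wp_For[where T = 0 and I = "\<lambda>j r' \<mu>'. (\<forall>q<j. \<mu>' [11, 0, 0, q, 0] = 1) \<and>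
      (\<forall>k. (\<forall>q. k \<noteq> [11, 0, 0, q, 0]) \<longrightarrow> \<mu>' k = \<mu> k)"], goal_cases)
    case 1
    then show ?case using staticD[OF st] K(2)[of N] V by simp
  next
    case (2 r')
    then show ?case by simp
  next
    case (3 j r' \<mu>')
    then show ?case using V by (auto simp: less_Suc_eq)
  next
    case (4 r1 \<mu>1 t1)
    have h0: "hval inp (HGet [HNum 9, $4]) r \<mu> = cB N" using staticD[OF st] by simp
    have t1: "t1 \<le> K" using 4(4) K(2)[of N] unfolding h0 by simp
    have st1: "static r1 \<mu>1" by (rule static_cong[OF st]) (use frame_reg[OF 4(3)] frame_mem[OF 4(3)] in auto)
    have Z0: "Z 0 \<mu>1" using 4(1) unfolding h0 by (intro init) auto
    show ?case
    proof (rule wp_For[where T = "2 * Suc (K * Suc (K * Suc T))" and I = "\<lambda>i r' \<mu>'. Z i \<mu>'"], goal_cases)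
      case 1
      then show ?case using staticD[OF st1] V by simp
    next
      case (2 r')
      then show ?case using Z0 by simp
    next
      case (3 i r2 \<mu>2)
      have i: "i < N" using 3(1) staticD[OF st1] by simp
      have st2: "static r2 \<mu>2"
        by (rule static_cong[OF st1]) (use frame_reg[OF 3(4)] frame_mem[OF 3(4)] in \<open>auto simp: mr mm\<close>)
      have e: "hval inp (HGet [HNum 3, $15]) r2 \<mu>2 = E i" using staticD(5)[OF st2] 3(3) E0[OF i] by simp
      let ?r2 = "r2(19 := hval inp (HGet [HNum 3, $15]) r2 \<mu>2)"
      have hb: "hval inp branches ?r2 \<mu>2 = nb i"
        using staticD[OF st2] unfolding e by (simp add: branches_def nb_def)
      have nb2: "nb i \<le> 2" by (simp add: nb_def)
      show ?case
        unfolding wp.simps(2,4)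
      proof (intro conjI, goal_cases)
        case 1
        then show ?case unfolding e using E_less[OF i] V by simp
      next
        case 2
        show ?case
        proof (rule wp_For[where T = "K * Suc (K * Suc T)" and I = "\<lambda>b r' \<mu>'. J i b 0 0 \<mu>'"], goal_cases)
          case 1
          then show ?case unfolding hb using nb2 V by simp
        next
          case (2 r')
          show ?case by (rule start[OF i 3(2)])
        next
          case (3 b r3 \<mu>3)
          have b: "b < nb i" using 3(1) unfolding hb .
          have r3: "r3 x = ?r2 x" if "x \<notin> {8, 16, 17, 18, 23, 24, 26, 27, 28}" for x
            using frame_reg[OF 3(4), of x] that by (auto simp: mr)
          have st3: "static r3 \<mu>3"
            by (rule static_cong[OF st2]) (use r3 frame_mem[OF 3(4)] in \<open>auto simp: mr mm\<close>)
          have h3: "hval inp (HGet [HNum 6, $15]) r3 \<mu>3 = cA i"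
            using staticD(5)[OF st3] r3[of 15] \<open>r2 15 = i\<close> by simp
          show ?case
          proof (rule wp_For[where T = "K * Suc T" and I = "\<lambda>p r' \<mu>'. J i b p 0 \<mu>'"], goal_cases)
            case 1
            then show ?case unfolding h3 using K(1)[of i] i V by simp
          next
            case (2 r')
            then show ?case using 3(2) by simp
          next
            case (3 p' r4 \<mu>4)
            have p: "p' < cA i" using 3(1) unfolding h3 .
            have r4: "r4 x = ?r2 x" if "x \<notin> {8, 16, 17, 18, 23, 24, 26, 27, 28}" for x
              using frame_reg[OF 3(4), of x] that r3[of x] by (auto simp: mr)
            have r4b: "r4 16 = b" using frame_reg[OF 3(4), of 16] \<open>r3 16 = b\<close> by (auto simp: mr)
            have st4: "static r4 \<mu>4"
              by (rule static_cong[OF st3]) (use r3 r4 frame_mem[OF 3(4)] in \<open>auto simp: mr mm\<close>)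
            have h4: "hval inp (HGet [HNum 9, $4 \<ominus> HNum 1 \<ominus> $15]) r4 \<mu>4 = cB (N - 1 - i)"
              using staticD[OF st4] r4[of 15] \<open>r2 15 = i\<close> by simp
            show ?case
            proof (rule wp_For[where T = T and I = "\<lambda>q r' \<mu>'. J i b p' q \<mu>'"], goal_cases)
              case 1
              then show ?case unfolding h4 using K(2)[of "N - 1 - i"] V by simp
            next
              case (2 r')
              then show ?case using 3(2) by simp
            next
              case (3 q r5 \<mu>5)
              have q: "q < cB (N - 1 - i)" using 3(1) unfolding h4 .
              have r5: "r5 x = ?r2 x" if "x \<notin> {8, 16, 17, 18, 23, 24, 26, 27, 28}" for x
                using frame_reg[OF 3(4), of x] that r4[of x] by (auto simp: mr)
              have r5': "r5 16 = b" "r5 17 = p'"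
                using frame_reg[OF 3(4), of 16] frame_reg[OF 3(4), of 17] r4b \<open>r4 17 = p'\<close> by (auto simp: mr)
              have st5: "static r5 \<mu>5"
                by (rule static_cong[OF st4]) (use r4 r5 frame_mem[OF 3(4)] in \<open>auto simp: mr mm\<close>)
              have h5: "hval inp (HGet [HNum 10, $4 \<ominus> HNum 1 \<ominus> $15, $16, $18]) r5 \<mu>5 = fB (N - 1 - i) b q"
                using staticD[OF st5] r5[of 15] \<open>r2 15 = i\<close> r5' 3(3) by simp
              let ?r5 = "r5(27 := fB (N - 1 - i) b q)"
              have h5': "hval inp (HGet [HNum 7, $15, $16, $17]) ?r5 \<mu>5 = fA i b p'"
                using staticD[OF st5] r5[of 15] \<open>r2 15 = i\<close> r5' 3(3) by simp
              have le: "fB (N - 1 - i) b q \<le> V" "fA i b p' \<le> V"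
                using FB[OF i b q] FA[OF i b p] K(1)[of "Suc i"] K(2)[of "N - i"] i V by auto
              have "wp inp V p (\<lambda>r' \<mu>' t. t \<le> T \<and> J i b p' (Suc q) \<mu>') (?r5(28 := fA i b p')) \<mu>5"
                using r5[of 15] r5[of 19] r5' \<open>r2 15 = i\<close> e 3(2,3)
                by (intro step[OF _ i b p q] static_cong[OF st5]) auto
              then have "wp inp V p (\<lambda>r'' \<mu>'' t. t \<le> T \<and> J i b p' (Suc q) \<mu>'') (?r5(28 := fA i b p')) \<mu>5" .
              then show ?case unfolding wp.simps(2,4) h5 h5' using le by simp
            next
              case (4 r5 \<mu>5 t)
              have "t \<le> K * Suc T"
                using 4(4) mult_le_mono1[OF K(2)[of "N - 1 - i"], of "Suc T"] unfolding h4 by simp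
              then show ?case using next_p[OF i b p] 4(1) unfolding h4 by blast
            qed
          next
            case (4 r4 \<mu>4 t)
            have "t \<le> K * Suc (K * Suc T)"
              using 4(4) mult_le_mono1[OF K(1)[of i], of "Suc (K * Suc T)"] i unfolding h3 by simp
            then show ?case using next_b[OF i b] 4(1) unfolding h3 by blast
          qed
        next
          case (4 r3 \<mu>3 t)
          have "t \<le> 2 * Suc (K * Suc (K * Suc T))"
            using 4(4) mult_le_mono1[OF nb2, of "Suc (K * Suc (K * Suc T))"] unfolding hb by linarith
          then show ?case using fin[OF i] 4(1) unfolding hb by simp
        qed
      qed
    next
      case (4 r2 \<mu>2 t)
      then show ?case using t1 staticD[OF st1] by simp
    qed
  qed
qed

definition "fresh i \<mu> \<longleftrightarrow> (\<forall>i'>i. \<forall>p q d. \<mu> [11, i', p, q, d] = (0::nat))"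

lemma num_zero: "(\<And>j. j < l \<Longrightarrow> \<mu> (ks @ [j]) = 0) \<Longrightarrow> num \<mu> ks l = 0 \<and> isbits \<mu> ks l"
  by (simp add: num_def isbits_def)

lemma num_fresh: "fresh i \<mu> \<Longrightarrow> i < i' \<Longrightarrow> num \<mu> [11, i', p, q] l = 0 \<and> isbits \<mu> [11, i', p, q] l"
  by (rule num_zero) (simp add: fresh_def)

lemma num_one:
  assumes "\<mu> (ks @ [0]) = 1" "\<And>j. 0 < j \<Longrightarrow> \<mu> (ks @ [j]) = 0"
  shows "num \<mu> ks l = 1 \<and> isbits \<mu> ks l"
proof -
  have "num \<mu> ks l = (\<Sum>j\<in>{0}. \<mu> (ks @ [j]) * 2 ^ j)"
    unfolding num_def using l0 assms(2) by (intro sum.mono_neutral_right) auto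
  moreover have "isbits \<mu> ks l" using assms unfolding isbits_def by (metis gr0I le_numeral_extra(4) zero_le)
  ultimately show ?thesis using assms(1) by simp
qed

lemma num_other:
  assumes "\<And>k. (\<And>j. k \<noteq> dk @ [j]) \<Longrightarrow> \<mu>' k = \<mu> k" "ks \<noteq> dk"
  shows "num \<mu>' ks l = num \<mu> ks l" "isbits \<mu>' ks l = isbits \<mu> ks l"
  using assms by (auto intro!: num_cong isbits_cong)

subsection \<open>Counting\<close>

definition "cnt_level i \<mu> \<longleftrightarrow> (\<forall>p<cA i. \<forall>q<cB (N - i). isbits \<mu> [11, i, p, q] l \<and> num \<mu> [11, i, p, q] l = cnt_tab i p q)"

text \<open>Columns before \<open>q\<close> have already received the contribution of
  \<open>p\<close>, the others have not; hence the case distinction in the partial count.\<close>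

definition "cnt_inv i b p q \<mu> \<longleftrightarrow> cnt_level i \<mu> \<and> fresh (Suc i) \<mu> \<and>
   (\<forall>p'<cA (Suc i). \<forall>q'<cB (N - 1 - i). isbits \<mu> [11, Suc i, p', q'] l \<and>
      num \<mu> [11, Suc i, p', q'] l = cnt_part i b (if q' < q then Suc p else p) p' q')"

lemma wp_count_step:
  assumes st: "static r \<mu>" and i: "i < N" "b < nb i" "p < cA i" "q < cB (N - 1 - i)"
    and r: "r 15 = i" "r 16 = b" "r 17 = p" "r 18 = q" "r 19 = E i" "r 27 = fB (N - 1 - i) b q" "r 28 = fA i b p"
    and J: "cnt_inv i b p q \<mu>" and l: "N < l"
  shows "wp inp V count_step (\<lambda>r' \<mu>' t. t \<le> l \<and> cnt_inv i b p (Suc q) \<mu>') r \<mu>"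
proof -
  let ?dk = "[11, Suc i, fA i b p, q]" and ?sk = "[11, i, p, fB (N - 1 - i) b q]"
  have c: "hval inp cond_exp r \<mu> \<noteq> 0 \<longleftrightarrow> cond i p q" using cond_val[OF st r(1,3,4,5) i(1)] .
  have fa: "fA i b p < cA (Suc i)" using FA[OF i(1-3)] by simp
  have fb: "fB (N - 1 - i) b q < cB (N - i)" using FB[OF i(1,2,4)] by simp
  have dk: "isbits \<mu> ?dk l" "num \<mu> ?dk l = cnt_part i b p (fA i b p) q"
    using J fa i(4) unfolding cnt_inv_def by auto
  have sk: "isbits \<mu> ?sk l" "num \<mu> ?sk l = cnt_tab i p (fB (N - 1 - i) b q)"
    using J fb i(3) unfolding cnt_inv_def cnt_level_def by auto
  note part = cnt_part_Suc[OF i(2), of p _ q]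
  show ?thesis
  proof (cases "cond i p q")
    case False
    have "cnt_part i b (Suc p) p' q = cnt_part i b p p' q" for p' using part[of p'] False by simp
    then have "cnt_inv i b p (Suc q) \<mu>" using J unfolding cnt_inv_def by (auto simp: less_Suc_eq)
    then show ?thesis using False c by (simp add: count_step_def)
  next
    case True
    \<comment> \<open>The sum is itself a partial count, so the bound on partial counts excludes an
      overflow of the addition.\<close>
    have "num \<mu> ?dk l + num \<mu> ?sk l = cnt_part i b (Suc p) (fA i b p) q"
      unfolding dk sk using part[of "fA i b p"] True by simp
    also have "\<dots> \<le> 2 ^ Suc i" by (rule cnt_part_bound)
    also have "\<dots> < 2 ^ l" using i(1) l by (intro power_strict_increasing) auto
    finally have lt: "num \<mu> ?dk l + num \<mu> ?sk l < 2 ^ l" .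
    have "wp inp V (add_to [HNum 11, $15 \<oplus> HNum 1, $28, $18] [HNum 11, $15, $17, $27])
      (\<lambda>r' \<mu>' t. t \<le> l \<and> isbits \<mu>' ?dk l \<and> num \<mu>' ?dk l = num \<mu> ?dk l + num \<mu> ?sk l \<and>
       (\<forall>k. (\<forall>j. k \<noteq> ?dk @ [j]) \<longrightarrow> \<mu>' k = \<mu> k)) r \<mu>"
      using staticD[OF st] V r dk sk by (intro wp_add_to[OF _ _ _ _ _ _ _ _ lt]) auto
    then have "wp inp V (add_to [HNum 11, $15 \<oplus> HNum 1, $28, $18] [HNum 11, $15, $17, $27])
      (\<lambda>r' \<mu>' t. t \<le> l \<and> cnt_inv i b p (Suc q) \<mu>') r \<mu>"
    proof (rule wp_mono)
      fix r' \<mu>' t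
      assume a: "t \<le> l \<and> isbits \<mu>' ?dk l \<and> num \<mu>' ?dk l = num \<mu> ?dk l + num \<mu> ?sk l \<and>
       (\<forall>k. (\<forall>j. k \<noteq> ?dk @ [j]) \<longrightarrow> \<mu>' k = \<mu> k)"
      have o: "num \<mu>' ks l = num \<mu> ks l" "isbits \<mu>' ks l = isbits \<mu> ks l" if "ks \<noteq> ?dk" for ks
        using num_other[of ?dk \<mu>' \<mu> ks] a that by blast+
      have "cnt_level i \<mu>'" using J unfolding cnt_inv_def cnt_level_def by (simp add: o)
      moreover have "fresh (Suc i) \<mu>'" using J a unfolding cnt_inv_def fresh_def by auto
      moreover have "isbits \<mu>' [11, Suc i, p', q'] l \<and>
          num \<mu>' [11, Suc i, p', q'] l = cnt_part i b (if q' < Suc q then Suc p else p) p' q'"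
        if "p' < cA (Suc i)" "q' < cB (N - 1 - i)" for p' q'
      proof (cases "q' = q \<and> p' = fA i b p")
        case True
        then show ?thesis using a part[of "fA i b p"] \<open>cond i p q\<close> dk(2) sk(2) by simp
      next
        case False
        then have "num \<mu>' [11, Suc i, p', q'] l = num \<mu> [11, Suc i, p', q'] l"
          "isbits \<mu>' [11, Suc i, p', q'] l = isbits \<mu> [11, Suc i, p', q'] l"
          by (auto intro!: o)
        moreover have "q' = q \<Longrightarrow> cnt_part i b (Suc p) p' q = cnt_part i b p p' q"
          using part[of p'] False by auto
        ultimately show ?thesis using J that unfolding cnt_inv_def by (auto simp: less_Suc_eq)
      qed
      ultimately show "t \<le> l \<and> cnt_inv i b p (Suc q) \<mu>'" using a unfolding cnt_inv_def by blast
    qed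
    then show ?thesis using True c by (simp add: count_step_def)
  qed
qed

lemma wp_count:
  assumes st: "static r \<mu>" and z: "\<And>ks. \<mu> (11 # ks) = 0" and l: "N < l"
  shows "wp inp V (sweep count_step) (\<lambda>r' \<mu>' t. t \<le> K + N * Suc (2 * Suc (K * Suc (K * Suc l))) \<and>
    isbits \<mu>' [11, N, 0, 0] l \<and> num \<mu>' [11, N, 0, 0] l = cnt_tab N 0 0) r \<mu>"
proof -
  \<comment> \<open>Branch 0 always exists, so the path of zeros is a full path and the last level
    has an index.\<close>
  have N0: "0 < cA N" using idx_bound[of _ N] pathsI[of "replicate N 0" N nb] by (fastforce simp: nb_def)
  have "wp inp V (sweep count_step) (\<lambda>r' \<mu>' t. t \<le> K + N * Suc (2 * Suc (K * Suc (K * Suc l))) \<and>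
    (cnt_level N \<mu>' \<and> fresh N \<mu>')) r \<mu>"
  proof (rule wp_sweep[where J = cnt_inv and Z = "\<lambda>i \<mu>. cnt_level i \<mu> \<and> fresh i \<mu>", OF st], goal_cases)
    case (3 \<mu>')
    have "num \<mu>' [11, 0, 0, q] l = 1 \<and> isbits \<mu>' [11, 0, 0, q] l" if "q < cB N" for q
      using 3(1)[OF that] 3(2) z by (intro num_one) auto
    then have "cnt_level 0 \<mu>'" using cnt0 cnt_tab_0 by (simp add: cnt_level_def)
    moreover have "fresh 0 \<mu>'" using 3(2) z by (simp add: fresh_def)
    ultimately show ?case by blast
  next
    case (4 i \<mu>)
    then show ?case using num_fresh[of i \<mu> "Suc i"] unfolding cnt_inv_def
      by (auto simp: fresh_def cnt_part_0)
  next
    case (5 i b p' q r \<mu>)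
    then show ?case using l by (intro wp_count_step) auto
  next
    case (6 i b p \<mu>)
    then show ?case unfolding cnt_inv_def by auto
  next
    case (7 i b \<mu>)
    then show ?case using cnt_part_next_b[of i b] unfolding cnt_inv_def by auto
  next
    case (8 i \<mu>)
    have "N - 1 - i = N - Suc i" by simp
    then show ?case using 8 cnt_part_end[of i] unfolding cnt_inv_def cnt_level_def by auto
  qed auto
  then show ?thesis
  proof (rule wp_mono)
    fix r' \<mu>' t assume a: "t \<le> K + N * Suc (2 * Suc (K * Suc (K * Suc l))) \<and> cnt_level N \<mu>' \<and> fresh N \<mu>'"
    have "cB (N - N) = 1" using cnt0 by simp
    then show "t \<le> K + N * Suc (2 * Suc (K * Suc (K * Suc l))) \<and> isbits \<mu>' [11, N, 0, 0] l \<and>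
       num \<mu>' [11, N, 0, 0] l = cnt_tab N 0 0"
      using a N0 unfolding cnt_level_def by simp
  qed
qed

end

subsection \<open>Maximizing\<close>

text \<open>Entries are stored increased by one, so that \<open>0\<close> marks a missing entry.\<close>

definition max_step :: prog where
  "max_step = copy [HNum 15] [HNum 11, $15, $17, $27] ;;
     PIf ($2 \<ominus> $19) (PIf cond_exp (add_to [HNum 15] [HNum 14, $19]) PSkip) PSkip ;;
     greater [HNum 15] [HNum 11, $15 \<oplus> HNum 1, $28, $18] ;;
     PIf ($26) (copy [HNum 11, $15 \<oplus> HNum 1, $28, $18] [HNum 15] ;;
       [HNum 12, $15 \<oplus> HNum 1, $28, $18] \<lhd> $16 ;; [HNum 13, $15 \<oplus> HNum 1, $28, $18] \<lhd> $17) PSkip"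

text \<open>Register 7 counts steps from the end; at element \<open>i\<close> it equals
  \<open>N - 1 - i\<close>, the backward level needed in array 10. Register 27 buffers the new
  forward index until the old pair is no longer needed.\<close>

definition backtrack :: prog where
  "backtrack = 17 ::= HNum 0 ;; 18 ::= HNum 0 ;; PFor 7 ($4)
     (15 ::= $4 \<ominus> HNum 1 \<ominus> $7 ;;
      16 ::= HGet [HNum 12, $15 \<oplus> HNum 1, $17, $18] ;;
      27 ::= HGet [HNum 13, $15 \<oplus> HNum 1, $17, $18] ;;
      19 ::= HGet [HNum 3, $15] ;;
      PIf ($2 \<ominus> $19) PSkip ([HNum 0, $19 \<ominus> $2] \<lhd> HNum 1 \<ominus> $16) ;;
      18 ::= HGet [HNum 10, $7, $16, $18] ;;
      17 ::= $27) ;;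
     1 ::= $3"

lemma mod_max_step [simp]: "modr max_step = {8, 23, 24, 26}" "modm max_step = {11, 12, 13, 15}" "wf_prog max_step"
  by (auto simp: max_step_def)

lemma mod_backtrack [simp]: "modr backtrack = {1, 7, 15, 16, 17, 18, 19, 27}" "modm backtrack = {0}" "wf_prog backtrack"
  by (auto simp: backtrack_def)

context dp_context
begin

text \<open>The gain at \<open>i\<close> with its condition dropped. Its sums bound every entry
  independently of the path, so that all additions fit into \<open>l\<close> bits.\<close>

definition "wmax i = (if E i < m then w (E i) else 0)"

definition "lower \<mu> i b p q \<longleftrightarrow>
  num \<mu> [11, i, p, fB (N - 1 - i) b q] l + inc i p q \<le> num \<mu> [11, Suc i, fA i b p, q] l"

text \<open>With \<open>lower\<close>, the two halves of a maximum: no candidate exceeds the entry,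
  and the entry equals the candidate recorded in arrays 12 and 13. During a level an entry may still
  be missing, that is 0, and then nothing is claimed.\<close>

definition "attained \<mu> i p q \<longleftrightarrow> (num \<mu> [11, Suc i, p, q] l \<noteq> 0 \<longrightarrow>
  \<mu> [12, Suc i, p, q] < nb i \<and> \<mu> [13, Suc i, p, q] < cA i \<and> fA i (\<mu> [12, Suc i, p, q]) (\<mu> [13, Suc i, p, q]) = p \<and>
  num \<mu> [11, Suc i, p, q] l = num \<mu> [11, i, \<mu> [13, Suc i, p, q], fB (N - 1 - i) (\<mu> [12, Suc i, p, q]) q] l +
    inc i (\<mu> [13, Suc i, p, q]) q)"

definition "max_upto i \<mu> \<longleftrightarrow>
  (\<forall>i'\<le>i. \<forall>p<cA i'. \<forall>q<cB (N - i'). isbits \<mu> [11, i', p, q] l \<and>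
     num \<mu> [11, i', p, q] l \<le> 1 + (\<Sum>j<i'. wmax j)) \<and>
  (\<forall>q<cB N. num \<mu> [11, 0, 0, q] l = 1) \<and>
  (\<forall>i'<i. (\<forall>b<nb i'. \<forall>p<cA i'. \<forall>q<cB (N - 1 - i'). lower \<mu> i' b p q) \<and>
     (\<forall>p<cA (Suc i'). \<forall>q<cB (N - 1 - i'). attained \<mu> i' p q))"

definition "max_inv i b p q \<mu> \<longleftrightarrow> max_upto i \<mu> \<and> fresh (Suc i) \<mu> \<and>
   (\<forall>p'<cA (Suc i). \<forall>q'<cB (N - 1 - i). isbits \<mu> [11, Suc i, p', q'] l \<and> attained \<mu> i p' q') \<and>
   (\<forall>b'<nb i. \<forall>p'<cA i. \<forall>q'<cB (N - 1 - i).
      b' < b \<or> b' = b \<and> p' < p \<or> b' = b \<and> p' = p \<and> q' < q \<longrightarrow> lower \<mu> i b' p' q')"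

lemma inc_le: "inc i p q \<le> wmax i"
  by (simp add: inc_def wmax_def)

lemma max_upto_cong:
  assumes "max_upto i \<mu>" "i < N"
    "\<And>i' p q. i' \<le> i \<Longrightarrow> num \<mu>' [11, i', p, q] l = num \<mu> [11, i', p, q] l \<and> isbits \<mu>' [11, i', p, q] l = isbits \<mu> [11, i', p, q] l"
    "\<And>i' p q. i' \<le> i \<Longrightarrow> \<mu>' [12, i', p, q] = \<mu> [12, i', p, q] \<and> \<mu>' [13, i', p, q] = \<mu> [13, i', p, q]"
  shows "max_upto i \<mu>'"
proof -
  have a: "attained \<mu>' i' p q = attained \<mu> i' p q" "lower \<mu>' i' b p q = lower \<mu> i' b p q" if "i' < i" for i' p q b
    using that assms(3)[of i'] assms(3,4)[of "Suc i'"] unfolding attained_def lower_def by simp_all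
  show ?thesis using assms(1,3) unfolding max_upto_def by (simp add: a)
qed

text \<open>The \<open>4 * l\<close> are two copies, one addition and one comparison of
  \<open>l\<close> bits each.\<close>

lemma wp_max_step:
  assumes st: "static r \<mu>" and i: "i < N" "b < nb i" "p < cA i" "q < cB (N - 1 - i)"
    and r: "r 15 = i" "r 16 = b" "r 17 = p" "r 18 = q" "r 19 = E i" "r 27 = fB (N - 1 - i) b q" "r 28 = fA i b p"
    and J: "max_inv i b p q \<mu>"
    and W: "\<And>c. c < m \<Longrightarrow> isbits \<mu>\<^sub>0 [14, c] l \<and> num \<mu>\<^sub>0 [14, c] l = w c"
    and l: "1 + (\<Sum>j<N. wmax j) < 2 ^ l"
  shows "wp inp V max_step (\<lambda>r' \<mu>' t. t \<le> 4 * l \<and> max_inv i b p (Suc q) \<mu>') r \<mu>"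
proof -
  let ?dk = "[11, Suc i, fA i b p, q]" and ?sk = "[11, i, p, fB (N - 1 - i) b q]"
  have fa: "fA i b p < cA (Suc i)" using FA[OF i(1-3)] by simp
  have fb: "fB (N - 1 - i) b q < cB (N - i)" using FB[OF i(1,2,4)] by simp
  have dk: "isbits \<mu> ?dk l" "attained \<mu> i (fA i b p) q" using J fa i(4) unfolding max_inv_def by auto
  have sk: "isbits \<mu> ?sk l" "num \<mu> ?sk l \<le> 1 + (\<Sum>j<i. wmax j)"
    using J fb i(3) unfolding max_inv_def max_upto_def by auto
  let ?X = "num \<mu> ?sk l + inc i p q"
  have X: "?X < 2 ^ l"
  proof -
    have "?X \<le> 1 + (\<Sum>j<Suc i. wmax j)" using sk(2) inc_le[of i p q] by simp
    also have "\<dots> \<le> 1 + (\<Sum>j<N. wmax j)" using i(1) by (intro add_left_mono sum_mono2) auto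
    finally show ?thesis using l by linarith
  qed
  have b2: "b \<le> V" using i(2) V by (auto simp: nb_def split: if_splits)
  have pV: "p \<le> V" using i(1,3) K(1)[of i] V by simp
  show ?thesis
    unfolding max_step_def wp.simps(4)
  proof (rule wp_mono[OF wp_frame[OF wp_copy[where dk = "[15]" and sk = ?sk and l = l]]], goal_cases)
    case (8 r1 \<mu>1 t1)
    then have f1: "frame (copy [HNum 15] [HNum 11, $15, $17, $27]) r \<mu> r1 \<mu>1" and c1: "t1 \<le> l" "isbits \<mu>1 [15] l"
      "num \<mu>1 [15] l = num \<mu> ?sk l" by auto
    have r1: "r1 x = r x" if "x \<noteq> 8" for x using frame_reg[OF f1, of x] that by simp
    have m1: "\<mu>1 (a # ks) = \<mu> (a # ks)" if "a \<noteq> 15" for a ks using frame_mem[OF f1, of a ks] that by simp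
    have st1: "static r1 \<mu>1" by (rule static_cong[OF st]) (use r1 m1 in auto)
    have cv: "hval inp cond_exp r1 \<mu>1 \<noteq> 0 \<longleftrightarrow> cond i p q"
      using r1 r i(1) by (intro cond_val[OF st1]) auto
    define P where "P = PIf ($2 \<ominus> $19) (PIf cond_exp (add_to [HNum 15] [HNum 14, $19]) PSkip) PSkip"
    have modP: "modr P = {8, 23, 24}" "modm P = {15}" unfolding P_def by auto
    have "wp inp V P (\<lambda>r' \<mu>' t. t \<le> l \<and> isbits \<mu>' [15] l \<and> num \<mu>' [15] l = ?X) r1 \<mu>1"
    proof (cases "E i < m \<and> cond i p q")
      case True
      have wk: "isbits \<mu>1 [14, E i] l" "num \<mu>1 [14, E i] l = w (E i)"
        using W[of "E i"] True staticD(5)[OF st1, of 14] by (auto simp: isbits_def num_def)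
      have lt: "num \<mu>1 [15] l + num \<mu>1 [14, E i] l < 2 ^ l"
        using X True unfolding c1(3) wk(2) by (simp add: inc_def)
      have "wp inp V (add_to [HNum 15] [HNum 14, $19]) (\<lambda>r' \<mu>' t. t \<le> l \<and> isbits \<mu>' [15] l \<and>
          num \<mu>' [15] l = num \<mu>1 [15] l + num \<mu>1 [14, E i] l \<and> (\<forall>k. (\<forall>j. k \<noteq> [15] @ [j]) \<longrightarrow> \<mu>' k = \<mu>1 k)) r1 \<mu>1"
        using staticD[OF st1] V r r1 c1 wk by (intro wp_add_to[OF _ _ _ _ _ _ _ _ lt]) auto
      then have "wp inp V (add_to [HNum 15] [HNum 14, $19]) (\<lambda>r' \<mu>' t. t \<le> l \<and> isbits \<mu>' [15] l \<and> num \<mu>' [15] l = ?X) r1 \<mu>1"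
        using True by (elim wp_mono) (auto simp: c1(3) wk(2) inc_def)
      then show ?thesis using True cv staticD[OF st1] r r1 unfolding P_def by simp
    next
      case False
      then have "inc i p q = 0" by (auto simp: inc_def)
      then show ?thesis using False cv staticD[OF st1] r r1 c1 unfolding P_def by auto
    qed
    from wp_frame[OF this] show ?case
      unfolding P_def[symmetric]
    proof (rule wp_mono, goal_cases)
      case (1 r2 \<mu>2 t2)
      then have f2: "frame P r1 \<mu>1 r2 \<mu>2" and c2: "t2 \<le> l" "isbits \<mu>2 [15] l" "num \<mu>2 [15] l = ?X" by auto
      have r2: "r2 x = r x" if "x \<notin> {8, 23, 24}" for x using frame_reg[OF f2, of x] r1[of x] that modP by simp
      have m2: "\<mu>2 (a # ks) = \<mu> (a # ks)" if "a \<noteq> 15" for a ks using frame_mem[OF f2, of a ks] m1 that modP by simp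
      have st2: "static r2 \<mu>2" by (rule static_cong[OF st]) (use r2 m2 in auto)
      have dk2: "isbits \<mu>2 ?dk l" "num \<mu>2 ?dk l = num \<mu> ?dk l"
        using dk(1) m2 by (auto simp: isbits_def num_def)
      show ?case
      proof (rule wp_mono[OF wp_frame[OF wp_greater[where xk = "[15]" and yk = ?dk and l = l]]], goal_cases)
        case (10 r3 \<mu>3 t3)
        then have f3: "frame (greater [HNum 15] [HNum 11, $15 \<oplus> HNum 1, $28, $18]) r2 \<mu>2 r3 \<mu>3"
          and c3: "t3 \<le> l" "r3 26 \<noteq> 0 \<longleftrightarrow> num \<mu> ?dk l < ?X" using c2 dk2 by auto
        have r3: "r3 x = r x" if "x \<notin> {8, 23, 24, 26}" for x using frame_reg[OF f3, of x] r2[of x] that by simp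
        have m3: "\<mu>3 (a # ks) = \<mu>2 (a # ks)" for a ks using frame_mem[OF f3, of a ks] by simp
        have m3': "\<mu>3 (a # ks) = \<mu> (a # ks)" if "a \<noteq> 15" for a ks using m3 m2 that by simp
        have n3: "num \<mu>3 (a # ks) l = num \<mu> (a # ks) l" "isbits \<mu>3 (a # ks) l = isbits \<mu> (a # ks) l" if "a \<noteq> 15" for a ks
          using m3' that by (auto simp: num_def isbits_def)
        have X3: "isbits \<mu>3 [15] l" "num \<mu>3 [15] l = ?X" using c2 m3 by (auto simp: num_def isbits_def)
        have J3: "max_inv i b p q \<mu>3"
          using J m3' unfolding max_inv_def max_upto_def attained_def lower_def fresh_def by (simp add: n3)
        have st3: "static r3 \<mu>3" by (rule static_cong[OF st]) (use r3 m3' in auto)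
        show ?case
        proof (cases "num \<mu> ?dk l < ?X")
          case False
          have "max_inv i b p (Suc q) \<mu>3"
            unfolding max_inv_def
          proof (intro conjI allI impI)
            fix b' p' q' assume "b' < nb i" "p' < cA i" "q' < cB (N - 1 - i)"
              "b' < b \<or> b' = b \<and> p' < p \<or> b' = b \<and> p' = p \<and> q' < Suc q"
            then show "lower \<mu>3 i b' p' q'"
              using J3 False unfolding max_inv_def by (cases "b' = b \<and> p' = p \<and> q' = q") (auto simp: lower_def n3)
          qed (use J3 in \<open>auto simp: max_inv_def\<close>)
          then show ?thesis using False c3 c1 c2 by simp
        next
          case True
          have "wp inp V (copy [HNum 11, $15 \<oplus> HNum 1, $28, $18] [HNum 15]) (\<lambda>r' \<mu>' t. t \<le> l \<and> isbits \<mu>' ?dk l \<and>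
              num \<mu>' ?dk l = num \<mu>3 [15] l \<and> (\<forall>k. (\<forall>j. k \<noteq> ?dk @ [j]) \<longrightarrow> \<mu>' k = \<mu>3 k)) r3 \<mu>3"
            using staticD[OF st3] V r r3 X3 by (intro wp_copy) auto
          from wp_frame[OF this]
          have "wp inp V (copy [HNum 11, $15 \<oplus> HNum 1, $28, $18] [HNum 15] ;;
            [HNum 12, $15 \<oplus> HNum 1, $28, $18] \<lhd> $16 ;; [HNum 13, $15 \<oplus> HNum 1, $28, $18] \<lhd> $17)
            (\<lambda>r' \<mu>' t. t \<le> l \<and> max_inv i b p (Suc q) \<mu>') r3 \<mu>3"
            unfolding wp.simps(4)
          proof (rule wp_mono, goal_cases)
            case (1 r4 \<mu>4 t4)
            then have f4: "frame (copy [HNum 11, $15 \<oplus> HNum 1, $28, $18] [HNum 15]) r3 \<mu>3 r4 \<mu>4"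
              and c4: "t4 \<le> l" "isbits \<mu>4 ?dk l" "num \<mu>4 ?dk l = ?X"
              and o4: "\<And>k. (\<And>j. k \<noteq> ?dk @ [j]) \<Longrightarrow> \<mu>4 k = \<mu>3 k" using X3 by auto
            have r4: "r4 x = r x" if "x \<notin> {8, 23, 24, 26}" for x using frame_reg[OF f4, of x] r3[of x] that by simp
            define \<mu>5 where "\<mu>5 = \<mu>4([12, Suc i, fA i b p, q] := b, [13, Suc i, fA i b p, q] := p)"
            have n5: "num \<mu>5 [11, i', p', q'] l = num \<mu>3 [11, i', p', q'] l"
              "isbits \<mu>5 [11, i', p', q'] l = isbits \<mu>3 [11, i', p', q'] l"
              if "[11, i', p', q'] \<noteq> ?dk" for i' p' q'
              using o4 that by (auto simp: num_def isbits_def \<mu>5_def)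
            have d5: "num \<mu>5 ?dk l = ?X" "isbits \<mu>5 ?dk l"
              using c4 by (auto simp: num_def isbits_def \<mu>5_def)
            have ch: "\<mu>5 [12, i', p', q'] = (if i' = Suc i \<and> p' = fA i b p \<and> q' = q then b else \<mu>3 [12, i', p', q'])"
              "\<mu>5 [13, i', p', q'] = (if i' = Suc i \<and> p' = fA i b p \<and> q' = q then p else \<mu>3 [13, i', p', q'])" for i' p' q'
              using o4 by (auto simp: \<mu>5_def)
            have up3: "max_upto i \<mu>3" and fr3: "fresh (Suc i) \<mu>3"
              and at3: "\<And>p' q'. p' < cA (Suc i) \<Longrightarrow> q' < cB (N - 1 - i) \<Longrightarrow>
                isbits \<mu>3 [11, Suc i, p', q'] l \<and> attained \<mu>3 i p' q'"
              using J3 unfolding max_inv_def by blast+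
            have "max_inv i b p (Suc q) \<mu>5"
              unfolding max_inv_def
            proof (intro conjI allI impI)
              show "max_upto i \<mu>5"
                by (rule max_upto_cong[OF up3 i(1)]) (simp_all add: n5 ch)
              show "fresh (Suc i) \<mu>5" using fr3 o4 unfolding fresh_def \<mu>5_def by simp
            next
              fix p' q' assume pq: "p' < cA (Suc i)" "q' < cB (N - 1 - i)"
              show "isbits \<mu>5 [11, Suc i, p', q'] l"
                using at3[OF pq] d5(2) n5(2)[of "Suc i" p' q'] by (cases "p' = fA i b p \<and> q' = q") auto
              show "attained \<mu>5 i p' q'"
              proof (cases "p' = fA i b p \<and> q' = q")
                case True
                \<comment> \<open>The source lies in level \<open>i\<close> and the write in level
                  \<open>Suc i\<close>, so the recorded value can still be read off.\<close>
                have "num \<mu>5 ?sk l = num \<mu> ?sk l" using n5(1)[of i] n3(1) by simp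
                then show ?thesis using True d5 i unfolding attained_def by (simp add: ch)
              next
                case False
                have "attained \<mu>3 i p' q'" using at3[OF pq] by blast
                moreover have "\<mu>5 [12, Suc i, p', q'] = \<mu>3 [12, Suc i, p', q']"
                  "\<mu>5 [13, Suc i, p', q'] = \<mu>3 [13, Suc i, p', q']"
                  using ch False by auto
                ultimately show ?thesis using False n5(1)[of "Suc i" p' q'] n5(1)[of i] unfolding attained_def
                  by simp
              qed
            next
              fix b' p' q' assume bpq: "b' < nb i" "p' < cA i" "q' < cB (N - 1 - i)"
                "b' < b \<or> b' = b \<and> p' < p \<or> b' = b \<and> p' = p \<and> q' < Suc q"
              have n5i: "num \<mu>5 [11, i, p'', q''] l = num \<mu> [11, i, p'', q''] l" for p'' q'' using n5(1)[of i] n3(1) by simp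
              show "lower \<mu>5 i b' p' q'"
              proof (cases "b' = b \<and> p' = p \<and> q' = q")
                case True
                then show ?thesis using d5(1) n5i unfolding lower_def by simp
              next
                case False
                then have low: "lower \<mu>3 i b' p' q'" using J3 bpq unfolding max_inv_def by auto
                show ?thesis
                proof (cases "fA i b' p' = fA i b p \<and> q' = q")
                  \<comment> \<open>Another candidate for the entry just overwritten: it was
                    dominated by the old value, and the new value is larger.\<close>
                  case True
                  then have "num \<mu> [11, i, p', fB (N - 1 - i) b' q'] l + inc i p' q' \<le> num \<mu> ?dk l"
                    using low n3(1) unfolding lower_def by simp
                  then show ?thesis using \<open>num \<mu> ?dk l < ?X\<close> True d5(1) unfolding lower_def n5i by auto
                next
                  case False
                  then have "num \<mu>5 [11, Suc i, fA i b' p', q'] l = num \<mu>3 [11, Suc i, fA i b' p', q'] l"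
                    by (intro n5(1)) auto
                  then show ?thesis using low n3(1) unfolding lower_def n5i by simp
                qed
              qed
            qed
            then show ?case using r4 r c4(1) b2 pV by (simp add: \<mu>5_def)
          qed
          then show ?thesis unfolding wp.simps(5) using True c3 c1 c2
            by (auto elim!: wp_mono)
        qed
      qed (use staticD[OF st2] V r r2 c2 dk2 in auto)
    qed
  qed (use staticD[OF st] V r sk in auto)
qed

lemma wp_max:
  assumes st: "static r \<mu>" and z: "\<And>ks. \<mu> (11 # ks) = 0"
    and W: "\<And>c. c < m \<Longrightarrow> isbits \<mu>\<^sub>0 [14, c] l \<and> num \<mu>\<^sub>0 [14, c] l = w c"
    and l: "1 + (\<Sum>j<N. wmax j) < 2 ^ l"
  shows "wp inp V (sweep max_step) (\<lambda>r' \<mu>' t. t \<le> K + N * Suc (2 * Suc (K * Suc (K * Suc (4 * l)))) \<and> max_upto N \<mu>') r \<mu>"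
proof -
  have "wp inp V (sweep max_step) (\<lambda>r' \<mu>' t. t \<le> K + N * Suc (2 * Suc (K * Suc (K * Suc (4 * l)))) \<and>
    (max_upto N \<mu>' \<and> fresh N \<mu>')) r \<mu>"
  proof (rule wp_sweep[where J = max_inv and Z = "\<lambda>i \<mu>. max_upto i \<mu> \<and> fresh i \<mu>", OF st], goal_cases)
    case (3 \<mu>')
    have "num \<mu>' [11, 0, 0, q] l = 1 \<and> isbits \<mu>' [11, 0, 0, q] l" if "q < cB N" for q
      using 3(1)[OF that] 3(2) z by (intro num_one) auto
    then have "max_upto 0 \<mu>'" using cnt0 by (simp add: max_upto_def)
    moreover have "fresh 0 \<mu>'" using 3(2) z by (simp add: fresh_def)
    ultimately show ?case by blast
  next
    case (4 i \<mu>)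
    then show ?case using num_fresh[of i \<mu> "Suc i"] unfolding max_inv_def attained_def
      by (auto simp: fresh_def)
  next
    case (5 i b p' q r \<mu>)
    show ?case by (rule wp_max_step[OF 5 W l])
  next
    case (6 i b p \<mu>)
    then show ?case unfolding max_inv_def by (auto simp: less_Suc_eq)
  next
    case (7 i b \<mu>)
    then show ?case unfolding max_inv_def by (auto simp: less_Suc_eq)
  next
    case (8 i \<mu>)
    have e: "N - 1 - i = N - Suc i" by simp
    have up: "max_upto i \<mu>" and lw: "\<forall>b<nb i. \<forall>p<cA i. \<forall>q<cB (N - 1 - i). lower \<mu> i b p q"
      and at: "\<forall>p<cA (Suc i). \<forall>q<cB (N - 1 - i). isbits \<mu> [11, Suc i, p, q] l \<and> attained \<mu> i p q"
      and fr: "fresh (Suc i) \<mu>"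
      using 8(2) unfolding max_inv_def by auto
    \<comment> \<open>A nonzero entry equals a source entry plus a gain, so its bound follows from
      that of level \<open>i\<close> and \<open>inc_le\<close>.\<close>
    have "num \<mu> [11, Suc i, p, q] l \<le> 1 + (\<Sum>j<Suc i. wmax j)" if pq: "p < cA (Suc i)" "q < cB (N - 1 - i)" for p q
    proof (cases "num \<mu> [11, Suc i, p, q] l = 0")
      case False
      let ?b = "\<mu> [12, Suc i, p, q]" and ?p = "\<mu> [13, Suc i, p, q]"
      have a: "?b < nb i" "?p < cA i" "num \<mu> [11, Suc i, p, q] l = num \<mu> [11, i, ?p, fB (N - 1 - i) ?b q] l + inc i ?p q"
        using at pq False unfolding attained_def by auto
      have "fB (N - 1 - i) ?b q < cB (N - i)" using FB[OF 8(1) a(1) pq(2)] by simp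
      then have "num \<mu> [11, i, ?p, fB (N - 1 - i) ?b q] l \<le> 1 + (\<Sum>j<i. wmax j)"
        using up a(2) unfolding max_upto_def by blast
      then show ?thesis using a(3) inc_le[of i ?p q] by simp
    qed simp
    then have "max_upto (Suc i) \<mu>"
      using up lw at unfolding max_upto_def e by (auto simp: le_Suc_eq less_Suc_eq)
    then show ?case using fr by blast
  qed auto
  then show ?thesis by (rule wp_mono) blast
qed

definition "best \<mu> = track (\<lambda>i p q. \<mu> [12, Suc i, p, q]) (\<lambda>i p q. \<mu> [13, Suc i, p, q])"

text \<open>Discharges the proviso in \<open>attained\<close>. Every forward index has a predecessor
  by \<open>FA_surj\<close>, so positivity spreads by \<open>lower\<close> from level 0 to all
  entries, and tracing back never meets a missing one.\<close>

lemma max_step_attained: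
  assumes up: "max_upto N \<mu>" and i: "i < N" "p < cA (Suc i)" "q < cB (N - 1 - i)"
  shows "\<mu> [12, Suc i, p, q] < nb i \<and> \<mu> [13, Suc i, p, q] < cA i \<and> fA i (\<mu> [12, Suc i, p, q]) (\<mu> [13, Suc i, p, q]) = p \<and>
    num \<mu> [11, Suc i, p, q] l = num \<mu> [11, i, \<mu> [13, Suc i, p, q], fB (N - 1 - i) (\<mu> [12, Suc i, p, q]) q] l +
    inc i (\<mu> [13, Suc i, p, q]) q"
proof -
  have e: "N - Suc i = N - 1 - i" by simp
  have v0: "1 \<le> num \<mu> [11, 0, 0, q] l" if "q < cB N" for q using up that unfolding max_upto_def by simp
  have low: "num \<mu> [11, i, p, fB (N - 1 - i) b q] l + inc i p q \<le> num \<mu> [11, Suc i, fA i b p, q] l"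
    if "i < N" "b < nb i" "p < cA i" "q < cB (N - 1 - i)" for i b p q
    using up that unfolding max_upto_def lower_def by blast
  have pos: "1 \<le> num \<mu> [11, i', p', q'] l" if "i' \<le> N" "p' < cA i'" "q' < cB (N - i')" for i' p' q'
    using that
  proof (induction i' arbitrary: p' q')
    case 0
    then show ?case using v0 cnt0 by simp
  next
    case (Suc i')
    then obtain b p where b: "b < nb i'" "p < cA i'" "fA i' b p = p'" using FA_surj[of i' p'] by auto
    have q: "q' < cB (N - 1 - i')" "i' < N" using Suc.prems by auto
    have "1 \<le> num \<mu> [11, i', p, fB (N - 1 - i') b q'] l"
      using FB[OF q(2) b(1) q(1)] q(2) b by (intro Suc.IH) auto
    then show ?case using low[OF q(2) b(1,2) q(1)] unfolding b(3) by linarith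
  qed
  have "num \<mu> [11, Suc i, p, q] l \<noteq> 0" using pos[of "Suc i" p q] i unfolding e by simp
  then show ?thesis using up i unfolding max_upto_def attained_def by blast
qed

lemma best_props:
  assumes up: "max_upto N \<mu>"
  shows "i \<le> N \<Longrightarrow> p < cA i \<Longrightarrow> q < cB (N - i) \<Longrightarrow> best \<mu> i p q \<in> paths nb i"
    and "best \<mu> N 0 0 \<in> paths nb N \<and> (\<forall>bs\<in>paths nb N. wpath bs 0 \<le> wpath (best \<mu> N 0 0) 0)"
proof -
  have v0: "num \<mu> [11, 0, 0, q] l = 1" if "q < cB N" for q using up that unfolding max_upto_def by simp
  have low: "num \<mu> [11, i, p, fB (N - 1 - i) b q] l + inc i p q \<le> num \<mu> [11, Suc i, fA i b p, q] l"
    if "i < N" "b < nb i" "p < cA i" "q < cB (N - 1 - i)" for i b p q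
    using up that unfolding max_upto_def lower_def by blast
  have tr: "best \<mu> i p q \<in> paths nb i \<and> idx fA (best \<mu> i p q) = p \<and>
      num \<mu> [11, i, p, q] l = wpath (best \<mu> i p q) q + 1" if "i \<le> N" "p < cA i" "q < cB (N - i)" for i p q
    unfolding best_def
    by (rule wpath_track[where v = "\<lambda>i p q. num \<mu> [11, i, p, q] l"])
      (erule v0, rule max_step_attained[OF up], assumption+, (rule that)+)
  show "i \<le> N \<Longrightarrow> p < cA i \<Longrightarrow> q < cB (N - i) \<Longrightarrow> best \<mu> i p q \<in> paths nb i" using tr[of i p q] by blast
  have q0: "0 < cB (N - N)" using cnt0 by simp
  have c0: "0 < cA N" using idx_bound[of "replicate N 0" N] pathsI[of "replicate N 0" N nb] by (fastforce simp: nb_def)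
  have b: "best \<mu> N 0 0 \<in> paths nb N" "num \<mu> [11, N, 0, 0] l = wpath (best \<mu> N 0 0) 0 + 1"
    using tr[OF order_refl c0 q0] by auto
  moreover have "wpath bs 0 \<le> wpath (best \<mu> N 0 0) 0" if bs: "bs \<in> paths nb N" for bs
  proof -
    have "wpath bs 0 + 1 \<le> num \<mu> [11, N, idx fA bs, 0] l"
      by (rule wpath_le[where v = "\<lambda>i p q. num \<mu> [11, i, p, q] l", OF _ _ bs order_refl q0])
        (simp add: v0, rule low)
    then show ?thesis using idx_full[OF bs] b(2) by simp
  qed
  ultimately show "best \<mu> N 0 0 \<in> paths nb N \<and> (\<forall>bs\<in>paths nb N. wpath bs 0 \<le> wpath (best \<mu> N 0 0) 0)" by blast
qed

lemma wp_backtrack: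
  assumes st: "static r \<mu>" and up: "max_upto N \<mu>"
  shows "wp inp V backtrack (\<lambda>r' \<mu>' t. t \<le> N \<and> r' 1 = n \<and>
    (\<forall>i<N. m \<le> E i \<longrightarrow> \<mu>' [0, E i - m] = 1 - rev (best \<mu> N 0 0) ! i)) r \<mu>"
proof -
  let ?bs = "best \<mu> N 0 0"
  have c0: "0 < cA N" using idx_bound[of "replicate N 0" N] pathsI[of "replicate N 0" N nb] by (fastforce simp: nb_def)
  have len: "length ?bs = N" using best_props(2)[OF up] length_paths by blast
  show ?thesis
    unfolding backtrack_def wp.simps(2,4)
  proof (intro conjI, goal_cases)
    case 3
    show ?case
    \<comment> \<open>After \<open>j\<close> steps, what is left of the optimal path is the trace
      from the pair in registers 17 and 18. The output so far covers the variables among the last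
      \<open>j\<close> elements.\<close>
    proof (rule wp_For[where T = 0 and I = "\<lambda>j r' \<mu>'. r' 17 < cA (N - j) \<and> r' 18 < cB j \<and>
      drop j ?bs = best \<mu> (N - j) (r' 17) (r' 18) \<and>
      (\<forall>d<j. m \<le> E (N - 1 - d) \<longrightarrow> \<mu>' [0, E (N - 1 - d) - m] = 1 - ?bs ! d)"], goal_cases)
      case 1
      then show ?case using staticD[OF st] V by simp
    next
      case (2 r')
      then show ?case using c0 cnt0 by simp
    next
      case (3 j r1 \<mu>1)
      have j: "j < N" using 3(1) staticD[OF st] by simp
      have st1: "static r1 \<mu>1"
        by (rule static_cong[OF st]) (use frame_reg[OF 3(4)] frame_mem[OF 3(4)] in auto)
      have m1: "\<mu>1 (a # ks) = \<mu> (a # ks)" if "a \<noteq> 0" for a ks using frame_mem[OF 3(4), of a ks] that by simp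
      define i where "i = N - 1 - j"
      have i: "i < N" "N - j = Suc i" "N - Suc j = i" "N - 1 - i = j" "N - 1 - j = i" using j unfolding i_def by auto
      define p where "p = r1 17"
      define q where "q = r1 18"
      define b where "b = \<mu> [12, Suc i, p, q]"
      define p' where "p' = \<mu> [13, Suc i, p, q]"
      have pq: "p < cA (Suc i)" "q < cB (N - 1 - i)" using 3(2) unfolding p_def q_def i(4) i(2)[symmetric] by blast+
      note at = max_step_attained[OF up i(1) pq, folded b_def p'_def]
      have b: "b < nb i" "p' < cA i" "b \<le> 1" using at by (auto simp: nb_def split: if_splits)
      have q': "fB j b q < cB (Suc j)" using FB[OF i(1) b(1) pq(2)] i(4) j by (simp add: i_def)
      have bt: "best \<mu> (Suc i) p q = b # best \<mu> i p' (fB (N - 1 - i) b q)"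
        unfolding best_def b_def p'_def track.simps ..
      have "drop j ?bs = best \<mu> (Suc i) p q"
        using 3(2) unfolding p_def[symmetric] q_def[symmetric] i(2) by blast
      then have bd: "drop j ?bs = b # best \<mu> i p' (fB j b q)" unfolding bt i(4) .
      have bj: "?bs ! j = b" "drop (Suc j) ?bs = best \<mu> i p' (fB j b q)"
        using bd Cons_nth_drop_Suc[of j ?bs] j len by auto
      have Ei: "E i < N" using E_less i by blast
      \<comment> \<open>Different variables have different output cells, so bits written earlier
        survive.\<close>
      have ne: "E (N - 1 - d) - m \<noteq> E i - m" if "d < j" "m \<le> E (N - 1 - d)" "m \<le> E i" for d
      proof
        assume "E (N - 1 - d) - m = E i - m"
        then have "E (N - 1 - d) = E i" using that by simp
        then have "N - 1 - d = i" using E_inj i(1) that(1) j by (auto dest!: inj_onD)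
        then show False using that(1) j unfolding i_def by simp
      qed
      have h: "\<mu>1 [12, Suc i, p, q] = b" "\<mu>1 [13, Suc i, p, q] = p'" "\<mu>1 [3, i] = E i"
        "\<mu>1 [10, j, b, q] = fB j b q"
        using m1[of 12] m1[of 13] staticD(5)[OF st1, of 3] staticD(5)[OF st1, of 10] E0[OF i(1)]
        by (simp_all add: b_def p'_def)
      have reg: "r1 4 - Suc j = i" "r1 2 = m" "r1 7 = j" using staticD[OF st1] 3(3) unfolding i_def by auto
      have bV: "b \<le> V" "p' \<le> V" "E i \<le> V" "fB j b q \<le> V" "i \<le> V" "Suc 0 - b \<le> V"
        using b K(1)[of i] K(2)[of "Suc j"] q' i j V Ei by auto
      have old: "\<And>d. d < j \<Longrightarrow> m \<le> E (N - 1 - d) \<Longrightarrow> \<mu>1 [0, E (N - 1 - d) - m] = 1 - ?bs ! d"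
        using 3(2) by blast
      show ?case
      proof (cases "E i < m")
        case True
        then have "\<forall>d<Suc j. m \<le> E (N - 1 - d) \<longrightarrow> \<mu>1 [0, E (N - 1 - d) - m] = 1 - ?bs ! d"
          using old i(5) by (auto simp: less_Suc_eq)
        then show ?thesis
          using True bV b q' bj by (simp add: reg h p_def[symmetric] q_def[symmetric] i(3))
      next
        case False
        have "\<forall>d<Suc j. m \<le> E (N - 1 - d) \<longrightarrow> (\<mu>1([0, E i - m] := Suc 0 - b)) [0, E (N - 1 - d) - m] = 1 - ?bs ! d"
          using old i(5) ne False bj(1) by (auto simp: less_Suc_eq simp del: diff_diff_left diff_Suc_eq_diff_pred)
        then show ?thesis
          using False bV b q' bj by (simp add: reg h p_def[symmetric] q_def[symmetric] i(3))
      qed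
    next
      case (4 r1 \<mu>1 t)
      have st1: "static r1 \<mu>1"
        by (rule static_cong[OF st]) (use frame_reg[OF 4(3)] frame_mem[OF 4(3)] in auto)
      have all: "\<forall>d<N. m \<le> E (N - 1 - d) \<longrightarrow> \<mu>1 [0, E (N - 1 - d) - m] = 1 - ?bs ! d"
        using 4(1) staticD(3)[OF st] by (simp del: diff_diff_left diff_Suc_eq_diff_pred)
      have "\<mu>1 [0, E i - m] = 1 - rev ?bs ! i" if "i < N" "m \<le> E i" for i
      proof -
        have "N - 1 - i < N" "N - 1 - (N - 1 - i) = i" using that by auto
        then have "\<mu>1 [0, E i - m] = 1 - ?bs ! (N - 1 - i)" using all that(2) by metis
        then show ?thesis using that len by (simp add: rev_nth)
      qed
      then show ?case using 4 staticD[OF st1] staticD[OF st] V N by simp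
    qed
  qed auto
qed

end

section \<open>Reading the input\<close>

definition seg :: "(nat \<Rightarrow> nat) \<Rightarrow> nat \<Rightarrow> nat list \<Rightarrow> bool" where
  "seg inp p xs \<longleftrightarrow> (\<forall>i<length xs. inp (p + i) = xs ! i)"

lemma seg_Nil [simp]: "seg inp p []"
  by (simp add: seg_def)

lemma seg_Cons [simp]: "seg inp p (x # xs) \<longleftrightarrow> inp p = x \<and> seg inp (Suc p) xs"
  unfolding seg_def by (auto simp: less_Suc_eq_0_disj)

lemma seg_append [simp]: "seg inp p (xs @ ys) \<longleftrightarrow> seg inp p xs \<and> seg inp (p + length xs) ys"
proof (induction xs arbitrary: p)
  case (Cons x xs)
  then show ?case by simp
qed simp

lemma seg_input_memory: "seg (input_memory ws) 1 ws"
  unfolding seg_def input_memory_def by simp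

lemma seg_nth: "seg inp p xs \<Longrightarrow> i < length xs \<Longrightarrow> inp (p + i) = xs ! i"
  by (simp add: seg_def)

subsection \<open>The decomposition tree\<close>

text \<open>A leaf takes two words, an inner node one, and there is one inner node fewer than
  leaves. Conversely, the length of a code reveals the number of leaves.\<close>

lemma length_encode_tree: "Suc (length (encode_tree g t)) = 3 * length (leaves t)"
  by (induction t) auto

lemma leaves_pos: "0 < length (leaves t)"
  by (induction t) auto

text \<open>The subtree that starts at the address in register 10 and ends before the address in register
  11 loses its topmost leaf.\<close>

definition peel :: "hexp \<Rightarrow> prog" where
  "peel pos = PIf (HInp ($10))
     (PIf (HInp ($10 \<oplus> HNum 1))
       ([HNum 3, pos] \<lhd> HInp ($11 \<ominus> HNum 1) ;; 10 ::= $10 \<oplus> HNum 1 ;; 11 ::= $11 \<ominus> HNum 2)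
       ([HNum 3, pos] \<lhd> HInp ($10 \<oplus> HNum 2) ;; 10 ::= $10 \<oplus> HNum 3))
     ([HNum 3, pos] \<lhd> HInp ($10 \<oplus> HNum 1))"

text \<open>Register 13 counts the subtrees that still have to be skipped.\<close>

definition skip_tree :: prog where
  "skip_tree = PIf ($13) (PIf (HInp ($12)) (13 ::= $13 \<oplus> HNum 1 ;; 12 ::= $12 \<oplus> HNum 1)
     (13 ::= $13 \<ominus> HNum 1 ;; 12 ::= $12 \<oplus> HNum 2)) PSkip"

text \<open>In preorder the right subtree starts where the left one ends, and this address must be
  found by skipping nodes. The left subtree is peeled from the top into descending positions, the
  right one into ascending positions, which produces \<open>leaf_order\<close>.\<close>

definition order_leaves :: prog where
  "order_leaves =
     (10 ::= $5 \<oplus> HNum 1 ;; 12 ::= $10 ;; 13 ::= HNum 1 ;;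
      PFor 8 (HNum 2 \<otimes> $4) skip_tree ;;
      14 ::= ($12 \<ominus> $10 \<oplus> HNum 1) \<oslash> HNum 3 ;; 11 ::= $12 ;;
      PFor 8 ($14) (peel ($14 \<ominus> HNum 1 \<ominus> $8)) ;;
      10 ::= $12 ;; 11 ::= $5 \<oplus> (HNum 3 \<otimes> $4 \<ominus> HNum 1) ;;
      PFor 8 ($4 \<ominus> $14) (peel ($14 \<oplus> $8)))"

definition read_tree :: prog where
  "read_tree = PIf (HInp ($5)) order_leaves
     ([HNum 3, HNum 0] \<lhd> HInp ($5 \<oplus> HNum 1)) ;;
     5 ::= $5 \<oplus> (HNum 3 \<otimes> $4 \<ominus> HNum 1)"

lemma mod_tree [simp]:
  "modr (peel pos) = {10, 11}" "modm (peel pos) = {3}" "wf_prog (peel pos)"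
  "modr skip_tree = {12, 13}" "modm skip_tree = {}" "wf_prog skip_tree"
  "modr order_leaves = {8, 10, 11, 12, 13, 14}" "modm order_leaves = {3}" "wf_prog order_leaves"
  "modr read_tree = {5, 8, 10, 11, 12, 13, 14}" "modm read_tree = {3}" "wf_prog read_tree"
  by (auto simp: peel_def skip_tree_def order_leaves_def read_tree_def)

lemma wp_peel:
  assumes t: "caterpillar t" "seg inp (r 10) (encode_tree g t)" "r 11 = r 10 + length (encode_tree g t)"
    and V: "r 11 + 3 \<le> V" "\<And>a. a \<in> set (leaves t) \<Longrightarrow> g a \<le> V"
  shows "wp inp V (peel pos) (\<lambda>r' \<mu>' u. u = 0 \<and> \<mu>' = \<mu>([3, hval inp pos r \<mu>] := g (hd (spine t))) \<and>
    (tl (spine t) \<noteq> [] \<longrightarrow> (\<exists>t'. caterpillar t' \<and> spine t' = tl (spine t) \<and> seg inp (r' 10) (encode_tree g t') \<and>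
       r' 11 = r' 10 + length (encode_tree g t') \<and> r' 11 \<le> r 11 \<and> set (leaves t') \<subseteq> set (leaves t)))) r \<mu>"
proof (cases t rule: spine.cases)
  case (1 a)
  then show ?thesis using t V by (simp add: peel_def)
next
  case (2 a r')
  have "hd (spine t) = a" "tl (spine t) = spine r'" "caterpillar r'" using 2 t(1) by auto
  moreover have "inp (r 10) = 1" "inp (Suc (r 10)) = 0" "inp (Suc (Suc (r 10))) = g a" "seg inp (r 10 + 3) (encode_tree g r')"
    "r 11 = r 10 + 3 + length (encode_tree g r')"
    using t(2,3) 2 by (auto simp: numeral_eq_Suc)
  ultimately show ?thesis using V 2
    by (auto simp: peel_def numeral_eq_Suc intro!: exI[of _ r'])
next
  case (3 l l' b)
  let ?n = "length (encode_tree g (Node l l'))"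
  have h: "hd (spine t) = b" "tl (spine t) = spine (Node l l')" "caterpillar (Node l l')" using 3 t(1) by auto
  have e: "encode_tree g t = 1 # encode_tree g (Node l l') @ [0, g b]" using 3 by simp
  have s: "inp (r 10) = 1" "seg inp (Suc (r 10)) (encode_tree g (Node l l'))" "inp (Suc (Suc (r 10 + ?n))) = g b"
    "r 11 = r 10 + ?n + 3"
    using t(2,3) unfolding e by (simp_all add: numeral_3_eq_3 del: encode_tree.simps)
  have "inp (Suc (r 10)) = 1" using s(2) by simp
  moreover have "inp (r 11 - 1) = g b" unfolding s(4) using s(3) by (simp add: numeral_3_eq_3 del: encode_tree.simps)
  ultimately show ?thesis using V 3 h s
    by (auto simp: peel_def intro!: exI[of _ "Node l l'"])
next
  case (4 l l' r r')
  then show ?thesis using t(1) by simp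
qed

text \<open>\<open>P\<close> is the position that receives the leaf peeled off at a given step; it
  runs downwards for the left spine and upwards for the right one.\<close>

lemma wp_peel_loop:
  assumes t: "caterpillar t" "seg inp (r 10) (encode_tree g t)" "r 11 = r 10 + length (encode_tree g t)"
    and V: "r 11 + 3 \<le> V" "\<And>a. a \<in> set (leaves t) \<Longrightarrow> g a \<le> V"
    and e: "hval inp e r \<mu> = length (leaves t)"
    and pos: "\<And>r' \<mu>' j. (\<And>x. x \<notin> {8, 10, 11} \<Longrightarrow> r' x = r x) \<Longrightarrow> r' 8 = j \<Longrightarrow> j < length (leaves t) \<Longrightarrow> hval inp pos r' \<mu>' = P j"
    and inj: "inj_on P {..<length (leaves t)}"
  shows "wp inp V (PFor 8 e (peel pos)) (\<lambda>r' \<mu>' u. u \<le> length (leaves t) \<and>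
    (\<forall>j<length (leaves t). \<mu>' [3, P j] = g (spine t ! j)) \<and>
    (\<forall>k. (\<forall>j<length (leaves t). k \<noteq> [3, P j]) \<longrightarrow> \<mu>' k = \<mu> k)) r \<mu>"
proof (rule wp_For[where T = 0 and I = "\<lambda>j r' \<mu>'. (\<forall>d<j. \<mu>' [3, P d] = g (spine t ! d)) \<and>
    (\<forall>k. (\<forall>d<j. k \<noteq> [3, P d]) \<longrightarrow> \<mu>' k = \<mu> k) \<and>
    (drop j (spine t) \<noteq> [] \<longrightarrow> (\<exists>t'. caterpillar t' \<and> spine t' = drop j (spine t) \<and> seg inp (r' 10) (encode_tree g t') \<and>
       r' 11 = r' 10 + length (encode_tree g t') \<and> r' 11 \<le> r 11 \<and> set (leaves t') \<subseteq> set (leaves t)))"], goal_cases)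
  case 1
  show ?case using V t(3) length_encode_tree[of g t] leaves_pos[of t] unfolding e by linarith
next
  case (2 r')
  have "r' 10 = r 10" "r' 11 = r 11" using 2(1) by simp_all
  then show ?case using t by (auto intro!: exI[of _ t])
next
  case (3 j r' \<mu>')
  have r': "r' x = r x" if "x \<notin> {8, 10, 11}" for x using frame_reg[OF 3(4), of x] that by simp
  have j: "j < length (leaves t)" "length (spine t) = length (leaves t)" using 3(1) e set_spine[OF t(1)] by auto
  then have "drop j (spine t) \<noteq> []" by simp
  then obtain t' where t': "caterpillar t'" "spine t' = drop j (spine t)" "seg inp (r' 10) (encode_tree g t')"
     "r' 11 = r' 10 + length (encode_tree g t')" "r' 11 \<le> r 11" "set (leaves t') \<subseteq> set (leaves t)"
    using 3(2) by blast
  have p: "hval inp pos r' \<mu>' = P j" using r' 3(3) j by (intro pos) auto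
  have "hd (spine t') = spine t ! j" "tl (spine t') = drop (Suc j) (spine t)"
    unfolding t'(2) using j by (simp_all add: hd_drop_conv_nth drop_Suc tl_drop)
  then have hd: "hd (spine t') = spine t ! j" "tl (spine t') = drop (Suc j) (spine t)" by auto
  have ne: "P d \<noteq> P j" if "d < j" for d using inj j that by (auto simp: inj_on_def)
  have "r' 11 + 3 \<le> V" using t'(5) V(1) by linarith
  from wp_peel[where pos = pos and \<mu> = \<mu>', OF t'(1,3,4) this] have w: "wp inp V (peel pos) (\<lambda>r'' \<mu>'' u. u = 0 \<and>
     \<mu>'' = \<mu>'([3, P j] := g (spine t ! j)) \<and>
    (drop (Suc j) (spine t) \<noteq> [] \<longrightarrow> (\<exists>t''. caterpillar t'' \<and> spine t'' = drop (Suc j) (spine t) \<and> seg inp (r'' 10) (encode_tree g t'') \<and>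
       r'' 11 = r'' 10 + length (encode_tree g t'') \<and> r'' 11 \<le> r' 11 \<and> set (leaves t'') \<subseteq> set (leaves t')))) r' \<mu>'"
    unfolding p hd using V(2) t'(6) by blast
  show ?case
  proof (rule wp_mono[OF w], goal_cases)
    case (1 r'' \<mu>'' u)
    have m: "\<mu>'' = \<mu>'([3, P j] := g (spine t ! j))" using 1 by blast
    have "(\<forall>d<Suc j. \<mu>'' [3, P d] = g (spine t ! d)) \<and> (\<forall>k. (\<forall>d<Suc j. k \<noteq> [3, P d]) \<longrightarrow> \<mu>'' k = \<mu> k)"
      unfolding m using 3(2) ne by (auto simp: less_Suc_eq)
    moreover have "\<exists>t''. caterpillar t'' \<and> spine t'' = drop (Suc j) (spine t) \<and> seg inp (r'' 10) (encode_tree g t'') \<and>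
       r'' 11 = r'' 10 + length (encode_tree g t'') \<and> r'' 11 \<le> r 11 \<and> set (leaves t'') \<subseteq> set (leaves t)"
      if dr: "drop (Suc j) (spine t) \<noteq> []"
    proof -
      obtain t'' where "caterpillar t''" "spine t'' = drop (Suc j) (spine t)" "seg inp (r'' 10) (encode_tree g t'')"
       "r'' 11 = r'' 10 + length (encode_tree g t'')" "r'' 11 \<le> r' 11" "set (leaves t'') \<subseteq> set (leaves t')"
        using 1 dr by blast
      then show ?thesis using t'(5,6) by (intro exI[of _ t'']) auto
    qed
    ultimately show ?case using 1 by auto
  qed
next
  case (4 r' \<mu>' u)
  then show ?case unfolding e by simp
qed

fun node_count :: "'a btree \<Rightarrow> nat" where
  "node_count (Leaf a) = 1"
| "node_count (Node l r) = 1 + node_count l + node_count r"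

lemma node_count_leaves: "Suc (node_count t) = 2 * length (leaves t)"
  by (induction t) auto

text \<open>The invariant describes the unread rest of the tree as a forest \<open>ts\<close>: an
  inner node replaces its tree by the two children, a leaf removes it. Each round consumes one node
  until none is left, so \<open>2 * r 4\<close> rounds suffice and surplus rounds do
  nothing.\<close>

lemma wp_skip_loop:
  assumes t: "seg inp (r 12) (encode_tree g t)" "r 13 = 1" "node_count t \<le> 2 * r 4"
    and V: "r 12 + length (encode_tree g t) + 2 * r 4 + 3 \<le> V"
  shows "wp inp V (PFor 8 (HNum 2 \<otimes> $4) skip_tree) (\<lambda>r' \<mu>' u. u \<le> 2 * r 4 \<and> r' 12 = r 12 + length (encode_tree g t)) r \<mu>"
proof (rule wp_For[where T = 0 and I = "\<lambda>j r' \<mu>'. r' 13 \<le> Suc j \<and> (\<exists>ts. r' 13 = length ts \<and> seg inp (r' 12) (concat (map (encode_tree g) ts)) \<and>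
    r' 12 + length (concat (map (encode_tree g) ts)) = r 12 + length (encode_tree g t) \<and>
    sum_list (map node_count ts) \<le> node_count t - j)"], goal_cases)
  case 1
  then show ?case using V by simp
next
  case (2 r')
  have "r' 12 = r 12" "r' 13 = r 13" using 2(1) by simp_all
  then show ?case using t by (auto intro!: exI[of _ "[t]"])
next
  case (3 j r' \<mu>')
  then obtain ts where ts: "r' 13 = length ts" "seg inp (r' 12) (concat (map (encode_tree g) ts))"
    "r' 12 + length (concat (map (encode_tree g) ts)) = r 12 + length (encode_tree g t)"
    "sum_list (map node_count ts) \<le> node_count t - j"
    by blast
  have le: "r' 13 \<le> Suc j" "j < 2 * r 4" using 3 by auto
  show ?case
  proof (cases ts)
    case Nil
    then show ?thesis using ts le unfolding skip_tree_def by (auto intro!: exI[of _ "[]"])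
  next
    case (Cons u us)
    show ?thesis
    proof (cases u)
      case (Leaf a)
      have "seg inp (r' 12 + 2) (concat (map (encode_tree g) us))" using ts(2) Cons Leaf by (simp add: numeral_eq_Suc)
      then show ?thesis using ts le V Cons Leaf unfolding skip_tree_def by (auto intro!: exI[of _ us])
    next
      case (Node x y)
      then show ?thesis using ts le V Cons unfolding skip_tree_def
        by (auto intro!: exI[of _ "x # y # us"])
    qed
  qed
next
  case (4 r' \<mu>' u)
  then obtain ts where ts: "r' 12 + length (concat (map (encode_tree g) ts)) = r 12 + length (encode_tree g t)"
    "sum_list (map node_count ts) \<le> 0"
    using t(3) by auto
  have "ts = []"
  proof (cases ts)
    case (Cons u us)
    then show ?thesis using ts(2) by (cases u) auto
  qed
  then show ?case using ts(1) 4 by simp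
qed

lemma wp_read_tree:
  assumes D: "linear_decomposition D" "seg inp (r 5) (encode_tree g D)" "r 4 = length (leaves D)"
    and V: "r 5 + 6 * r 4 + 6 \<le> V" "\<And>a. a \<in> set (leaves D) \<Longrightarrow> g a \<le> V"
  shows "wp inp V read_tree (\<lambda>r' \<mu>' t. t \<le> 3 * r 4 \<and> (\<forall>i<r 4. \<mu>' [3, i] = g (leaf_order D ! i)) \<and>
    r' 5 = r 5 + length (encode_tree g D)) r \<mu>"
proof (cases D)
  case (Leaf a)
  have "inp (Suc (r 5)) = g a" using D(2) Leaf by simp
  then show ?thesis using D V Leaf by (simp add: read_tree_def)
next
  case (Node l t)
  let ?nl = "length (leaves l)" and ?nt = "length (leaves t)"
  let ?el = "length (encode_tree g l)" and ?et = "length (encode_tree g t)"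
  have c: "caterpillar l" "caterpillar t" using caterpillar_children D(1) Node by auto
  have s: "inp (r 5) = 1" "seg inp (Suc (r 5)) (encode_tree g l)" "seg inp (Suc (r 5) + ?el) (encode_tree g t)"
    using D(2) Node by auto
  have N: "r 4 = ?nl + ?nt" using D(3) Node by simp
  have len: "Suc ?el = 3 * ?nl" "Suc ?et = 3 * ?nt" "0 < ?nl" "0 < ?nt"
    using length_encode_tree[of g l] length_encode_tree[of g t] leaves_pos[of l] leaves_pos[of t] by simp_all
  have sp: "length (spine l) = ?nl" "length (spine t) = ?nt" using set_spine c by auto
  have eD: "length (encode_tree g D) = 3 * r 4 - 1" using length_encode_tree[of g D] D(3) by simp
  let ?p = "Suc (r 5)"
  have nc: "node_count l \<le> 2 * r 4" using node_count_leaves[of l] N by simp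
  let ?r1 = "r(10 := ?p, 12 := ?p, 13 := 1)"
  have w1: "wp inp V (PFor 8 (HNum 2 \<otimes> $4) skip_tree) (\<lambda>r' \<mu>' u. u \<le> 2 * ?r1 4 \<and> r' 12 = ?r1 12 + ?el) ?r1 \<mu>"
    using s(2) nc V N len by (intro wp_skip_loop) auto
  have w2: "wp inp V order_leaves
     (\<lambda>r' \<mu>' u. u \<le> 3 * r 4 \<and> (\<forall>i<r 4. \<mu>' [3, i] = g (leaf_order D ! i)) \<and> r' 4 = r 4 \<and> r' 5 = r 5) r \<mu>"
  proof -
    have "wp inp V (PFor 8 (HNum 2 \<otimes> $4) skip_tree) (\<lambda>r1 \<mu>1 u1. wp inp V
      (14 ::= ($12 \<ominus> $10 \<oplus> HNum 1) \<oslash> HNum 3 ;; 11 ::= $12 ;;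
      PFor 8 ($14) (peel ($14 \<ominus> HNum 1 \<ominus> $8)) ;;
      10 ::= $12 ;; 11 ::= $5 \<oplus> (HNum 3 \<otimes> $4 \<ominus> HNum 1) ;;
      PFor 8 ($4 \<ominus> $14) (peel ($14 \<oplus> $8)))
      (\<lambda>r' \<mu>' u. u1 + u \<le> 3 * r 4 \<and> (\<forall>i<r 4. \<mu>' [3, i] = g (leaf_order D ! i)) \<and> r' 4 = r 4 \<and> r' 5 = r 5) r1 \<mu>1) ?r1 \<mu>"
    proof (rule wp_mono[OF wp_frame[OF w1]], goal_cases)
      case (1 r1 \<mu>1 u1)
      have r1: "r1 4 = r 4" "r1 5 = r 5" "r1 10 = ?p" "r1 12 = ?p + ?el" and u1: "u1 \<le> 2 * r 4"
        using 1 by (auto simp: frame_def)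
      \<comment> \<open>The left subtree with \<open>?nl\<close> leaves occupies
        \<open>3 * ?nl - 1\<close> words.\<close>
      have d3: "Suc (r1 12 - r1 10) div 3 = ?nl" using r1 len by simp
      let ?r2 = "r1(14 := ?nl, 11 := ?p + ?el)"
      have w3: "wp inp V (PFor 8 ($14) (peel ($14 \<ominus> HNum 1 \<ominus> $8))) (\<lambda>r' \<mu>' u. u \<le> ?nl \<and>
         (\<forall>j<?nl. \<mu>' [3, ?nl - 1 - j] = g (spine l ! j)) \<and> (\<forall>k. (\<forall>j<?nl. k \<noteq> [3, ?nl - 1 - j]) \<longrightarrow> \<mu>' k = \<mu>1 k)) ?r2 \<mu>1"
        using c(1) s(2) r1 V N len Node by (intro wp_peel_loop) (auto simp: inj_on_def)
      have "wp inp V (PFor 8 ($14) (peel ($14 \<ominus> HNum 1 \<ominus> $8))) (\<lambda>r3 \<mu>3 u3. wp inp V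
        (10 ::= $12 ;; 11 ::= $5 \<oplus> (HNum 3 \<otimes> $4 \<ominus> HNum 1) ;; PFor 8 ($4 \<ominus> $14) (peel ($14 \<oplus> $8)))
        (\<lambda>r' \<mu>' u. u1 + (u3 + u) \<le> 3 * r 4 \<and> (\<forall>i<r 4. \<mu>' [3, i] = g (leaf_order D ! i)) \<and> r' 4 = r 4 \<and> r' 5 = r 5) r3 \<mu>3) ?r2 \<mu>1"
      proof (rule wp_mono[OF wp_frame[OF w3]], goal_cases)
        case (1 r3 \<mu>3 u3)
        have r3: "r3 4 = r 4" "r3 5 = r 5" "r3 12 = ?p + ?el" "r3 14 = ?nl"
          using 1 r1 by (auto simp: frame_def)
        have u3: "u3 \<le> ?nl" and m3: "\<forall>j<?nl. \<mu>3 [3, ?nl - 1 - j] = g (spine l ! j)" using 1 by auto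
        have e3: "r 5 + (3 * r 4 - Suc 0) = ?p + ?el + ?et" using N len by simp
        let ?r4 = "r3(10 := ?p + ?el, 11 := ?p + ?el + ?et)"
        have w5: "wp inp V (PFor 8 ($4 \<ominus> $14) (peel ($14 \<oplus> $8))) (\<lambda>r' \<mu>' u. u \<le> ?nt \<and>
           (\<forall>j<?nt. \<mu>' [3, ?nl + j] = g (spine t ! j)) \<and> (\<forall>k. (\<forall>j<?nt. k \<noteq> [3, ?nl + j]) \<longrightarrow> \<mu>' k = \<mu>3 k)) ?r4 \<mu>3"
          using c(2) s(3) r3 V N len Node by (intro wp_peel_loop) (auto simp: inj_on_def)
        have "wp inp V (PFor 8 ($4 \<ominus> $14) (peel ($14 \<oplus> $8))) (\<lambda>r' \<mu>' u. u1 + (u3 + u) \<le> 3 * r 4 \<and>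
            (\<forall>i<r 4. \<mu>' [3, i] = g (leaf_order D ! i)) \<and> r' 4 = r 4 \<and> r' 5 = r 5) ?r4 \<mu>3"
        proof (rule wp_mono[OF wp_frame[OF w5]], goal_cases)
          case (1 r5 \<mu>5 u5)
          have "\<mu>5 [3, i] = g (leaf_order D ! i)" if "i < r 4" for i
          proof (cases "i < ?nl")
            case True
            have "\<mu>5 [3, i] = \<mu>3 [3, i]" using 1 True by auto
            also have "\<dots> = g (spine l ! (?nl - 1 - i))" using m3[rule_format, of "?nl - 1 - i"] True by simp
            finally show ?thesis using True Node sp by (simp add: nth_append rev_nth)
          next
            case False
            then have "i - ?nl < ?nt" "?nl + (i - ?nl) = i" using N that by auto
            moreover have "\<forall>j<?nt. \<mu>5 [3, ?nl + j] = g (spine t ! j)" using 1 by blast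
            ultimately have "\<mu>5 [3, i] = g (spine t ! (i - ?nl))" by metis
            then show ?thesis using False Node sp by (simp add: nth_append)
          qed
          moreover have "r5 4 = r 4" "r5 5 = r 5" using 1 r3 by (auto simp: frame_def)
          ultimately show ?case using 1 u1 u3 N by simp
        qed
        then show ?case using r3 e3 V N len by (simp add: algebra_simps)
      qed
      then show ?case using r1 d3 V N len by simp
    qed
    then show ?thesis using V unfolding order_leaves_def by simp
  qed
  have "wp inp V order_leaves (\<lambda>r' \<mu>' t. r' 5 + (3 * r' 4 - Suc 0) \<le> V \<and> t \<le> 3 * r 4 \<and>
      (\<forall>i<r 4. \<mu>' [3, i] = g (leaf_order D ! i)) \<and> r' 5 + (3 * r' 4 - Suc 0) = r 5 + length (encode_tree g D)) r \<mu>"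
    using V eD by (intro wp_mono[OF w2]) auto
  then show ?thesis using s(1) by (simp add: read_tree_def)
qed

subsection \<open>Formula and weights\<close>

definition read_head :: prog where
  "read_head = 2 ::= HInp (HNum 1) ;; 3 ::= HInp (HNum 2) ;; 4 ::= $2 \<oplus> $3 ;; 5 ::= HNum 3"

text \<open>A literal code splits into the variable, its half, and the sign, its parity. The parity
  coincides with the branch that makes the literal true, so it serves as index directly.\<close>

definition read_clauses :: prog where
  "read_clauses = PFor 6 ($2) (7 ::= HInp ($5) ;; 5 ::= $5 \<oplus> HNum 1 ;;
     PFor 8 ($7) (9 ::= HInp ($5) ;;
       [HNum 2, $2 \<oplus> ($9 \<oslash> HNum 2), $9 \<ominus> HNum 2 \<otimes> ($9 \<oslash> HNum 2), $6] \<lhd> HNum 1 ;;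
       5 ::= $5 \<oplus> HNum 1))"

text \<open>Entries are at most \<open>m + 1\<close>, which fits into \<open>m + 2\<close>
  bits.\<close>

definition unit_weights :: prog where
  "unit_weights = PFor 6 ($2) ([HNum 14, $6, HNum 0] \<lhd> HNum 1) ;; 25 ::= $2 \<oplus> HNum 2"

text \<open>Register 29 holds the maximal length of a weight.\<close>

definition read_weights :: prog where
  "read_weights = 29 ::= HNum 0 ;; PFor 6 ($2) (7 ::= HInp ($5) ;; 5 ::= $5 \<oplus> HNum 1 ;;
     29 ::= $29 \<oplus> ($7 \<ominus> $29) ;;
     PFor 8 ($7) ([HNum 14, $6, $8] \<lhd> HInp ($5) ;; 5 ::= $5 \<oplus> HNum 1)) ;;
     25 ::= $29 \<oplus> $2 \<oplus> HNum 1"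

definition positions :: prog where
  "positions = PFor 15 ($4) ([HNum 4, HGet [HNum 3, $15]] \<lhd> $15)"

lemma mod_read [simp]:
  "modr read_head = {2, 3, 4, 5}" "modm read_head = {}" "wf_prog read_head"
  "modr read_clauses = {5, 6, 7, 8, 9}" "modm read_clauses = {2}" "wf_prog read_clauses"
  "modr unit_weights = {6, 25}" "modm unit_weights = {14}" "wf_prog unit_weights"
  "modr read_weights = {5, 6, 7, 8, 25, 29}" "modm read_weights = {14}" "wf_prog read_weights"
  "modr positions = {15}" "modm positions = {4}" "wf_prog positions"
  by (auto simp: read_head_def read_clauses_def unit_weights_def read_weights_def positions_def)

lemma seg_concat:
  assumes "seg inp p (concat (map f [0..<m]))" "c < m"
  shows "seg inp (p + length (concat (map f [0..<c]))) (f c)"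
proof -
  have "[0..<m] = [0..<c] @ c # [Suc c..<m]" 
    using upt_add_eq_append[of 0 c "m - c"] upt_conv_Cons[OF assms(2)] assms(2) by simp
  then show ?thesis using assms(1) by simp
qed

lemma length_concat_le: "c \<le> m \<Longrightarrow> length (concat (map f [0..<c])) \<le> length (concat (map f [0..<m]))"
proof -
  assume "c \<le> m"
  then have "[0..<m] = [0..<c] @ [c..<m]" using upt_add_eq_append[of 0 c "m - c"] by simp
  then show ?thesis by simp
qed

definition hit :: "nat \<Rightarrow> nat list \<Rightarrow> nat \<Rightarrow> nat \<Rightarrow> bool" where
  "hit m xs e b \<longleftrightarrow> (\<exists>x\<in>set xs. e = m + x div 2 \<and> b = x mod 2)"

lemma hit_take_Suc: "j < length xs \<Longrightarrow>
    hit m (take (Suc j) xs) e b \<longleftrightarrow> hit m (take j xs) e b \<or> e = m + xs ! j div 2 \<and> b = xs ! j mod 2"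
  by (auto simp: hit_def take_Suc_conv_app_nth)

text \<open>Every clause is charged the uniform length \<open>S\<close>. With \<open>S = s\<close>
  this gives about \<open>m * s\<close>, crude but within the time bound.\<close>

lemma wp_read_clauses:
  assumes s: "seg inp (r 5) (concat (map (\<lambda>c. length (f c) # f c) [0..<m]))" and r: "r 2 = m"
    and z: "\<And>ks. \<mu> (2 # ks) = 0"
    and V: "r 5 + length (concat (map (\<lambda>c. length (f c) # f c) [0..<m])) + m + 2 \<le> V"
      "\<And>c x. c < m \<Longrightarrow> x \<in> set (f c) \<Longrightarrow> x \<le> V"
    and S: "\<And>c. c < m \<Longrightarrow> length (f c) \<le> S"
  shows "wp inp V read_clauses (\<lambda>r' \<mu>' t. t \<le> m * Suc S \<and>
    r' 5 = r 5 + length (concat (map (\<lambda>c. length (f c) # f c) [0..<m])) \<and>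
    (\<forall>e b c. \<mu>' [2, e, b, c] = of_bool (c < m \<and> hit m (f c) e b))) r \<mu>"
  unfolding read_clauses_def
proof (rule wp_For[where T = S and I = "\<lambda>c r' \<mu>'.
    r' 5 = r 5 + length (concat (map (\<lambda>c. length (f c) # f c) [0..<c])) \<and>
    (\<forall>e b c'. \<mu>' [2, e, b, c'] = of_bool (c' < c \<and> hit m (f c') e b))"], goal_cases)
  case 1
  then show ?case using V r by simp
next
  case (2 r')
  then show ?case using z by simp
next
  case (3 c r1 \<mu>1)
  have c: "c < m" using 3(1) r by simp
  have r1: "r1 2 = m" using frame_reg[OF 3(4), of 2] r by simp
  let ?p = "r 5 + length (concat (map (\<lambda>c. length (f c) # f c) [0..<c]))"
  have sc: "inp ?p = length (f c)" "seg inp (Suc ?p) (f c)" using seg_concat[OF s c] by auto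
  have le: "?p + Suc (length (f c)) \<le> r 5 + length (concat (map (\<lambda>c. length (f c) # f c) [0..<m]))"
    using length_concat_le[of "Suc c" m "\<lambda>c. length (f c) # f c"] c by simp
  have r15: "r1 5 = ?p" using 3(2) by blast
  let ?r2 = "r1(7 := length (f c), 5 := Suc ?p)"
  have "wp inp V (PFor 8 ($7) (9 ::= HInp ($5) ;;
       [HNum 2, $2 \<oplus> ($9 \<oslash> HNum 2), $9 \<ominus> HNum 2 \<otimes> ($9 \<oslash> HNum 2), $6] \<lhd> HNum 1 ;;
       5 ::= $5 \<oplus> HNum 1)) (\<lambda>r' \<mu>' t. t \<le> S \<and> r' 5 = Suc ?p + length (f c) \<and>
         (\<forall>e b c'. \<mu>' [2, e, b, c'] = of_bool (c' < Suc c \<and> hit m (f c') e b))) ?r2 \<mu>1"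
  proof (rule wp_For[where T = 0 and I = "\<lambda>j r' \<mu>'. r' 5 = Suc ?p + j \<and> (\<forall>e b c'. \<mu>' [2, e, b, c'] =
       of_bool (c' < c \<and> hit m (f c') e b \<or> c' = c \<and> hit m (take j (f c)) e b))"], goal_cases)
    case 1
    then show ?case using V le by simp
  next
    case (2 r')
    then show ?case using 3(2) by (auto simp: hit_def)
  next
    case (3 j r3 \<mu>3)
    have j: "j < length (f c)" using 3(1) by simp
    have r3: "r3 2 = m" "r3 6 = c"
      using frame_reg[OF 3(4), of 2] frame_reg[OF 3(4), of 6] r1 \<open>r1 6 = c\<close> by simp_all
    have i: "inp (r3 5) = f c ! j" using seg_nth[OF sc(2) j] 3(2) by simp
    have x: "f c ! j \<le> V" using V(2) c j by simp
    have k: "f c ! j - 2 * (f c ! j div 2) = f c ! j mod 2" by (simp add: minus_mult_div_eq_mod)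
    have m3: "\<mu>3 [2, e, b, c'] = of_bool (c' < c \<and> hit m (f c') e b \<or> c' = c \<and> hit m (take j (f c)) e b)" for e b c'
      using 3(2) by blast
    have r35: "r3 5 = Suc ?p + j" using 3(2) by blast
    let ?x = "f c ! j"
    have mem: "(\<mu>3([2, m + ?x div 2, ?x mod 2, c] := 1)) [2, e, b, c'] =
        of_bool (c' < c \<and> hit m (f c') e b \<or> c' = c \<and> hit m (take (Suc j) (f c)) e b)" for e b c'
      unfolding hit_take_Suc[OF j] fun_upd_apply m3 by auto
    have "Suc (r3 5) \<le> V" "1 \<le> V" using V(1) le j r35 by auto
    then have "wp inp V (9 ::= HInp ($5) ;;
       [HNum 2, $2 \<oplus> ($9 \<oslash> HNum 2), $9 \<ominus> HNum 2 \<otimes> ($9 \<oslash> HNum 2), $6] \<lhd> HNum 1 ;; 5 ::= $5 \<oplus> HNum 1)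
       (\<lambda>r' \<mu>' t. t = 0 \<and> r' 5 = Suc (r3 5) \<and> \<mu>' = \<mu>3([2, m + ?x div 2, ?x mod 2, c] := 1)) r3 \<mu>3"
      using x by (simp add: r3 i k)
    then show ?case
      by (rule wp_mono) (use r35 mem in \<open>simp del: fun_upd_apply add: fun_upd_other\<close>)
  next
    case (4 r3 \<mu>3 t)
    have "\<mu>3 [2, e, b, c'] = of_bool (c' < Suc c \<and> hit m (f c') e b)" for e b c'
      using 4(1) by (auto simp: less_Suc_eq)
    then show ?case using 4(1,4) S[OF c] by simp
  qed
  then show ?case using r15 sc(1) V(1) le by (simp add: add.assoc)
next
  case (4 r' \<mu>' t)
  then show ?case using r by simp
qed

lemma wp_unit_weights:
  assumes r: "r 2 = m" and z: "\<And>ks. \<mu> (14 # ks) = 0" and V: "m + 2 \<le> V"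
  shows "wp inp V unit_weights (\<lambda>r' \<mu>' t. t \<le> m \<and> r' 25 = m + 2 \<and>
    (\<forall>c<m. isbits \<mu>' [14, c] (m + 2) \<and> num \<mu>' [14, c] (m + 2) = 1)) r \<mu>"
  unfolding unit_weights_def wp.simps(4)
proof (rule wp_For[where T = 0 and I = "\<lambda>c r' \<mu>'. r' 2 = m \<and> (\<forall>c' j. \<mu>' [14, c', j] = of_bool (c' < c \<and> j = 0))"], goal_cases)
  case (4 r' \<mu>' t)
  have m': "\<mu>' [14, c', j] = of_bool (c' < m \<and> j = 0)" for c' j using 4(1) r by simp
  have "isbits \<mu>' [14, c] (m + 2) \<and> num \<mu>' [14, c] (m + 2) = 1" if "c < m" for c
  proof -
    have "num \<mu>' [14, c] (m + 2) = (\<Sum>j\<in>{0}. \<mu>' ([14, c] @ [j]) * 2 ^ j)"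
      unfolding num_def by (intro sum.mono_neutral_right) (auto simp: m')
    then show ?thesis using that by (simp add: isbits_def m')
  qed
  then show ?case using 4 r V by simp
qed (use r z V in \<open>auto simp: less_Suc_eq\<close>)

lemma binary_0 [simp]: "binary 0 = []"
  by (simp add: binary.simps)

lemma binary_pos: "0 < n \<Longrightarrow> binary n = n mod 2 # binary (n div 2)"
  by (subst binary.simps) simp

lemma binary_bits: "x \<in> set (binary n) \<Longrightarrow> x \<le> 1"
proof (induction n rule: binary.induct)
  case (1 n)
  then show ?case by (cases "n = 0") (auto simp: binary_pos)
qed

lemma binary_value: "(\<Sum>j<length (binary n). binary n ! j * 2 ^ j) = n"
proof (induction n rule: binary.induct)
  case (1 n)
  show ?case
  proof (cases "n = 0")
    case False
    have "(\<Sum>j<length (binary n). binary n ! j * 2 ^ j) =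
        n mod 2 + (\<Sum>j<length (binary (n div 2)). binary (n div 2) ! j * 2 ^ Suc j)"
      using False by (simp add: binary_pos sum.lessThan_Suc_shift del: sum.lessThan_Suc)
    also have "(\<Sum>j<length (binary (n div 2)). binary (n div 2) ! j * 2 ^ Suc j) =
        2 * (\<Sum>j<length (binary (n div 2)). binary (n div 2) ! j * 2 ^ j)"
      by (simp add: sum_distrib_left mult.left_commute)
    also have "\<dots> = 2 * (n div 2)" using 1[OF False] by simp
    finally show ?thesis by simp
  qed simp
qed

lemma length_binary: "n < 2 ^ e \<Longrightarrow> length (binary n) \<le> e"
proof (induction e arbitrary: n)
  case (Suc e)
  then show ?case using Suc.IH[of "n div 2"] by (cases "n = 0") (auto simp: binary_pos)
qed simp

lemma wp_read_weights:
  assumes s: "seg inp (r 5) (concat (map (\<lambda>c. length (binary (f c)) # binary (f c)) [0..<m]))" and r: "r 2 = m"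
    and z: "\<And>ks. \<mu> (14 # ks) = 0"
    and V: "r 5 + length (concat (map (\<lambda>c. length (binary (f c)) # binary (f c)) [0..<m])) + m + S + 2 \<le> V"
    and S: "\<And>c. c < m \<Longrightarrow> length (binary (f c)) \<le> S"
  shows "wp inp V read_weights (\<lambda>r' \<mu>' t. t \<le> m * Suc S \<and> (\<exists>l. r' 25 = l + m + 1 \<and> l \<le> S \<and>
    (\<forall>c<m. length (binary (f c)) \<le> l \<and> isbits \<mu>' [14, c] (l + m + 1) \<and> num \<mu>' [14, c] (l + m + 1) = f c))) r \<mu>"
  unfolding read_weights_def wp.simps(2,4)
proof (intro conjI, goal_cases)
  case 2
  let ?h = "\<lambda>c. length (binary (f c)) # binary (f c)"
  let ?J = "\<lambda>c r' \<mu>'. r' 5 = r 5 + length (concat (map ?h [0..<c])) \<and> r' 29 \<le> S \<and> (\<forall>c'<c. length (binary (f c')) \<le> r' 29) \<and>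
    (\<forall>c' j. \<mu>' [14, c', j] = (if c' < c \<and> j < length (binary (f c')) then binary (f c') ! j else 0))"
  show ?case
  proof (rule wp_For[where T = S and I = ?J], goal_cases)
    case 1
    then show ?case using V r by simp
  next
    case (2 r')
    then show ?case using z by simp
  next
    case (3 c r1 \<mu>1)
    have c: "c < m" using 3(1) r by simp
    let ?p = "r 5 + length (concat (map ?h [0..<c]))"
    let ?b = "binary (f c)"
    have sc: "inp ?p = length ?b" "seg inp (Suc ?p) ?b" using seg_concat[OF s c] by auto
    have le: "?p + Suc (length ?b) \<le> r 5 + length (concat (map ?h [0..<m]))"
      using length_concat_le[of "Suc c" m ?h] c by simp
    have r15: "r1 5 = ?p" and r29: "r1 29 \<le> S" "\<forall>c'<c. length (binary (f c')) \<le> r1 29" using 3(2) by blast+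
    \<comment> \<open>With truncated subtraction, \<open>x + (y - x)\<close> is the maximum of
      \<open>x\<close> and \<open>y\<close>.\<close>
    let ?r2 = "r1(7 := length ?b, 5 := Suc ?p, 29 := r1 29 + (length ?b - r1 29))"
    have "wp inp V (PFor 8 ($7) ([HNum 14, $6, $8] \<lhd> HInp ($5) ;; 5 ::= $5 \<oplus> HNum 1))
      (\<lambda>r' \<mu>' t. t \<le> S \<and> r' 5 = Suc ?p + length ?b \<and> r' 29 = r1 29 + (length ?b - r1 29) \<and>
         (\<forall>c' j. \<mu>' [14, c', j] = (if c' < Suc c \<and> j < length (binary (f c')) then binary (f c') ! j else 0))) ?r2 \<mu>1"
    proof (rule wp_For[where T = 0 and I = "\<lambda>d r' \<mu>'. r' 5 = Suc ?p + d \<and> (\<forall>c' j. \<mu>' [14, c', j] =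
        (if c' < c \<and> j < length (binary (f c')) \<or> c' = c \<and> j < d then binary (f c') ! j else 0))"], goal_cases)
      case 1
      then show ?case using V le by simp
    next
      case (2 r')
      then show ?case using 3(2) by auto
    next
      case (3 d r3 \<mu>3)
      have d: "d < length ?b" using 3(1) by simp
      have r3: "r3 6 = c" using frame_reg[OF 3(4), of 6] \<open>r1 6 = c\<close> by simp
      have r35: "r3 5 = Suc ?p + d" using 3(2) by blast
      have i: "inp (Suc ?p + d) = ?b ! d" by (rule seg_nth[OF sc(2) d])
      have "?b ! d \<in> set ?b" using d by simp
      then have x: "?b ! d \<le> V" using binary_bits[of "?b ! d" "f c"] V by linarith
      show ?case using 3(2,3) V le d x i[unfolded r35[symmetric]] by (auto simp: r3 less_Suc_eq)
    next
      case (4 r3 \<mu>3 t)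
      have "\<mu>3 [14, c', j] = (if c' < Suc c \<and> j < length (binary (f c')) then binary (f c') ! j else 0)" for c' j
        using 4(1) by (auto simp: less_Suc_eq)
      moreover have "r3 29 = r1 29 + (length ?b - r1 29)" using frame_reg[OF 4(3), of 29] by simp
      ultimately show ?case using 4(1,4) S[OF c] by simp
    qed
    moreover have "r1 29 + (length ?b - r1 29) \<le> S" using r29 S[OF c] by simp
    ultimately show ?case using r15 sc(1) V le r29 S[OF c]
      by (simp add: add.assoc) (erule wp_mono, auto simp: less_Suc_eq)
  next
    case (4 r1 \<mu>1 t)
    have J: "?J m r1 \<mu>1" using 4(1) r by simp
    have r12: "r1 2 = m" using frame_reg[OF 4(3), of 2] r by simp
    let ?l = "r1 29 + m + 1"
    have "isbits \<mu>1 [14, c] ?l \<and> num \<mu>1 [14, c] ?l = f c" if c: "c < m" for c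
    proof -
      have v: "\<mu>1 ([14, c] @ [j]) = (if j < length (binary (f c)) then binary (f c) ! j else 0)" for j using J c by simp
      have lb: "length (binary (f c)) \<le> r1 29" using J c by blast
      have "num \<mu>1 [14, c] ?l = (\<Sum>j<length (binary (f c)). binary (f c) ! j * 2 ^ j)"
        unfolding num_def v using lb by (intro sum.mono_neutral_cong_right) auto
      then show ?thesis unfolding isbits_def v binary_value using binary_bits[of _ "f c"] by auto
    qed
    then show ?case using J 4(4) r12 r V by auto
  qed
qed (use V in simp)

section \<open>The programs\<close>

definition tables :: prog where
  "tables = ps_gen 5 6 7 (HGet [HNum 3, $15]) (HGet [HNum 4, $6] \<ominus> $15) ;;
     ps_gen 8 9 10 (HGet [HNum 3, $4 \<ominus> HNum 1 \<ominus> $15]) ($4 \<ominus> HNum 1 \<ominus> $15 \<ominus> HGet [HNum 4, $6])"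

definition prepare :: "prog \<Rightarrow> prog" where
  "prepare W = read_head ;; read_clauses ;; read_tree ;; W ;; positions ;; tables"

definition count_prog :: prog where
  "count_prog = prepare (25 ::= $4 \<oplus> HNum 1) ;; sweep count_step ;;
     PFor 8 ($25) ([HNum 0, $8] \<lhd> HGet [HNum 11, $4, HNum 0, HNum 0, $8]) ;; 1 ::= $25"

definition max_prog :: "prog \<Rightarrow> prog" where
  "max_prog W = prepare W ;; sweep max_step ;; backtrack"

lemma mod_tables [simp]: "modr tables = {6, 15, 16, 17, 18, 19, 20, 21, 22}" "modm tables = {5, 6, 7, 8, 9, 10}" "wf_prog tables"
  by (auto simp: tables_def)

lemma mod_prepare [simp]: "modr (prepare W) = {2, 3, 4, 5, 6, 7, 8, 9, 10, 11, 12, 13, 14, 15, 16, 17, 18, 19, 20, 21, 22} \<union> modr W"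
    "modm (prepare W) = {2, 3, 4, 5, 6, 7, 8, 9, 10} \<union> modm W" "wf_prog (prepare W) \<longleftrightarrow> wf_prog W"
  by (auto simp: prepare_def)

lemma wf_sweep: "modr p \<inter> {15, 16, 17, 18} = {} \<Longrightarrow> wf_prog p \<Longrightarrow> wf_prog (sweep p)"
  by (auto simp: sweep_def)

lemma wf_programs: "wf_prog count_prog" "wf_prog W \<Longrightarrow> wf_prog (max_prog W)"
  by (auto simp: count_prog_def max_prog_def intro!: wf_sweep)

section \<open>Arithmetic of the running times\<close>

lemma table_cost:
  assumes "1 \<le> k" "1 \<le> (m::nat)"
  shows "Suc (2 * Suc (k * Suc (m + k * Suc m))) \<le> 11 * (k ^ 2 * m)"
proof -
  have km: "1 \<le> k * m" "m \<le> k * m" "k \<le> k * m" using assms by auto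
  \<comment> \<open>Four summands \<open>1\<close>, \<open>m\<close>, \<open>k\<close> and
    \<open>k * m\<close>, each at most \<open>k * m\<close>; the final 11 is
    \<open>2 * 4 + 3\<close>.\<close>
  have "Suc (m + k * Suc m) \<le> 4 * (k * m)" unfolding mult_Suc_right using km by linarith
  then have "k * Suc (m + k * Suc m) \<le> k * (4 * (k * m))" by (rule mult_le_mono2)
  also have "\<dots> = 4 * (k ^ 2 * m)" by (simp add: power2_eq_square)
  finally have "k * Suc (m + k * Suc m) \<le> 4 * (k ^ 2 * m)" .
  moreover have "1 \<le> k ^ 2 * m" using assms by auto
  moreover have "Suc (2 * Suc a) \<le> 11 * b" if "a \<le> 4 * b" "1 \<le> b" for a b :: nat using that by simp
  ultimately show ?thesis by blast
qed

lemma sweep_cost: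
  assumes "1 \<le> k"
  shows "Suc (2 * Suc (k * Suc (k * Suc x))) \<le> 7 * (k ^ 2 * Suc x)"
proof -
  have "1 \<le> k * Suc x" using assms by (metis mult_le_mono mult_1 Suc_le_eq zero_less_Suc One_nat_def)
  then have "k * Suc (k * Suc x) \<le> k * (2 * (k * Suc x))" by (intro mult_le_mono2) linarith
  also have "\<dots> = 2 * (k ^ 2 * Suc x)" by (simp only: power2_eq_square mult.assoc mult.left_commute)
  finally have "k * Suc (k * Suc x) \<le> 2 * (k ^ 2 * Suc x)" .
  moreover have "1 \<le> k ^ 2 * Suc x" using assms by (metis mult_le_mono mult_1 Suc_le_eq zero_less_Suc One_nat_def one_le_power)
  moreover have "Suc (2 * Suc a) \<le> 7 * b" if "a \<le> 2 * b" "1 \<le> b" for a b :: nat using that by simp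
  ultimately show ?thesis by blast
qed

text \<open>Since \<open>m + 1 <= 2 ^ m\<close>, a sum of \<open>m\<close> numbers of
  \<open>a\<close> bits, increased by one, fits into \<open>a + m + 1\<close> bits; this fixes the
  length of table entries.\<close>

lemma prod_sum_less_power:
  assumes "\<And>c. c < m \<Longrightarrow> f c < (2::nat) ^ a"
  shows "1 + (\<Sum>c<m. f c) < 2 ^ (a + m + 1)"
proof -
  have "(\<Sum>c<m. f c) \<le> (\<Sum>c<m. 2 ^ a)" using assms by (intro sum_mono) (simp add: less_imp_le)
  then have "(\<Sum>c<m. f c) \<le> m * 2 ^ a" by simp
  moreover have "1 \<le> (2::nat) ^ a" by simp
  ultimately have "1 + (\<Sum>c<m. f c) \<le> Suc m * 2 ^ a" unfolding mult_Suc by linarith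
  also have "\<dots> \<le> 2 ^ m * 2 ^ a" by (intro mult_le_mono1) (simp add: Suc_leI)
  also have "\<dots> < 2 ^ (a + m + 1)" by (simp add: power_add)
  finally show ?thesis .
qed

section \<open>Encoded instances and correctness of the programs on them\<close>

context lin_inst
begin

definition "lcodes c = map (encode_lit xs) (ls (cs ! c))"
definition "clause_code = concat (map (\<lambda>c. length (lcodes c) # lcodes c) [0..<m])"

lemma encode_lit_div: "l \<in> fst (cs ! c) \<Longrightarrow> c < m \<Longrightarrow>
   encode_lit xs l div 2 < n \<and> lit_of (encode_lit xs l mod 2) (xs ! (encode_lit xs l div 2)) = l"
proof -
  assume a: "l \<in> fst (cs ! c)" "c < m"
  have "lvar l \<in> set xs" using lvar_vars[OF a(2,1)] inst_facts(9) by simp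
  then show ?thesis using pos_in[of "lvar l" xs] inst_facts(13) by (cases l) (auto simp: lit_of_def)
qed

lemma set_lcodes: "c < m \<Longrightarrow> set (lcodes c) = encode_lit xs ` fst (cs ! c)"
  unfolding lcodes_def using inst_facts(12)[OF cs_nth(1)] by simp

lemma L_hit: "e < N \<Longrightarrow> b < 2 \<Longrightarrow> c < m \<Longrightarrow> L e b c \<longleftrightarrow> hit m (lcodes c) e b"
proof
  assume a: "e < N" "b < 2" "c < m" "L e b c"
  let ?l = "lit_of b (xs ! (e - m))"
  have l: "?l \<in> fst (cs ! c)" "m \<le> e" using a(4) by (auto simp: L_def)
  have "pos_in xs (xs ! (e - m)) = e - m" using pos_in_nth[of xs "e - m"] inst_facts(8,13) a(1) l(2) by simp
  then have "encode_lit xs ?l = 2 * (e - m) + b" using a(2) by (auto simp: lit_of_def)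
  then have "e = m + encode_lit xs ?l div 2 \<and> b = encode_lit xs ?l mod 2" using a(2) l(2) by simp
  then show "hit m (lcodes c) e b" unfolding hit_def set_lcodes[OF a(3)] using l(1) by blast
next
  assume a: "e < N" "b < 2" "c < m" "hit m (lcodes c) e b"
  then obtain l where l: "l \<in> fst (cs ! c)" "e = m + encode_lit xs l div 2" "b = encode_lit xs l mod 2"
    unfolding hit_def set_lcodes[OF a(3)] by blast
  then show "L e b c" using encode_lit_div[OF l(1) a(3)] a by (simp add: L_def)
qed

lemma size_eq: "s = m + (\<Sum>c<m. length (lcodes c))"
proof -
  have "(\<Sum>c\<in>cla F. card (fst c)) = (\<Sum>c<m. card (fst (cs ! c)))"
    unfolding cla_cs using inst_facts(10,14) by (subst sum.reindex) (auto simp: inj_on_def nth_eq_iff_index_eq)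
  also have "\<dots> = (\<Sum>c<m. length (lcodes c))"
  proof (rule sum.cong)
    fix c assume "c \<in> {..<m}"
    then have "distinct (ls (cs ! c)) \<and> set (ls (cs ! c)) = fst (cs ! c)" using inst_facts(12) cs_nth(1) by simp
    then show "card (fst (cs ! c)) = length (lcodes c)" unfolding lcodes_def by (metis distinct_card length_map)
  qed simp
  finally have "(\<Sum>(C, i)\<in>cla F. card C) = (\<Sum>c<m. length (lcodes c))" by (simp add: case_prod_beta)
  then show ?thesis using inst_facts(3,4) unfolding cnf_size_def by simp
qed

lemma length_clause_code: "length clause_code = s"
proof -
  have "length (concat (map (\<lambda>c. length (lcodes c) # lcodes c) [0..<j])) = j + (\<Sum>c<j. length (lcodes c))" for j
    by (induction j) auto
  then show ?thesis unfolding clause_code_def size_eq by simp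
qed

lemma length_lcodes: "c < m \<Longrightarrow> length (lcodes c) \<le> s"
  using member_le_sum[of c "{..<m}" "\<lambda>c. length (lcodes c)"] unfolding size_eq by simp

text \<open>A tree has a leaf, and without clauses there would be no variables to label it, so
  \<open>1 <= m\<close>. Each variable occurs in some clause, whence \<open>n <= s\<close>; the
  forward level 0 has one set, whence \<open>1 <= k\<close>.\<close>

lemma parameters: "1 \<le> m" "m \<le> s" "n \<le> s" "1 \<le> k" "m + n \<le> 2 * s"
proof -
  show ms: "m \<le> s" using size_eq by simp
  have "vars F = (\<Union>c\<in>cla F. lvar ` fst c)" unfolding vars_def by auto
  also have "\<dots> = (\<Union>c<m. lvar ` fst (cs ! c))" unfolding cla_cs by simp
  finally have v: "vars F = (\<Union>c<m. lvar ` set (ls (cs ! c)))" using inst_facts(12) cs_nth(1) by simp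
  have "n \<le> (\<Sum>c<m. card (lvar ` set (ls (cs ! c))))"
    unfolding inst_facts(2)[symmetric] v by (rule card_UN_le) simp
  also have "\<dots> \<le> (\<Sum>c<m. length (lcodes c))"
  proof (rule sum_mono)
    fix c
    have "card (lvar ` set (ls (cs ! c))) \<le> card (set (ls (cs ! c)))" by (rule card_image_le) simp
    also have "\<dots> \<le> length (lcodes c)" unfolding lcodes_def by (simp add: card_length)
    finally show "card (lvar ` set (ls (cs ! c))) \<le> length (lcodes c)" .
  qed
  finally show ns: "n \<le> s" using size_eq by simp
  show "m + n \<le> 2 * s" using ms ns by simp
  show "1 \<le> m"
  proof (rule ccontr)
    assume "\<not> 1 \<le> m"
    then have "m = 0" by simp
    then have "vars F = {}" using v by simp
    then have "n = 0" using inst_facts(2) by simp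
    then have "leaves D = []" using \<open>m = 0\<close> inst_facts(19) leaf_order_set[OF inst_facts(6)] unfolding es_def by simp
    then show False using leaves_pos[of D] by simp
  qed
  show "1 \<le> k" using card_psetsA[of 0] by simp
qed

lemma length_D: "length (leaves D) = N"
  using inst_facts(19) leaf_order_set[OF inst_facts(6)] unfolding es_def by simp

lemma encode_instance_eq:
  "encode_instance xs cs ls D = m # n # clause_code @ encode_tree (encode_label xs cs) D"
proof -
  have "map (\<lambda>c. length (ls c) # map (encode_lit xs) (ls c)) cs =
      map (\<lambda>c. length (ls (cs ! c)) # map (encode_lit xs) (ls (cs ! c))) [0..<m]"
    using inst_facts(14) by (intro nth_equalityI) auto
  then show ?thesis using inst_facts(13,14)
    unfolding encode_instance_def encode_cnf_def clause_code_def lcodes_def by simp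
qed

lemma length_instance: "length (encode_instance xs cs ls D) = 1 + s + 3 * N"
  using length_encode_tree[of "encode_label xs cs" D] unfolding encode_instance_eq length_D
  by (simp add: length_clause_code)

lemma instance_values: "a \<in> set (encode_instance xs cs ls D) \<Longrightarrow> a \<le> s + 2 * N"
proof -
  assume a: "a \<in> set (encode_instance xs cs ls D)"
  have lc: "x < 2 * n" if "x \<in> set (lcodes c)" "c < m" for x c
    using that encode_lit_div[of _ c] unfolding set_lcodes[OF that(2)] by fastforce
  have cl: "x \<le> s + 2 * N" if "x \<in> set clause_code" for x
    using that length_lcodes lc unfolding clause_code_def by fastforce
  have tr: "x \<le> 1 \<or> x \<in> g ` set (leaves t)" if "x \<in> set (encode_tree g t)" for x and g :: "'z \<Rightarrow> nat" and t
    using that by (induction t) auto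
  have "x \<le> N" if "x \<in> encode_label xs cs ` set (leaves D)" for x
    using that encode_label inst_facts(18) leaf_order_set[OF inst_facts(6)] unfolding es_def by fastforce
  then show ?thesis
    using a cl tr[of a "encode_label xs cs" D] parameters(1,2) unfolding encode_instance_eq by fastforce
qed

lemma ps_contextA:
  assumes "N \<le> V" "k \<le> V" "2 \<le> V"
  shows "ps_context inp V m n k E PC L (\<lambda>i. i) maskA nb litA 5 6 7 (HGet [HNum 3, $15]) (HGet [HNum 4, $6] \<ominus> $15)"
proof (unfold_locales, goal_cases)
  case (6 i b c)
  show ?case by (simp add: litA_def)
qed (use assms E_less card_psetsA in \<open>auto simp: base_def maskA_def nb_def\<close>)

lemma ps_contextB:
  assumes "N \<le> V" "k \<le> V" "2 \<le> V"
  shows "ps_context inp V m n k E PC L (\<lambda>i. N - 1 - i) maskB nbB litB 8 9 10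
    (HGet [HNum 3, $4 \<ominus> HNum 1 \<ominus> $15]) ($4 \<ominus> HNum 1 \<ominus> $15 \<ominus> HGet [HNum 4, $6])"
proof (unfold_locales, goal_cases)
  case (6 i b c)
  show ?case by (simp add: litB_def)
next
  case (4 i)
  show ?case by (rule E_less) (use 4 in simp)
next
  case (5 i)
  show ?case by (simp add: nbB_def nb_def)
qed (use assms card_psetsB in \<open>auto simp: base_def maskB_def\<close>)

lemma wp_positions:
  assumes "r 4 = N" "\<And>i. i < N \<Longrightarrow> \<mu> [3, i] = E i" "N \<le> V"
  shows "wp inp V positions (\<lambda>r' \<mu>' t. t \<le> N \<and> (\<forall>c<m. \<mu>' [4, c] = PC c)) r \<mu>"
  unfolding positions_def
proof (rule wp_For[where T = 0 and I = "\<lambda>i r' \<mu>'. \<forall>j<i. \<mu>' [4, E j] = j"], goal_cases)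
  case (3 i r' \<mu>')
  have i: "i < N" using 3(1) assms(1) by simp
  have "\<mu>' [3, i] = E i" using frame_mem[OF 3(4), of 3] assms(2)[OF i] by simp
  moreover have "E j \<noteq> E i" if "j < i" for j using E_inj that i by (auto simp: inj_on_def)
  ultimately show ?case using 3(2,3) i assms(3) by (auto simp: less_Suc_eq)
next
  case (4 r' \<mu>' t)
  have "\<mu>' [4, c] = PC c" if "c < m" for c using 4(1) PC_pos[OF that] assms(1) by force
  then show ?case using 4 assms(1) by simp
qed (use assms in auto)

definition "prepared l wv r \<mu> \<longleftrightarrow> base m n E PC L r \<mu> \<and> r 25 = l \<and>
  (\<forall>c<m. isbits \<mu> [14, c] l \<and> num \<mu> [14, c] l = wv c) \<and>
  (\<forall>a ks. a \<notin> {2, 3, 4, 5, 6, 7, 8, 9, 10, 14} \<longrightarrow> \<mu> (a # ks) = 0) \<and>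
  ps_table m N nb maskA litA (\<lambda>i. \<mu> [6, i]) (vec m \<mu> 5) (\<lambda>i b p. \<mu> [7, i, b, p]) \<and>
  ps_table m N nbB maskB litB (\<lambda>i. \<mu> [9, i]) (vec m \<mu> 8) (\<lambda>i b p. \<mu> [10, i, b, p]) \<and>
  (\<forall>i\<le>N. \<mu> [6, i] \<le> k \<and> \<mu> [9, i] \<le> k)"

lemma wp_tables:
  assumes b: "base m n E PC L r \<mu>" and z: "\<And>a ks. a \<in> {5, 6, 7, 8, 9, 10} \<Longrightarrow> \<mu> (a # ks) = 0"
    and V: "N \<le> V" "k \<le> V" "2 \<le> V"
  shows "wp inp V tables (\<lambda>r' \<mu>' t. t \<le> 2 * (N * Suc (2 * Suc (k * Suc (m + k * Suc m)))) \<and> base m n E PC L r' \<mu>' \<and>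
    ps_table m N nb maskA litA (\<lambda>i. \<mu>' [6, i]) (vec m \<mu>' 5) (\<lambda>i b p. \<mu>' [7, i, b, p]) \<and>
    ps_table m N nbB maskB litB (\<lambda>i. \<mu>' [9, i]) (vec m \<mu>' 8) (\<lambda>i b p. \<mu>' [10, i, b, p]) \<and>
    (\<forall>i\<le>N. \<mu>' [6, i] \<le> k \<and> \<mu>' [9, i] \<le> k)) r \<mu>"
proof -
  interpret A: ps_context inp V m n k E PC L "\<lambda>i. i" maskA nb litA 5 6 7 "HGet [HNum 3, $15]" "HGet [HNum 4, $6] \<ominus> $15"
    by (rule ps_contextA[OF V])
  interpret B: ps_context inp V m n k E PC L "\<lambda>i. N - 1 - i" maskB nbB litB 8 9 10
    "HGet [HNum 3, $4 \<ominus> HNum 1 \<ominus> $15]" "$4 \<ominus> HNum 1 \<ominus> $15 \<ominus> HGet [HNum 4, $6]"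
    by (rule ps_contextB[OF V])
  let ?T = "N * Suc (2 * Suc (k * Suc (m + k * Suc m)))"
  show ?thesis
    unfolding tables_def wp.simps(4)
  proof (rule wp_mono[OF wp_frame[OF A.wp_ps_gen[OF b]]], goal_cases)
    case (2 r1 \<mu>1 t1)
    then have f1: "frame (ps_gen 5 6 7 (HGet [HNum 3, $15]) (HGet [HNum 4, $6] \<ominus> $15)) r \<mu> r1 \<mu>1"
      and t1: "t1 \<le> ?T" and g1: "A.good N \<mu>1" by auto
    have b1: "base m n E PC L r1 \<mu>1" by (rule base_cong[OF b]) (use frame_reg[OF f1] frame_mem[OF f1] in auto)
    have z1: "\<mu>1 [8, 0, 0, c] = 0" for c using frame_mem[OF f1, of 8] z by simp
    show ?case
    proof (rule wp_mono[OF wp_frame[OF B.wp_ps_gen[OF b1]]], goal_cases)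
      case (2 r2 \<mu>2 t2)
      then have f2: "frame (ps_gen 8 9 10 (HGet [HNum 3, $4 \<ominus> HNum 1 \<ominus> $15]) ($4 \<ominus> HNum 1 \<ominus> $15 \<ominus> HGet [HNum 4, $6])) r1 \<mu>1 r2 \<mu>2"
        and t2: "t2 \<le> ?T" and g2: "B.good N \<mu>2" by auto
      have b2: "base m n E PC L r2 \<mu>2" by (rule base_cong[OF b1]) (use frame_reg[OF f2] frame_mem[OF f2] in auto)
      have g1': "A.good N \<mu>2" by (rule A.good_cong[OF g1]) (use frame_mem[OF f2] in auto)
      show ?case
        using t1 t2 b2 A.good_table[OF g1'] B.good_table[OF g2] A.cnt_le[OF g1'] B.cnt_le[OF g2] by auto
    qed (use z1 in simp)
  qed (use z in simp)
qed

text \<open>The three problems differ in preparation only by \<open>W\<close>, which supplies the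
  weights \<open>wv\<close> and chooses the number of bits of table entries, about which
  \<open>P\<close> keeps what is needed later.\<close>

lemma wp_prepare:
  assumes s: "seg inp 1 (encode_instance xs cs ls D @ ws)"
    and V: "s + 6 * N + 10 \<le> V" "k \<le> V"
    and W: "\<And>r \<mu>. r 2 = m \<Longrightarrow> r 4 = N \<Longrightarrow> r 5 = 2 + s + 3 * N \<Longrightarrow> (\<And>ks. \<mu> (14 # ks) = 0) \<Longrightarrow>
       seg inp (r 5) ws \<Longrightarrow>
       wp inp V W (\<lambda>r' \<mu>' t. t \<le> TW \<and> P (r' 25) \<and>
         (\<forall>c<m. isbits \<mu>' [14, c] (r' 25) \<and> num \<mu>' [14, c] (r' 25) = wv c)) r \<mu>"
    and mods: "modr W \<subseteq> {5, 6, 7, 8, 25, 29}" "modm W \<subseteq> {14}"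
  shows "wp inp V (prepare W) (\<lambda>r \<mu> t. t \<le> m * Suc s + 3 * N + TW + N + 2 * (N * Suc (2 * Suc (k * Suc (m + k * Suc m)))) \<and>
    (\<exists>l. P l \<and> prepared l wv r \<mu>)) (\<lambda>_. 0) (\<lambda>_. 0)"
proof -
  have mr: "x \<notin> modr W" if "x \<notin> {5, 6, 7, 8, 25, 29}" for x using that mods(1) by blast
  have mm: "x \<notin> modm W" if "x \<notin> {14}" for x using that mods(2) by blast
  have lt: "length (encode_tree (encode_label xs cs) D) = 3 * N - 1"
    using length_encode_tree[of "encode_label xs cs" D] unfolding length_D by simp
  have N1: "1 \<le> N" using parameters(1) by simp
  have s1: "inp 1 = m" "inp 2 = n" "seg inp 3 clause_code" "seg inp (3 + s) (encode_tree (encode_label xs cs) D)"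
    using s unfolding encode_instance_eq by (simp_all add: length_clause_code numeral_2_eq_2 numeral_3_eq_3)
  have "1 + length (encode_instance xs cs ls D) = 2 + s + 3 * N" unfolding length_instance by simp
  then have s2: "seg inp (2 + s + 3 * N) ws" using s seg_append by metis
  have lc: "x \<le> V" if "x \<in> set (lcodes c)" "c < m" for x c
  proof -
    have "x div 2 < n" using that encode_lit_div[of _ c] unfolding set_lcodes[OF that(2)] by fastforce
    then show ?thesis using V(1) by simp
  qed
  let ?r0 = "(\<lambda>_ :: nat. 0)(2 := m, 3 := n, 4 := N, 5 := 3)"
  have w1: "wp inp V read_clauses (\<lambda>r' \<mu>' t. t \<le> m * Suc s \<and> r' 5 = ?r0 5 + length clause_code \<and>
    (\<forall>e b c. \<mu>' [2, e, b, c] = of_bool (c < m \<and> hit m (lcodes c) e b))) ?r0 (\<lambda>_. 0)"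
    unfolding clause_code_def
    by (rule wp_read_clauses)
      (use s1(3) V lc length_lcodes length_clause_code[unfolded clause_code_def] in \<open>auto simp: clause_code_def\<close>)
  have "wp inp V (read_clauses ;; read_tree ;; W ;; positions ;; tables)
    (\<lambda>r \<mu> t. t \<le> m * Suc s + 3 * N + TW + N + 2 * (N * Suc (2 * Suc (k * Suc (m + k * Suc m)))) \<and>
    (\<exists>l. P l \<and> prepared l wv r \<mu>)) ?r0 (\<lambda>_. 0)"
    unfolding wp.simps(4)
  proof (rule wp_mono[OF wp_frame[OF w1]], goal_cases)
    case (1 r1 \<mu>1 t1)
    then have f1: "frame read_clauses ?r0 (\<lambda>_. 0) r1 \<mu>1" and t1: "t1 \<le> m * Suc s" and p1: "r1 5 = 3 + s"
      and L1: "\<And>e b c. \<mu>1 [2, e, b, c] = of_bool (c < m \<and> hit m (lcodes c) e b)"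
      by (auto simp: length_clause_code)
    have r1: "r1 2 = m" "r1 3 = n" "r1 4 = N"
      using frame_reg[OF f1, of 2] frame_reg[OF f1, of 3] frame_reg[OF f1, of 4] by simp_all
    have z1: "\<mu>1 (a # ks) = 0" if "a \<noteq> 2" for a ks using frame_mem[OF f1, of a ks] that by simp
    have lab: "encode_label xs cs a \<le> V" if "a \<in> set (leaves D)" for a
      using that encode_label[of a] inst_facts(5) V unfolding branch_decomposition_def by auto
    have w2: "wp inp V read_tree (\<lambda>r' \<mu>' t. t \<le> 3 * r1 4 \<and> (\<forall>i<r1 4. \<mu>' [3, i] = encode_label xs cs (leaf_order D ! i)) \<and>
        r' 5 = r1 5 + length (encode_tree (encode_label xs cs) D)) r1 \<mu>1"
      using s1(4) V length_D lab by (intro wp_read_tree[OF inst_facts(6)]) (auto simp: r1 p1)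
    show ?case
    proof (rule wp_mono[OF wp_frame[OF w2]], goal_cases)
      case (1 r2 \<mu>2 t2)
      then have f2: "frame read_tree r1 \<mu>1 r2 \<mu>2" and t2: "t2 \<le> 3 * N" and p2: "r2 5 = 2 + s + 3 * N"
        and E2: "\<And>i. i < N \<Longrightarrow> \<mu>2 [3, i] = E i"
        using N1 by (auto simp: p1 lt r1 E_def es_def)
      have r2: "r2 2 = m" "r2 3 = n" "r2 4 = N"
        using frame_reg[OF f2, of 2] frame_reg[OF f2, of 3] frame_reg[OF f2, of 4] r1 by simp_all
      have z2: "\<mu>2 (a # ks) = 0" if "a \<noteq> 2" "a \<noteq> 3" for a ks using frame_mem[OF f2, of a ks] z1 that by simp
      have L2: "\<mu>2 [2, e, b, c] = of_bool (c < m \<and> hit m (lcodes c) e b)" for e b c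
        using frame_mem[OF f2, of 2] L1 by simp
      have w3: "wp inp V W (\<lambda>r' \<mu>' t. t \<le> TW \<and> P (r' 25) \<and>
         (\<forall>c<m. isbits \<mu>' [14, c] (r' 25) \<and> num \<mu>' [14, c] (r' 25) = wv c)) r2 \<mu>2"
        using z2 s2 by (intro W) (auto simp: r2 p2)
      show ?case
      proof (rule wp_mono[OF wp_frame[OF w3]], goal_cases)
        case (1 r3 \<mu>3 t3)
        then have f3: "frame W r2 \<mu>2 r3 \<mu>3" and t3: "t3 \<le> TW" and P3: "P (r3 25)"
          and w3: "\<And>c. c < m \<Longrightarrow> isbits \<mu>3 [14, c] (r3 25) \<and> num \<mu>3 [14, c] (r3 25) = wv c"
          by auto
        have r3: "r3 2 = m" "r3 3 = n" "r3 4 = N"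
          using frame_reg[OF f3] r2 by (simp_all add: mr)
        have m3: "\<mu>3 (a # ks) = \<mu>2 (a # ks)" if "a \<noteq> 14" for a ks using frame_mem[OF f3, of a ks] that by (simp add: mm)
        have w4: "wp inp V positions (\<lambda>r' \<mu>' t. t \<le> N \<and> (\<forall>c<m. \<mu>' [4, c] = PC c)) r3 \<mu>3"
          by (rule wp_positions[where \<mu> = \<mu>3]) (use V r3 m3 E2 in auto)
        show ?case
        proof (rule wp_mono[OF wp_frame[OF w4]], goal_cases)
          case (1 r4 \<mu>4 t4)
          then have f4: "frame positions r3 \<mu>3 r4 \<mu>4" and t4: "t4 \<le> N" and P4: "\<And>c. c < m \<Longrightarrow> \<mu>4 [4, c] = PC c"
            by auto
          have r4: "r4 2 = m" "r4 3 = n" "r4 4 = N" "r4 25 = r3 25"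
            using frame_reg[OF f4, of 2] frame_reg[OF f4, of 3] frame_reg[OF f4, of 4] frame_reg[OF f4, of 25] r3 by simp_all
          have m4: "\<mu>4 (a # ks) = \<mu>3 (a # ks)" if "a \<noteq> 4" for a ks using frame_mem[OF f4, of a ks] that by simp
          have b4: "base m n E PC L r4 \<mu>4"
            unfolding base_def using r4 P4 m4[of 2] m4[of 3] m3[of 2] m3[of 3] L2 E2 L_hit by simp
          have z4: "\<mu>4 (a # ks) = 0" if "a \<notin> {2, 3, 4, 14}" for a ks using that m4 m3 z2 by simp
          have "wp inp V tables (\<lambda>r' \<mu>' t. t \<le> 2 * (N * Suc (2 * Suc (k * Suc (m + k * Suc m)))) \<and> base m n E PC L r' \<mu>' \<and>
              ps_table m N nb maskA litA (\<lambda>i. \<mu>' [6, i]) (vec m \<mu>' 5) (\<lambda>i b p. \<mu>' [7, i, b, p]) \<and>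
              ps_table m N nbB maskB litB (\<lambda>i. \<mu>' [9, i]) (vec m \<mu>' 8) (\<lambda>i b p. \<mu>' [10, i, b, p]) \<and>
              (\<forall>i\<le>N. \<mu>' [6, i] \<le> k \<and> \<mu>' [9, i] \<le> k)) r4 \<mu>4"
            using V z4 by (intro wp_tables[OF b4]) auto
          from wp_frame[OF this] show ?case
          proof (rule wp_mono, goal_cases)
            case (1 r5 \<mu>5 t5)
            then have f5: "frame tables r4 \<mu>4 r5 \<mu>5" by blast
            have m5: "\<mu>5 (a # ks) = \<mu>4 (a # ks)" if "a \<notin> {5, 6, 7, 8, 9, 10}" for a ks
              using frame_mem[OF f5, of a ks] that by simp
            have "r5 25 = r3 25" using frame_reg[OF f5, of 25] r4 by simp
            moreover have "isbits \<mu>5 [14, c] (r3 25) \<and> num \<mu>5 [14, c] (r3 25) = wv c" if "c < m" for c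
              using w3[OF that] m5[of 14] m4[of 14] by (simp add: isbits_def num_def)
            moreover have "\<mu>5 (a # ks) = 0" if "a \<notin> {2, 3, 4, 5, 6, 7, 8, 9, 10, 14}" for a ks
              using that m5 z4 by simp
            ultimately have "prepared (r3 25) wv r5 \<mu>5" unfolding prepared_def using 1 by blast
            then show ?case using P3 t1 t2 t3 t4 1 by auto
          qed
        qed
      qed
    qed
  qed
  then show ?thesis
    using V s1(1,2) unfolding prepare_def read_head_def by simp
qed

lemma preparedD: "prepared l wv r \<mu> \<Longrightarrow> r 2 = m \<and> r 3 = n \<and> r 4 = N \<and> r 25 = l"
  unfolding prepared_def base_def by simp

lemma wp_count_prog:
  assumes s: "seg inp 1 (encode_instance xs cs ls D)" and V: "s + 6 * N + 10 \<le> V" "k \<le> V"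
  shows "wp inp V count_prog (\<lambda>r \<mu> t. r 1 = N + 1 \<and>
    t \<le> (m * Suc s + 3 * N + 0 + N + 2 * (N * Suc (2 * Suc (k * Suc (m + k * Suc m))))) +
      (k + N * Suc (2 * Suc (k * Suc (k * Suc (N + 1))))) + (N + 1) \<and>
    represents_number (map (\<lambda>j. \<mu> [0, j]) [0..<r 1]) (num_models F)) (\<lambda>_. 0) (\<lambda>_. 0)"
proof -
  let ?t1 = "m * Suc s + 3 * N + 0 + N + 2 * (N * Suc (2 * Suc (k * Suc (m + k * Suc m))))"
  let ?t2 = "k + N * Suc (2 * Suc (k * Suc (k * Suc (N + 1))))"
  \<comment> \<open>Counting has no weights: the untouched array 14 represents the constant 0. Up to
    \<open>2 ^ N\<close> models require \<open>N + 1\<close> bits.\<close>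
  have w1: "wp inp V (prepare (25 ::= $4 \<oplus> HNum 1)) (\<lambda>r \<mu> t. t \<le> ?t1 \<and> (\<exists>l. l = N + 1 \<and> prepared l (\<lambda>_. 0) r \<mu>)) (\<lambda>_. 0) (\<lambda>_. 0)"
    using s V by (intro wp_prepare[where ws = "[]"]) (auto simp: isbits_def num_def)
  show ?thesis
    unfolding count_prog_def wp.simps(4)
  proof (rule wp_mono[OF w1], goal_cases)
    case (1 r1 \<mu>1 t1)
    then have p: "prepared (N + 1) (\<lambda>_. 0) r1 \<mu>1" and t1: "t1 \<le> ?t1" by auto
    interpret dp: dp_context m N E PC L "\<lambda>_. 0" \<mu>1 inp V n k "N + 1"
      by unfold_locales (use p V in \<open>auto simp: prepared_def base_def\<close>)
    have st: "dp.static r1 \<mu>1" using preparedD[OF p] unfolding dp.static_def by simp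
    have z: "\<mu>1 (11 # ks) = 0" for ks using p by (simp add: prepared_def)
    show ?case
    proof (rule wp_mono[OF wp_frame[OF dp.wp_count[OF st z]]], goal_cases)
      case (2 r2 \<mu>2 t2)
      then have f2: "frame (sweep count_step) r1 \<mu>1 r2 \<mu>2" and t2: "t2 \<le> ?t2"
        and b2: "isbits \<mu>2 [11, N, 0, 0] (N + 1)" "num \<mu>2 [11, N, 0, 0] (N + 1) = dp.cnt_tab N 0 0" by auto
      have r2: "r2 4 = N" "r2 25 = N + 1"
        using frame_reg[OF f2, of 4] frame_reg[OF f2, of 25] preparedD[OF p] by (simp_all add: sweep_def)
      have w3: "wp inp V (PFor 8 ($25) ([HNum 0, $8] \<lhd> HGet [HNum 11, $4, HNum 0, HNum 0, $8]))
        (\<lambda>r \<mu> t. t \<le> N + 1 \<and> r 25 = N + 1 \<and> (\<forall>j<N + 1. \<mu> [0, j] = \<mu>2 [11, N, 0, 0, j])) r2 \<mu>2"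
      proof (rule wp_For[where T = 0 and I = "\<lambda>j r \<mu>. \<forall>d<j. \<mu> [0, d] = \<mu>2 [11, N, 0, 0, d]"], goal_cases)
        case 1
        then show ?case using r2 V by simp
      next
        case (3 j r \<mu>)
        have "r 4 = N" using frame_reg[OF 3(4), of 4] r2 by simp
        moreover have "\<mu> (11 # ks) = \<mu>2 (11 # ks)" for ks using frame_mem[OF 3(4), of 11] by simp
        moreover have "\<mu>2 [11, N, 0, 0, j] \<le> 1" using b2(1) 3(1) r2 by (simp add: isbits_def)
        ultimately show ?case using 3(2,3) V by (auto simp: less_Suc_eq)
      next
        case (4 r \<mu> t)
        then show ?case using frame_reg[OF 4(3), of 25] r2 by simp
      qed simp
      show ?case
      proof (rule wp_mono[OF w3], goal_cases)
        case (1 r3 \<mu>3 t3)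
        let ?out = "map (\<lambda>j. \<mu>3 [0, j]) [0..<N + 1]"
        have o: "?out = map (\<lambda>j. \<mu>2 [11, N, 0, 0, j]) [0..<N + 1]" using 1 by simp
        have "\<mu>2 [11, N, 0, 0, j] \<in> {0, 1}" if "j < N + 1" for j
          using b2(1) that unfolding isbits_def by (simp add: le_Suc_eq)
        then have "set ?out \<subseteq> {0, 1}" unfolding o set_map set_upt by (intro image_subsetI) simp
        moreover have "horner_sum id 2 ?out = num \<mu>2 [11, N, 0, 0] (N + 1)"
          unfolding o num_def horner_sum_eq_sum by (rule sum.cong) (auto simp del: upt_Suc)
        ultimately have "represents_number ?out (num_models F)"
          unfolding represents_number_def b2(2) dp.cnt_tab_N num_models_paths by blast
        then show ?case using 1 t1 t2 V by simp
      qed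
    qed simp
  qed
qed

lemma vpos_nth: "v < n \<Longrightarrow> vpos (xs ! v) < N \<and> m \<le> E (vpos (xs ! v)) \<and> E (vpos (xs ! v)) - m = v"
proof -
  assume v: "v < n"
  note vp = vpos[OF xs_nth[OF v]]
  then have "E (vpos (xs ! v)) - m < n" using E_less[of "vpos (xs ! v)"] parameters(1) v by linarith
  then show ?thesis using vp v inst_facts(8,13) nth_eq_iff_index_eq by metis
qed

text \<open>The gains are indexed by positions, the weights by clauses; \<open>E\<close> is
  injective, so no weight is counted twice.\<close>

lemma wmax_bound: "(\<Sum>j<N. if E j < m then f (E j) else 0) \<le> (\<Sum>c<m. f c :: nat)"
proof -
  have "(\<Sum>j<N. if E j < m then f (E j) else 0) = (\<Sum>j\<in>{j. j < N \<and> E j < m}. f (E j))"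
    by (rule sum.mono_neutral_cong_right) auto
  also have "\<dots> = (\<Sum>c\<in>E ` {j. j < N \<and> E j < m}. f c)"
    using E_inj by (subst sum.reindex) (auto simp: inj_on_def)
  also have "\<dots> \<le> (\<Sum>c<m. f c)" by (rule sum_mono2) auto
  finally show ?thesis .
qed

lemma wp_max_prog:
  assumes s: "seg inp 1 (encode_instance xs cs ls D @ ws)" and V: "s + 6 * N + 10 \<le> V" "k \<le> V" "lm \<le> V"
    and W: "\<And>r \<mu>. r 2 = m \<Longrightarrow> r 4 = N \<Longrightarrow> r 5 = 2 + s + 3 * N \<Longrightarrow> (\<And>ks. \<mu> (14 # ks) = 0) \<Longrightarrow>
       seg inp (r 5) ws \<Longrightarrow>
       wp inp V W (\<lambda>r' \<mu>' t. t \<le> TW \<and> (0 < r' 25 \<and> r' 25 \<le> lm \<and> 1 + (\<Sum>c<m. w (cs ! c)) < 2 ^ r' 25) \<and>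
         (\<forall>c<m. isbits \<mu>' [14, c] (r' 25) \<and> num \<mu>' [14, c] (r' 25) = w (cs ! c))) r \<mu>"
    and mods: "modr W \<subseteq> {5, 6, 7, 8, 25, 29}" "modm W \<subseteq> {14}"
  shows "wp inp V (max_prog W) (\<lambda>r \<mu> t. r 1 = n \<and>
    t \<le> (m * Suc s + 3 * N + TW + N + 2 * (N * Suc (2 * Suc (k * Suc (m + k * Suc m))))) +
      (k + N * Suc (2 * Suc (k * Suc (k * Suc (4 * lm))))) + N \<and>
    (\<exists>\<tau>. max_weight_assignment F w \<tau> \<and> represents_assignment xs (map (\<lambda>j. \<mu> [0, j]) [0..<r 1]) \<tau>)) (\<lambda>_. 0) (\<lambda>_. 0)"
proof -
  let ?t1 = "m * Suc s + 3 * N + TW + N + 2 * (N * Suc (2 * Suc (k * Suc (m + k * Suc m))))"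
  let ?wv = "\<lambda>c. w (cs ! c)"
  have w1: "wp inp V (prepare W) (\<lambda>r \<mu> t. t \<le> ?t1 \<and>
      (\<exists>l. (0 < l \<and> l \<le> lm \<and> 1 + (\<Sum>c<m. ?wv c) < 2 ^ l) \<and> prepared l ?wv r \<mu>)) (\<lambda>_. 0) (\<lambda>_. 0)"
    by (rule wp_prepare[OF s V(1,2) W mods])
  show ?thesis
    unfolding max_prog_def wp.simps(4)
  proof (rule wp_mono[OF w1], goal_cases)
    case (1 r1 \<mu>1 t1)
    then obtain l where l: "0 < l" "l \<le> lm" "1 + (\<Sum>c<m. ?wv c) < 2 ^ l" and p: "prepared l ?wv r1 \<mu>1" by blast
    have t1: "t1 \<le> ?t1" using 1 by blast
    interpret dp: dp_context m N E PC L ?wv \<mu>1 inp V n k l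
      by unfold_locales (use p V l in \<open>auto simp: prepared_def base_def\<close>)
    have st: "dp.static r1 \<mu>1" using preparedD[OF p] unfolding dp.static_def by simp
    have z: "\<mu>1 (11 # ks) = 0" for ks using p by (simp add: prepared_def)
    have wt: "isbits \<mu>1 [14, c] l \<and> num \<mu>1 [14, c] l = ?wv c" if "c < m" for c using p that by (simp add: prepared_def)
    have lt: "1 + (\<Sum>j<N. dp.wmax j) < 2 ^ l"
      unfolding dp.wmax_def using wmax_bound[of ?wv] l(3) by linarith
    show ?case
    proof (rule wp_mono[OF wp_frame[OF dp.wp_max[OF st z wt lt]]], goal_cases)
      case (2 r2 \<mu>2 t2)
      then have f2: "frame (sweep max_step) r1 \<mu>1 r2 \<mu>2" and up: "dp.max_upto N \<mu>2"
        and t2: "t2 \<le> k + N * Suc (2 * Suc (k * Suc (k * Suc (4 * l))))" by auto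
      have t2': "t2 \<le> k + N * Suc (2 * Suc (k * Suc (k * Suc (4 * lm))))"
        by (rule order.trans[OF t2]) (intro add_left_mono mult_le_mono2 Suc_leI le_imp_less_Suc, use l in simp)
      have st2: "dp.static r2 \<mu>2"
        by (rule dp.static_cong[OF st]) (use frame_reg[OF f2] frame_mem[OF f2] in \<open>auto simp: sweep_def\<close>)
      show ?case
      proof (rule wp_mono[OF dp.wp_backtrack[OF st2 up]], goal_cases)
        case (1 r3 \<mu>3 t3)
        let ?bs = "dp.best \<mu>2 N 0 0"
        have bs: "?bs \<in> paths nb N" "\<And>bs. bs \<in> paths nb N \<Longrightarrow> dp.wpath bs 0 \<le> dp.wpath ?bs 0"
          using dp.best_props(2)[OF up] by blast+
        have "max_weight_assignment F w (asg ?bs)"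
          by (rule max_weight_asg[OF bs(1)]) (use bs dp.wpath_full in auto)
        moreover have o: "map (\<lambda>j. \<mu>3 [0, j]) [0..<r3 1] = map (\<lambda>v. 1 - rev ?bs ! vpos (xs ! v)) [0..<n]"
        proof -
          have "\<mu>3 [0, v] = 1 - rev ?bs ! vpos (xs ! v)" if "v < n" for v
            using 1 vpos_nth[OF that] by metis
          then show ?thesis using 1 by simp
        qed
        ultimately have ex: "max_weight_assignment F w (asg ?bs) \<and>
            represents_assignment xs (map (\<lambda>j. \<mu>3 [0, j]) [0..<r3 1]) (asg ?bs)"
          unfolding o using represents_asg[of ?bs] by blast
        have "r3 1 = n" "t3 \<le> N" using 1 by auto
        then show ?case using ex add_mono[OF add_mono[OF t1 t2'], of t3 N] by (auto simp only: add.assoc)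
      qed
    qed (use wt in auto)
  qed
qed

section \<open>The time bounds of the three programs\<close>

definition "T = k ^ 2 * s * N"

lemma T_bounds: "1 \<le> T" "N \<le> T" "s \<le> T" "k \<le> T" "m * s \<le> T" "m * m \<le> T" "N * (k ^ 2 * m) \<le> T" "m \<le> T"
    "N * (k ^ 2 * s) = T"
proof -
  have kk: "1 \<le> k ^ 2" "k \<le> k ^ 2" using parameters(4) by (auto simp: power2_eq_square)
  have s1: "1 \<le> s" and N1: "1 \<le> N" using parameters by auto
  show e: "N * (k ^ 2 * s) = T" unfolding T_def by (simp only: ac_simps)
  show "1 \<le> T" unfolding T_def using mult_le_mono[OF mult_le_mono[OF kk(1) s1] N1] by simp
  show "N \<le> T" unfolding T_def using mult_le_mono[OF mult_le_mono[OF kk(1) s1] order_refl[of N]] by simp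
  then show "m \<le> T" by simp
  show "s \<le> T" unfolding T_def using mult_le_mono[OF mult_le_mono[OF kk(1) order_refl[of s]] N1] by simp
  show "k \<le> T" unfolding T_def using mult_le_mono[OF mult_le_mono[OF kk(2) s1] N1] by simp
  have "s * m \<le> 1 * s * N" by simp
  also have "\<dots> \<le> T" unfolding T_def using kk(1) by (intro mult_le_mono1)
  finally show ms: "m * s \<le> T" by (simp only: mult.commute)
  show "m * m \<le> T" using mult_le_mono2[OF parameters(2), of m] ms by linarith
  show "N * (k ^ 2 * m) \<le> T" unfolding e[symmetric] using parameters(2) by (intro mult_le_mono2)
qed

lemma tables_time: "m * Suc s + 3 * N + t + N + 2 * (N * Suc (2 * Suc (k * Suc (m + k * Suc m)))) \<le> t + 28 * T"
proof -
  have "N * Suc (2 * Suc (k * Suc (m + k * Suc m))) \<le> N * (11 * (k ^ 2 * m))"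
    by (rule mult_le_mono2[OF table_cost[OF parameters(4,1)]])
  also have "\<dots> = 11 * (N * (k ^ 2 * m))" by (simp only: mult.left_commute)
  also have "\<dots> \<le> 11 * T" using T_bounds(7) by (rule mult_le_mono2)
  finally have "N * Suc (2 * Suc (k * Suc (m + k * Suc m))) \<le> 11 * T" .
  \<comment> \<open>2 for \<open>m * Suc s\<close>, 4 for the multiples of \<open>N\<close> and 22
    for the two table constructions.\<close>
  moreover have "m * Suc s + 3 * N + t + N + 2 * a \<le> t + 28 * T" if "a \<le> 11 * T" for a
    using that T_bounds(2,5,8) unfolding mult_Suc_right by simp
  ultimately show ?thesis by blast
qed

text \<open>The numbers have \<open>O(s)\<close> bits, so a sweep of \<open>N\<close> levels with at
  most \<open>2 * k ^ 2\<close> big-number steps each costs \<open>O(T)\<close>; here the factor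
  \<open>s\<close> enters.\<close>

lemma sweep_time:
  assumes "Suc x \<le> y * s"
  shows "k + N * Suc (2 * Suc (k * Suc (k * Suc x))) \<le> (7 * y + 1) * T"
proof -
  have "N * Suc (2 * Suc (k * Suc (k * Suc x))) \<le> N * (7 * (k ^ 2 * Suc x))"
    by (rule mult_le_mono2[OF sweep_cost[OF parameters(4)]])
  also have "\<dots> \<le> N * (7 * (k ^ 2 * (y * s)))" using assms by (intro mult_le_mono2)
  also have "\<dots> = 7 * y * T" unfolding T_def by (simp only: ac_simps)
  finally have "N * Suc (2 * Suc (k * Suc (k * Suc x))) \<le> 7 * y * T" .
  then show ?thesis using T_bounds(4) unfolding distrib_right by (simp only: add.commute add_mono mult_1)
qed

lemma count_within:
  assumes "20 ^ prog_esz count_prog + prog_esz count_prog + (tsz count_prog * Suc 70 + 3 * 5 + 5) \<le> c"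
  shows "computes_within (program count_prog) c (k ^ 2 * s * (m + n)) (encode_instance xs cs ls D)
     (\<lambda>out. represents_number out (num_models F))"
  unfolding T_def[symmetric]
proof (rule computes_within_program[where a = 5 and v = 20 and b = 70, OF wf_programs(1) T_bounds(1) _ _ _ _ _ assms])
  let ?ws = "encode_instance xs cs ls D"
  show "length ?ws \<le> 5 * T" unfolding length_instance using T_bounds(1-3) by simp
  show "\<forall>w\<in>set ?ws. w \<le> 20 * T"
  proof
    fix x assume "x \<in> set ?ws"
    then show "x \<le> 20 * T" using instance_values[of x] T_bounds(2,3) by (linarith | simp)
  qed
  have V: "s + 6 * N + 10 \<le> 20 * T" "k \<le> 20 * T" using T_bounds(1-4) by (linarith | simp)+
  show "wp (input_memory ?ws) (20 * T) count_prog
     (\<lambda>r \<mu> t. r 1 \<le> length ?ws \<and> t \<le> 70 * T \<and> represents_number (map (\<lambda>j. \<mu> [0, j]) [0..<r 1]) (num_models F))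
     (\<lambda>_. 0) (\<lambda>_. 0)"
  proof (rule wp_mono[OF wp_count_prog[OF seg_input_memory V]], goal_cases)
    case (1 r \<mu> t)
    \<comment> \<open>From \<open>m + n <= 2 * s\<close> and \<open>1 <= s\<close>; the factor 4
      gives \<open>7 * 4 + 1 = 29\<close>.\<close>
    have "Suc (N + 1) \<le> 4 * s" using parameters by (linarith | simp)
    from sweep_time[OF this] have "k + N * Suc (2 * Suc (k * Suc (k * Suc (N + 1)))) \<le> 29 * T" by simp
    then have "t \<le> 70 * T" using 1 tables_time[of 0] T_bounds(1,2) by (linarith | simp)
    moreover have "r 1 \<le> length ?ws" unfolding length_instance using 1 parameters by (linarith | simp)
    ultimately show ?case using 1 by blast
  qed
qed simp_all

lemma unit_within:
  assumes "20 ^ prog_esz (max_prog unit_weights) + prog_esz (max_prog unit_weights) +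
     (tsz (max_prog unit_weights) * Suc 130 + 3 * 5 + 5) \<le> c"
  shows "computes_within (program (max_prog unit_weights)) c (k ^ 2 * s * (m + n)) (encode_instance xs cs ls D)
     (\<lambda>out. \<exists>\<tau>. max_weight_assignment F (\<lambda>_. 1) \<tau> \<and> represents_assignment xs out \<tau>)"
  unfolding T_def[symmetric]
proof (rule computes_within_program[where a = 5 and v = 20 and b = 130, OF _ T_bounds(1) _ _ _ _ _ assms])
  let ?ws = "encode_instance xs cs ls D"
  show "wf_prog (max_prog unit_weights)" by (rule wf_programs) simp
  show "length ?ws \<le> 5 * T" unfolding length_instance using T_bounds(1-3) by simp
  show "\<forall>w\<in>set ?ws. w \<le> 20 * T"
  proof
    fix x assume "x \<in> set ?ws"
    then show "x \<le> 20 * T" using instance_values[of x] T_bounds(2,3) by (linarith | simp)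
  qed
  have V: "s + 6 * N + 10 \<le> 20 * T" "k \<le> 20 * T" "m + 2 \<le> 20 * T" using T_bounds by (linarith | simp)+
  have l: "1 + (\<Sum>c<m. (1::nat)) < 2 ^ (m + 2)" using prod_sum_less_power[of m "\<lambda>_. 1" 1] by (simp add: add.commute)
  show "wp (input_memory ?ws) (20 * T) (max_prog unit_weights)
     (\<lambda>r \<mu> t. r 1 \<le> length ?ws \<and> t \<le> 130 * T \<and>
       (\<exists>\<tau>. max_weight_assignment F (\<lambda>_. 1) \<tau> \<and> represents_assignment xs (map (\<lambda>j. \<mu> [0, j]) [0..<r 1]) \<tau>))
     (\<lambda>_. 0) (\<lambda>_. 0)"
  proof (rule wp_mono[OF wp_max_prog[where ws = "[]" and w = "\<lambda>_. 1" and TW = m, OF _ V]], goal_cases)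
    case 1
    show ?case using seg_input_memory[of ?ws] by simp
  next
    case (2 r \<mu>)
    show ?case by (rule wp_mono, rule wp_unit_weights, rule 2(1), rule 2(4), rule V(3)) (use l in auto)
  next
    case (5 r \<mu> t)
    \<comment> \<open>\<open>4 * m + 9 <= 13 * s\<close>, and
      \<open>7 * 13 + 1 = 92\<close>.\<close>
    have "Suc (4 * (m + 2)) \<le> 13 * s" using parameters by (linarith | simp)
    from sweep_time[OF this] have "k + N * Suc (2 * Suc (k * Suc (k * Suc (4 * (m + 2))))) \<le> 92 * T" by simp
    then have "t \<le> 130 * T" using 5 tables_time[of m] T_bounds by (linarith | simp)
    moreover have "r 1 \<le> length ?ws" unfolding length_instance using 5 parameters by (linarith | simp)
    ultimately show ?case using 5 by blast
  qed simp_all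
qed simp_all

lemma less_power_binary: "x < 2 ^ length (binary x)"
proof (induction x rule: binary.induct)
  case (1 x)
  then show ?case by (cases "x = 0") (auto simp: binary_pos)
qed

text \<open>By the bound on the total weight, a single weight has at most \<open>d * m + 1\<close>
  bits, so entries have \<open>O(s)\<close> bits for fixed \<open>d\<close>. Only the constant
  depends on \<open>d\<close>; the program takes the lengths of the weights from its input.\<close>

lemma weights_within:
  assumes w: "(\<Sum>C\<in>cla F. w C) \<le> 2 ^ (d * m)"
    and c: "(2 * d + 20) ^ prog_esz (max_prog read_weights) + prog_esz (max_prog read_weights) +
     (tsz (max_prog read_weights) * Suc (30 * d + 130) + 3 * (d + 7) + 5) \<le> c"
  shows "computes_within (program (max_prog read_weights)) c (k ^ 2 * s * (m + n)) (encode_instance xs cs ls D @ encode_weights cs w)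
     (\<lambda>out. \<exists>\<tau>. max_weight_assignment F w \<tau> \<and> represents_assignment xs out \<tau>)"
  unfolding T_def[symmetric]
proof (rule computes_within_program[where a = "d + 7" and v = "2 * d + 20" and b = "30 * d + 130", OF _ T_bounds(1) _ _ _ _ _ c])
  let ?f = "\<lambda>c. w (cs ! c)"
  let ?g = "\<lambda>c. length (binary (?f c)) # binary (?f c)"
  let ?S = "d * m + 1"
  let ?ws = "encode_instance xs cs ls D @ encode_weights cs w"
  have enc: "encode_weights cs w = concat (map ?g [0..<m])"
  proof -
    have "map (\<lambda>c. length (binary (w c)) # binary (w c)) cs = map ?g [0..<m]"
      using inst_facts(14) by (intro nth_equalityI) auto
    then show ?thesis unfolding encode_weights_def by simp
  qed
  have S: "length (binary (?f c)) \<le> ?S" if "c < m" for c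
  proof (rule length_binary)
    have "?f c \<le> (\<Sum>C\<in>cla F. w C)" using cs_nth(1)[OF that] inst_facts(16) by (intro member_le_sum) auto
    also have "\<dots> \<le> 2 ^ (d * m)" by (rule w)
    also have "\<dots> < 2 ^ ?S" by simp
    finally show "?f c < 2 ^ ?S" .
  qed
  have mS: "m * Suc ?S \<le> (d + 2) * T"
  proof -
    have "m * Suc ?S = d * (m * m) + 2 * m" by (simp add: algebra_simps)
    also have "\<dots> \<le> d * T + 2 * T" using T_bounds by (intro add_mono mult_le_mono2) auto
    finally show ?thesis by (simp add: algebra_simps)
  qed
  have dm: "d * m \<le> d * T" using T_bounds by (intro mult_le_mono2) auto
  have lw: "length (encode_weights cs w) \<le> (d + 2) * T"
  proof -
    have "length (concat (map ?g [0..<j])) \<le> j * Suc ?S" if "j \<le> m" for j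
      using that
    proof (induction j)
      case (Suc j)
      then have "length (?g j) \<le> Suc ?S" "length (concat (map ?g [0..<j])) \<le> j * Suc ?S" using S[of j] by auto
      then show ?case unfolding mult_Suc by simp
    qed simp
    from this[of m] show ?thesis unfolding enc using mS by (linarith | simp)
  qed
  show "wf_prog (max_prog read_weights)" by (rule wf_programs) simp
  show "length ?ws \<le> (d + 7) * T"
    using lw T_bounds(1-3) unfolding length_append length_instance distrib_right by (linarith | simp)
  show "\<forall>x\<in>set ?ws. x \<le> (2 * d + 20) * T"
  proof
    fix x assume "x \<in> set ?ws"
    moreover have "x \<le> ?S" if "x \<in> set (encode_weights cs w)"
      using that S binary_bits unfolding enc by fastforce
    ultimately have "x \<le> s + 2 * N \<or> x \<le> ?S" using instance_values by auto
    moreover have "s + 2 * N \<le> (2 * d + 20) * T" "?S \<le> (2 * d + 20) * T"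
      using T_bounds(1-3) dm unfolding distrib_right mult.assoc by (linarith | simp)+
    ultimately show "x \<le> (2 * d + 20) * T" by auto
  qed
  have V: "s + 6 * N + 10 \<le> (2 * d + 20) * T" "k \<le> (2 * d + 20) * T" "?S + m + 1 \<le> (2 * d + 20) * T"
    using T_bounds(1-4,8) dm unfolding distrib_right mult.assoc by (linarith | simp)+
  show "wp (input_memory ?ws) ((2 * d + 20) * T) (max_prog read_weights)
     (\<lambda>r \<mu> t. r 1 \<le> length ?ws \<and> t \<le> (30 * d + 130) * T \<and>
       (\<exists>\<tau>. max_weight_assignment F w \<tau> \<and> represents_assignment xs (map (\<lambda>j. \<mu> [0, j]) [0..<r 1]) \<tau>))
     (\<lambda>_. 0) (\<lambda>_. 0)"
  proof (rule wp_mono[OF wp_max_prog[where ws = "encode_weights cs w" and w = w and TW = "m * Suc ?S", OF seg_input_memory V]], goal_cases)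
    case (1 r \<mu>)
    have "2 + s + 3 * N + x + m + (y + 1) + 2 \<le> 2 * z + 20 * T" if "x \<le> z + 2 * T" "y \<le> z" for x y z
      using that T_bounds(1-3,8) by simp
    from this[OF lw[unfolded distrib_right enc] dm]
    have "r 5 + length (concat (map ?g [0..<m])) + m + ?S + 2 \<le> (2 * d + 20) * T"
      unfolding 1(3) distrib_right mult.assoc .
    note room = this
    show ?case
    proof (rule wp_mono[OF wp_read_weights[where f = ?f and m = m and S = ?S]], goal_cases)
      case 1
      show ?case using \<open>seg _ (r 5) _\<close> unfolding enc .
    next
      case 2
      show ?case by (rule \<open>r 2 = m\<close>)
    next
      case (3 ks)
      show ?case by (rule 1(4))
    next
      case 4
      show ?case by (rule room)
    next
      case (5 c)
      then show ?case by (rule S)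
    next
      case (6 r' \<mu>' t)
      then obtain l where l: "r' 25 = l + m + 1" "l \<le> ?S" "t \<le> m * Suc ?S"
        "\<And>c. c < m \<Longrightarrow> length (binary (?f c)) \<le> l \<and> isbits \<mu>' [14, c] (l + m + 1) \<and> num \<mu>' [14, c] (l + m + 1) = ?f c"
        by blast
      have "?f c < 2 ^ l" if "c < m" for c
        using less_power_binary[of "?f c"] l(4)[OF that] power_increasing[of "length (binary (?f c))" l "2::nat"] by (linarith | simp)
      then have "1 + (\<Sum>c<m. ?f c) < 2 ^ (l + m + 1)" by (rule prod_sum_less_power)
      then show ?case using l by simp
    qed
  next
    case (4 r \<mu> t)
    have "d * m \<le> d * s" using parameters(2) by (rule mult_le_mono2)
    moreover have "Suc (4 * (x + 1 + m + 1)) \<le> 4 * y + 13 * s" if "x \<le> y" for x y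
      using that parameters by simp
    ultimately have "Suc (4 * (?S + m + 1)) \<le> (4 * d + 13) * s" unfolding distrib_right mult.assoc by blast
    from sweep_time[OF this]
    have sw: "k + N * Suc (2 * Suc (k * Suc (k * Suc (4 * (?S + m + 1))))) \<le> 28 * (d * T) + 92 * T"
      by (simp add: algebra_simps)
    have "t \<le> ((d + 2) * T + 28 * T) + (28 * (d * T) + 92 * T) + T"
      using 4 tables_time[of "m * Suc ?S"] sw mS T_bounds(2) by (linarith | simp)
    then have "t \<le> (30 * d + 130) * T" unfolding distrib_right mult.assoc by (linarith | simp)
    moreover have "r 1 \<le> length ?ws" unfolding length_append length_instance using 4 parameters by (linarith | simp)
    ultimately show ?case using 4 by blast
  qed simp_all
qed simp_all

end

theorem theorem4:
  shows
    "(\<exists>P c. \<forall>F D xs cs ls n m s k. linear_instance F D xs cs ls n m s k \<longrightarrow>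
       computes_within P c (k ^ 2 * s * (m + n)) (encode_instance xs cs ls D)
         (\<lambda>out. represents_number out (num_models F))) \<and>
     (\<exists>P c. \<forall>F D xs cs ls n m s k. linear_instance F D xs cs ls n m s k \<longrightarrow>
       computes_within P c (k ^ 2 * s * (m + n)) (encode_instance xs cs ls D)
         (\<lambda>out. \<exists>\<tau>. max_weight_assignment F (\<lambda>_. 1) \<tau> \<and> represents_assignment xs out \<tau>)) \<and>
     (\<exists>P. \<forall>d. \<exists>c. \<forall>F D xs cs ls n m s k w. linear_instance F D xs cs ls n m s k \<longrightarrow>
       (\<Sum>C\<in>cla F. w C) \<le> 2 ^ (d * m) \<longrightarrow>
       computes_within P c (k ^ 2 * s * (m + n))
         (encode_instance xs cs ls D @ encode_weights cs w)
         (\<lambda>out. \<exists>\<tau>. max_weight_assignment F w \<tau> \<and> represents_assignment xs out \<tau>))"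
proof (intro conjI)
  show "\<exists>P c. \<forall>F D xs cs ls n m s k. linear_instance F D xs cs ls n m s k \<longrightarrow>
       computes_within P c (k ^ 2 * s * (m + n)) (encode_instance xs cs ls D)
         (\<lambda>out. represents_number out (num_models F))"
    using lin_inst.count_within[OF lin_inst.intro order_refl] by blast
  show "\<exists>P c. \<forall>F D xs cs ls n m s k. linear_instance F D xs cs ls n m s k \<longrightarrow>
       computes_within P c (k ^ 2 * s * (m + n)) (encode_instance xs cs ls D)
         (\<lambda>out. \<exists>\<tau>. max_weight_assignment F (\<lambda>_. 1) \<tau> \<and> represents_assignment xs out \<tau>)"
    using lin_inst.unit_within[OF lin_inst.intro order_refl] by blast
  show "\<exists>P. \<forall>d. \<exists>c. \<forall>F D xs cs ls n m s k w. linear_instance F D xs cs ls n m s k \<longrightarrow>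
       (\<Sum>C\<in>cla F. w C) \<le> 2 ^ (d * m) \<longrightarrow>
       computes_within P c (k ^ 2 * s * (m + n))
         (encode_instance xs cs ls D @ encode_weights cs w)
         (\<lambda>out. \<exists>\<tau>. max_weight_assignment F w \<tau> \<and> represents_assignment xs out \<tau>)"
    using lin_inst.weights_within[OF lin_inst.intro _ order_refl] by blast
qed

end
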